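(* Let $\mathbf Y=\mathbf H(\mathcal Z,\mathbf Y)$ be a well-founded system, $\mathbf H=(\mathcal H_1,\dots,\mathcal H_m)$, and let $\mathbf S$ be its solution (with $\mathbf S(\mathbf 0)=\mathbf H^m(\mathbf 0,\mathbf 0)$). Let $\boldsymbol H(z,\boldsymbol y)$ be the exponential generating series of $\mathbf H$ and define $$\boldsymbol N_{\mathbf H}(z,\boldsymbol Y)=\boldsymbol Y+\Big(\mathrm{Id}-\frac{\partial\boldsymbol H}{\partial\boldsymbol Y}(z,\boldsymbol Y)\Big)^{-1}\big(\boldsymbol H(z,\boldsymbol Y)-\boldsymbol Y\big),$$ $$\boldsymbol\Phi_{\mathcal N_{\mathbf H}}(z,\boldsymbol Y)=\boldsymbol Y+\Big(\mathrm{Id}-\boldsymbol\Phi_{\partial\mathbf H/\partial\mathbf Y}(z,\boldsymbol Y)\Big)^{-1}\big(\boldsymbol\Phi_{\mathbf H}(z,\boldsymbol Y)-\boldsymbol Y\big).$$ Then the iterations $\boldsymbol Y^{[n+1]}(z)=\boldsymbol N_{\mathbf H}(z,\boldsymbol Y^{[n]}(z))$ and $\boldsymbol Y^{[n+1]}(z)=\boldsymbol\Phi_{\mathcal N_{\mathbf H}}(z,\boldsymbol Y^{[n]}(z))$, both started at $\boldsymbol Y^{[0]}(z)=\mathbf 0$, converge quadratically (in the $z$-adic sense), respectively to the exponential generating series $\boldsymbol S(z)$ and to the ordinary generating series $\tilde{\boldsymbol S}(z)$ of $\mathbf S$.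
   Context: Species: functorial assignments of finite sets of structures to tuples of finite sets, up to isomorphism, with the standard operations (sum, product, composition, partial derivatives, Jacobian matrix). \emph{Well founded}: the iteration $\mathbf Z^{[0]}=\mathbf 0$, $\mathbf Z^{[n+1]}=\mathbf H(\mathcal Z,\mathbf Z^{[n]})$ is well defined (composition with species having structures on the empty set being allowed only in sorts in which $\mathbf H$ is polynomial, i.e. has finitely many structures of each total size in the other sorts), converges (eventual contact — isomorphism up to size $p$ — of every order), and has a limit with no empty coordinate; $\mathbf H^m(\mathbf 0,\mathbf 0)$ is the $m$-th iterate of $\mathbf Y\mapsto\mathbf H(\mathbf 0,\mathbf Y)$ from $\mathbf 0$. The exponential generating series of a multisort species $\mathcal F$ is $\sum f_{\mathbf n}\mathbf z^{\mathbf n}/\mathbf n!$ with $f_{\mathbf n}$ the number of structures on $(\{1..n_1\},\dots)$; the ordinary generating series counts isomorphism classes of structures. The cycle index series of a $k$-sort species $\mathcal F$ is $Z_{\mathcal F}=\sum_{\mathbf n}\frac{1}{n_1!\cdots n_k!}\sum_{\sigma_1,\dots,\sigma_k}\mathrm{fix}\,\mathcal F[\sigma_1,\dots,\sigma_k]\prod_{i,j}x_{i,j}^{c_j(\sigma_i)}$, sum over permutations $\sigma_i$ of $\{1..n_i\}$, $c_j(\sigma)$ the number of $j$-cycles, $\mathrm{fix}$ the number of fixed structures. The Pólya operator of $\mathcal F(\mathcal Z,\mathcal Y_1,\dots,\mathcal Y_m)$ sends power series $Y_1,\dots,Y_m$ to $\Phi_{\mathcal F}(z,\boldsymbol Y)=Z_{\mathcal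 F}$ evaluated at $x_{0,j}=z^j$, $x_{i,j}=Y_i(z^j)$ (so that it maps ordinary generating series of species $\mathcal U_i$ to that of $\mathcal F(\mathcal Z,\boldsymbol{\mathcal U})$); it is applied entrywise to vectors and matrices. Quadratic convergence: the number of coefficients agreeing with the limit at least doubles at each step.
   Formalization: The exponential part additionally assumes that no H_i-structure is fixed by a nontrivial relabelling of only those sorts Y_j with S_j(0) ≠ 0; without it the claim fails, e.g. H_1 = 1, H_2 = Z·E_2(Y_1), where the iteration tends to (1, z/2), not (1, z). The ordinary part is unchanged. *)

theory Defs
  imports
    "HOL-Analysis.Analysis"
    "HOL-Library.Disjoint_Sets"
    "HOL-Library.Countable_Set"
    "HOL-Computational_Algebra.Formal_Power_Series"
    "HOL-Combinatorics.Orbits"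
    "HOL-Combinatorics.Permutations"
begin

section \<open>Multisort species\<close>

text \<open>
  Sorts are the elements of a finite type \<open>'s\<close>. Labels are natural numbers: the finite subsets of
  \<open>nat\<close> with bijections form a category equivalent to that of all finite sets with bijections.
  A tuple of bijections \<open>\<sigma>\<close> with source \<open>U\<close> has target \<open>\<lambda>i. \<sigma> i ` U i\<close>; since HOL functions are
  total, only the values of \<open>\<sigma> i\<close> on \<open>U i\<close> may matter, and the source is an explicit argument of
  \<open>transport\<close>.
\<close>

record ('s, 'x) species =
  structs :: "('s \<Rightarrow> nat set) \<Rightarrow> 'x set"
  transport :: "('s \<Rightarrow> nat set) \<Rightarrow> ('s \<Rightarrow> nat \<Rightarrow> nat) \<Rightarrow> 'x \<Rightarrow> 'x"

definition finite_tuple :: "('s \<Rightarrow> nat set) \<Rightarrow> bool" where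
  "finite_tuple U \<longleftrightarrow> (\<forall>i. finite (U i))"

definition bij_tuple :: "('s \<Rightarrow> nat \<Rightarrow> nat) \<Rightarrow> ('s \<Rightarrow> nat set) \<Rightarrow> ('s \<Rightarrow> nat set) \<Rightarrow> bool" where
  "bij_tuple \<sigma> U V \<longleftrightarrow> (\<forall>i. bij_betw (\<sigma> i) (U i) (V i))"

definition is_species :: "('s, 'x) species \<Rightarrow> bool" where
  "is_species F \<longleftrightarrow>
     (\<forall>U. finite_tuple U \<longrightarrow> finite (structs F U)) \<and>
     (\<forall>U V \<sigma>. finite_tuple U \<longrightarrow> bij_tuple \<sigma> U V \<longrightarrow>
        (\<forall>x \<in> structs F U. transport F U \<sigma> x \<in> structs F V)) \<and>
     (\<forall>U V \<sigma> \<tau>. finite_tuple U \<longrightarrow> bij_tuple \<sigma> U V \<longrightarrow> (\<forall>i. \<forall>a \<in> U i. \<sigma> i a = \<tau> i a) \<longrightarrow>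
        (\<forall>x \<in> structs F U. transport F U \<sigma> x = transport F U \<tau> x)) \<and>
     (\<forall>U. finite_tuple U \<longrightarrow> (\<forall>x \<in> structs F U. transport F U (\<lambda>i. id) x = x)) \<and>
     (\<forall>U V W \<sigma> \<tau>. finite_tuple U \<longrightarrow> bij_tuple \<sigma> U V \<longrightarrow> bij_tuple \<tau> V W \<longrightarrow>
        (\<forall>x \<in> structs F U.
           transport F U (\<lambda>i. \<tau> i \<circ> \<sigma> i) x = transport F V \<tau> (transport F U \<sigma> x)))"

definition species_iso :: "('s, 'x) species \<Rightarrow> ('s, 'y) species \<Rightarrow> bool" (infix \<open>\<simeq>\<^sub>s\<close> 50) where
  "F \<simeq>\<^sub>s G \<longleftrightarrow>
     (\<exists>\<phi>. (\<forall>U. finite_tuple U \<longrightarrow> bij_betw (\<phi> U) (structs F U) (structs G U)) \<and>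
          (\<forall>U V \<sigma>. finite_tuple U \<longrightarrow> bij_tuple \<sigma> U V \<longrightarrow>
             (\<forall>x \<in> structs F U. \<phi> V (transport F U \<sigma> x) = transport G U \<sigma> (\<phi> U x))))"

definition empty_species :: "('s, nat) species" where
  "empty_species = \<lparr>structs = \<lambda>U. {}, transport = \<lambda>U \<sigma> x. x\<rparr>"

definition singleton_species :: "(unit, nat) species" where
  "singleton_species = \<lparr>structs = \<lambda>U. if card (U ()) = 1 then {0} else {}, transport = \<lambda>U \<sigma> x. x\<rparr>"

definition std :: "('s \<Rightarrow> nat) \<Rightarrow> 's \<Rightarrow> nat set" where
  "std n i = {1..n i}"

abbreviation empty_structs :: "('s, 'x) species \<Rightarrow> 'x set" where
  "empty_structs F \<equiv> structs F (\<lambda>i. {})"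

text \<open>The adjoined point is \<open>0\<close>; the old labels of sort \<open>i\<close> are shifted by one to make room for it.\<close>

definition add_point :: "'s \<Rightarrow> ('s \<Rightarrow> nat set) \<Rightarrow> 's \<Rightarrow> nat set" where
  "add_point i U = U(i := insert 0 (Suc ` U i))"

definition partial_deriv :: "'s \<Rightarrow> ('s, 'x) species \<Rightarrow> ('s, 'x) species" where
  "partial_deriv i F =
     \<lparr>structs = \<lambda>U. structs F (add_point i U),
      transport = \<lambda>U \<sigma>. transport F (add_point i U) (\<sigma>(i := case_nat 0 (\<lambda>a. Suc (\<sigma> i a))))\<rparr>"


section \<open>Composition\<close>

text \<open>
  A representative of an \<open>F(G)\<close>-structure on \<open>U\<close> is \<open>(n, h, B, g)\<close>: an \<open>F\<close>-structure \<open>h\<close> on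
  \<open>({1..n i})\<^sub>i\<close>, and for each label \<open>a\<close> of sort \<open>i\<close> a block \<open>B i a\<close> with a \<open>G i\<close>-structure \<open>g i a\<close> on
  it, the blocks partitioning \<open>U\<close>. Two representatives are identified when they differ by a
  relabelling of \<open>({1..n i})\<^sub>i\<close>, i.e. \<open>F(G) = \<Sum>\<^sub>n (F[n] \<times> G\<^sup>n) / S\<^sub>n\<close>. If no \<open>G i\<close> has structures on
  the empty set this is the usual sum over set partitions; the quotient form also makes sense for
  empty blocks.
\<close>

type_synonym ('s, 'x, 't, 'y) comp_rep =
  "('s \<Rightarrow> nat) \<times> 'x \<times> ('s \<Rightarrow> nat \<Rightarrow> 't \<Rightarrow> nat set) \<times> ('s \<Rightarrow> nat \<Rightarrow> 'y)"

definition comp_reps ::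
  "('s, 'x) species \<Rightarrow> ('s \<Rightarrow> ('t, 'y) species) \<Rightarrow> ('t \<Rightarrow> nat set) \<Rightarrow> ('s, 'x, 't, 'y) comp_rep set" where
  "comp_reps F G U =
     {(n, h, B, g).
        h \<in> structs F (std n) \<and>
        (\<forall>i. \<forall>a \<in> std n i. g i a \<in> structs (G i) (B i a)) \<and>
        (\<forall>t. (\<Union>i. \<Union>a \<in> std n i. B i a t) = U t \<and>
             disjoint_family_on (\<lambda>(i, a). B i a t) (SIGMA i:UNIV. std n i))}"

definition comp_rel ::
  "('s, 'x) species \<Rightarrow> ('s \<Rightarrow> ('t, 'y) species) \<Rightarrow> ('t \<Rightarrow> nat set) \<Rightarrow> ('s, 'x, 't, 'y) comp_rep rel" where
  "comp_rel F G U =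
     {((n, h, B, g), (n', h', B', g')).
        (n, h, B, g) \<in> comp_reps F G U \<and> (n', h', B', g') \<in> comp_reps F G U \<and> n' = n \<and>
        (\<exists>\<sigma>. bij_tuple \<sigma> (std n) (std n) \<and> h' = transport F (std n) \<sigma> h \<and>
             (\<forall>i. \<forall>a \<in> std n i. B' i (\<sigma> i a) = B i a \<and> g' i (\<sigma> i a) = g i a))}"

definition comp_rep_transport ::
  "('s \<Rightarrow> ('t, 'y) species) \<Rightarrow> ('t \<Rightarrow> nat \<Rightarrow> nat) \<Rightarrow> ('s, 'x, 't, 'y) comp_rep \<Rightarrow> ('s, 'x, 't, 'y) comp_rep"
where
  "comp_rep_transport G \<tau> =
     (\<lambda>(n, h, B, g). (n, h, \<lambda>i a t. \<tau> t ` B i a t, \<lambda>i a. transport (G i) (B i a) \<tau> (g i a)))"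

definition comp_classes ::
  "('s, 'x) species \<Rightarrow> ('s \<Rightarrow> ('t, 'y) species) \<Rightarrow> ('t, ('s, 'x, 't, 'y) comp_rep set) species" where
  "comp_classes F G =
     \<lparr>structs = \<lambda>U. comp_reps F G U // comp_rel F G U,
      transport = \<lambda>U \<tau> C. comp_rel F G (\<lambda>t. \<tau> t ` U t) `` (comp_rep_transport G \<tau> ` C)\<rparr>"

text \<open>
  Structures are renamed to natural numbers (one finite set of structures at a time), so that
  composition can be iterated at a fixed type.
\<close>

definition recode :: "('s, 'x) species \<Rightarrow> ('s, nat) species" where
  "recode F =
     \<lparr>structs = \<lambda>U. to_nat_on (structs F U) ` structs F U,
      transport = \<lambda>U \<sigma> k. to_nat_on (structs F (\<lambda>i. \<sigma> i ` U i))
                             (transport F U \<sigma> (from_nat_into (structs F U) k))\<rparr>"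

definition compose :: "('s, 'x) species \<Rightarrow> ('s \<Rightarrow> ('t, 'y) species) \<Rightarrow> ('t, nat) species" where
  "compose F G = recode (comp_classes F G)"

definition polynomial_in :: "('s::finite, 'x) species \<Rightarrow> 's set \<Rightarrow> bool" where
  "polynomial_in F P \<longleftrightarrow>
     (\<forall>k. finite (SIGMA n:{n. (\<Sum>i\<in>-P. n i) = k}. structs F (std n)))"

definition composable :: "('s::finite, 'x) species \<Rightarrow> ('s \<Rightarrow> ('t, 'y) species) \<Rightarrow> bool" where
  "composable F G \<longleftrightarrow> polynomial_in F {i. empty_structs (G i) \<noteq> {}}"


section \<open>Well-founded systems\<close>

definition truncate_species :: "nat \<Rightarrow> ('s::finite, 'x) species \<Rightarrow> ('s, 'x) species" where
  "truncate_species p F =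
     \<lparr>structs = \<lambda>U. if (\<Sum>i\<in>UNIV. card (U i)) \<le> p then structs F U else {},
      transport = transport F\<rparr>"

definition contact :: "nat \<Rightarrow> ('s::finite, 'x) species \<Rightarrow> ('s, 'y) species \<Rightarrow> bool" where
  "contact p F G \<longleftrightarrow> truncate_species p F \<simeq>\<^sub>s truncate_species p G"

definition species_limit ::
  "(nat \<Rightarrow> 'm \<Rightarrow> ('s::finite, 'x) species) \<Rightarrow> ('m \<Rightarrow> ('s, 'y) species) \<Rightarrow> bool" where
  "species_limit Z L \<longleftrightarrow> (\<forall>p. \<exists>N. \<forall>n\<ge>N. \<forall>i. contact p (Z n i) (L i))"

text \<open>A system has type \<open>'m \<Rightarrow> ('m option, 'x) species\<close>: sort \<open>None\<close> is \<open>\<Z>\<close>, sort \<open>Some i\<close> is \<open>\<Y>\<^sub>i\<close>.\<close>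

definition apply_system ::
  "('m \<Rightarrow> ('m option, 'x) species) \<Rightarrow> ('t, 'y) species \<Rightarrow> ('m \<Rightarrow> ('t, 'y) species) \<Rightarrow> 'm \<Rightarrow> ('t, nat) species"
where
  "apply_system H A Y i = compose (H i) (case_option A Y)"

primrec system_iter ::
  "('m \<Rightarrow> ('m option, 'x) species) \<Rightarrow> ('t, nat) species \<Rightarrow> nat \<Rightarrow> 'm \<Rightarrow> ('t, nat) species"
where
  "system_iter H A 0 = (\<lambda>i. empty_species)"
| "system_iter H A (Suc n) = apply_system H A (system_iter H A n)"

definition well_founded_system :: "('m::finite \<Rightarrow> ('m option, 'x) species) \<Rightarrow> bool" where
  "well_founded_system H \<longleftrightarrow>
     (\<forall>n i. composable (H i) (case_option singleton_species (system_iter H singleton_species n))) \<and>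
     (\<exists>L :: 'm \<Rightarrow> (unit, nat) species.
        (\<forall>i. is_species (L i)) \<and>
        species_limit (system_iter H singleton_species) L \<and>
        (\<forall>i. \<exists>U. finite_tuple U \<and> structs (L i) U \<noteq> {}))"

text \<open>
  \<open>S\<close> may have any type of structures, so it is recoded before being substituted along with \<open>\<Z>\<close>.
  The last condition is \<open>S(0) = H\<^sup>m(0, 0)\<close>.
\<close>

definition system_solution ::
  "('m::finite \<Rightarrow> ('m option, 'x) species) \<Rightarrow> ('m \<Rightarrow> (unit, 'y) species) \<Rightarrow> bool" where
  "system_solution H S \<longleftrightarrow>
     (\<forall>i. is_species (S i)) \<and>
     (\<forall>i. composable (H i) (case_option singleton_species (\<lambda>j. recode (S j)))) \<and>
     (\<forall>i. S i \<simeq>\<^sub>s apply_system H singleton_species (\<lambda>j. recode (S j)) i) \<and>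
     (\<forall>i. compose (S i) (\<lambda>_. empty_species :: (unit, nat) species)
            \<simeq>\<^sub>s system_iter H (empty_species :: (unit, nat) species) CARD('m) i)"


section \<open>Generating series\<close>

text \<open>
  A formal power series in the indeterminates indexed by \<open>'s\<close> is given by its coefficient function
  of type \<open>('s \<Rightarrow> nat) \<Rightarrow> rat\<close>.
\<close>

definition egf :: "('s::finite, 'x) species \<Rightarrow> ('s \<Rightarrow> nat) \<Rightarrow> rat" where
  "egf F n = of_nat (card (structs F (std n))) / (\<Prod>i\<in>UNIV. fact (n i))"

definition ogf :: "('s, 'x) species \<Rightarrow> ('s \<Rightarrow> nat) \<Rightarrow> rat" where
  "ogf F n =
     of_nat (card (structs F (std n) //
       {(x, y). x \<in> structs F (std n) \<and>
                (\<exists>\<sigma>. bij_tuple \<sigma> (std n) (std n) \<and> y = transport F (std n) \<sigma> x)}))"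

definition univariate :: "((unit \<Rightarrow> nat) \<Rightarrow> rat) \<Rightarrow> rat fps" where
  "univariate f = Abs_fps (\<lambda>n. f (\<lambda>_. n))"

definition series_deriv :: "'s \<Rightarrow> (('s \<Rightarrow> nat) \<Rightarrow> rat) \<Rightarrow> ('s \<Rightarrow> nat) \<Rightarrow> rat" where
  "series_deriv i f n = of_nat (n i + 1) * f (n(i := n i + 1))"

definition locally_finite :: "('a \<Rightarrow> rat fps) \<Rightarrow> bool" where
  "locally_finite f \<longleftrightarrow> (\<forall>k. finite {a. fps_nth (f a) k \<noteq> 0})"

definition fps_Sum :: "('a \<Rightarrow> rat fps) \<Rightarrow> rat fps" where
  "fps_Sum f = Abs_fps (\<lambda>k. \<Sum>a | fps_nth (f a) k \<noteq> 0. fps_nth (f a) k)"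

definition series_term :: "(('s::finite \<Rightarrow> nat) \<Rightarrow> rat) \<Rightarrow> ('s \<Rightarrow> rat fps) \<Rightarrow> ('s \<Rightarrow> nat) \<Rightarrow> rat fps" where
  "series_term f Y n = fps_const (f n) * (\<Prod>i\<in>UNIV. Y i ^ n i)"

definition series_eval :: "(('s::finite \<Rightarrow> nat) \<Rightarrow> rat) \<Rightarrow> ('s \<Rightarrow> rat fps) \<Rightarrow> rat fps" where
  "series_eval f Y = fps_Sum (series_term f Y)"

definition num_cycles :: "nat \<Rightarrow> nat \<Rightarrow> (nat \<Rightarrow> nat) \<Rightarrow> nat" where
  "num_cycles n j \<sigma> = card {C \<in> orbit \<sigma> ` {1..n}. card C = j}"

definition num_fixed :: "('s, 'x) species \<Rightarrow> ('s \<Rightarrow> nat) \<Rightarrow> ('s \<Rightarrow> nat \<Rightarrow> nat) \<Rightarrow> nat" where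
  "num_fixed F n \<sigma> = card {x \<in> structs F (std n). transport F (std n) \<sigma> x = x}"

text \<open>
  The cycle index series with the value \<open>x i j\<close> substituted for the indeterminate \<open>x\<^sub>i\<^sub>,\<^sub>j\<close>: its
  contribution of multidegree \<open>n\<close>, and the sum over all \<open>n\<close>.
\<close>

definition cycle_index_term ::
  "('s::finite, 'x) species \<Rightarrow> ('s \<Rightarrow> nat \<Rightarrow> rat fps) \<Rightarrow> ('s \<Rightarrow> nat) \<Rightarrow> rat fps" where
  "cycle_index_term F x n =
     fps_const (1 / (\<Prod>i\<in>UNIV. fact (n i))) *
     (\<Sum>\<sigma> | \<forall>i. \<sigma> i permutes {1..n i}.
        of_nat (num_fixed F n \<sigma>) * (\<Prod>i\<in>UNIV. \<Prod>j\<in>{1..n i}. x i j ^ num_cycles (n i) j (\<sigma> i)))"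

definition cycle_index_eval :: "('s::finite, 'x) species \<Rightarrow> ('s \<Rightarrow> nat \<Rightarrow> rat fps) \<Rightarrow> rat fps" where
  "cycle_index_eval F x = fps_Sum (cycle_index_term F x)"

definition with_z :: "rat fps ^ 'm \<Rightarrow> 'm option \<Rightarrow> rat fps" where
  "with_z Y = case_option fps_X (\<lambda>i. Y $ i)"

text \<open>\<open>dilate Y i j\<close> is \<open>Y\<^sub>i(z\<^sup>j)\<close>, with \<open>Y\<^sub>0(z) = z\<close>.\<close>

definition dilate :: "rat fps ^ 'm \<Rightarrow> 'm option \<Rightarrow> nat \<Rightarrow> rat fps" where
  "dilate Y i j = fps_compose (with_z Y i) (fps_X ^ j)"

definition polya :: "('m::finite option, 'x) species \<Rightarrow> rat fps ^ 'm \<Rightarrow> rat fps" where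
  "polya F Y = cycle_index_eval F (dilate Y)"


section \<open>Newton iterations\<close>

definition egf_jacobian ::
  "('m::finite \<Rightarrow> ('m option, 'x) species) \<Rightarrow> rat fps ^ 'm \<Rightarrow> rat fps ^ 'm ^ 'm" where
  "egf_jacobian H Y = (\<chi> i j. series_eval (series_deriv (Some j) (egf (H i))) (with_z Y))"

definition newton_egf ::
  "('m::finite \<Rightarrow> ('m option, 'x) species) \<Rightarrow> rat fps ^ 'm \<Rightarrow> rat fps ^ 'm" where
  "newton_egf H Y =
     Y + matrix_inv (mat 1 - egf_jacobian H Y) *v ((\<chi> i. series_eval (egf (H i)) (with_z Y)) - Y)"

definition newton_egf_defined ::
  "('m::finite \<Rightarrow> ('m option, 'x) species) \<Rightarrow> rat fps ^ 'm \<Rightarrow> bool" where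
  "newton_egf_defined H Y \<longleftrightarrow>
     (\<forall>i. locally_finite (series_term (egf (H i)) (with_z Y))) \<and>
     (\<forall>i j. locally_finite (series_term (series_deriv (Some j) (egf (H i))) (with_z Y))) \<and>
     invertible (mat 1 - egf_jacobian H Y)"

definition polya_jacobian ::
  "('m::finite \<Rightarrow> ('m option, 'x) species) \<Rightarrow> rat fps ^ 'm \<Rightarrow> rat fps ^ 'm ^ 'm" where
  "polya_jacobian H Y = (\<chi> i j. polya (partial_deriv (Some j) (H i)) Y)"

definition newton_polya ::
  "('m::finite \<Rightarrow> ('m option, 'x) species) \<Rightarrow> rat fps ^ 'm \<Rightarrow> rat fps ^ 'm" where
  "newton_polya H Y =
     Y + matrix_inv (mat 1 - polya_jacobian H Y) *v ((\<chi> i. polya (H i) Y) - Y)"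

definition newton_polya_defined ::
  "('m::finite \<Rightarrow> ('m option, 'x) species) \<Rightarrow> rat fps ^ 'm \<Rightarrow> bool" where
  "newton_polya_defined H Y \<longleftrightarrow>
     (\<forall>i. locally_finite (cycle_index_term (H i) (dilate Y))) \<and>
     (\<forall>i j. locally_finite (cycle_index_term (partial_deriv (Some j) (H i)) (dilate Y))) \<and>
     invertible (mat 1 - polya_jacobian H Y)"

definition agree_upto :: "nat \<Rightarrow> rat fps ^ 'm \<Rightarrow> rat fps ^ 'm \<Rightarrow> bool" where
  "agree_upto p A B \<longleftrightarrow> (\<forall>i. \<forall>k<p. fps_nth (A $ i) k = fps_nth (B $ i) k)"

text \<open>
  Convergence is required separately: the doubling condition alone says nothing as long as no
  coefficient is correct, which can happen at the start when \<open>S(0) \<noteq> 0\<close>.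
\<close>

definition converges_quadratically :: "(nat \<Rightarrow> rat fps ^ 'm) \<Rightarrow> rat fps ^ 'm \<Rightarrow> bool" where
  "converges_quadratically Y L \<longleftrightarrow>
     (\<forall>p. \<exists>N. \<forall>n\<ge>N. agree_upto p (Y n) L) \<and>
     (\<forall>n p. agree_upto p (Y n) L \<longrightarrow> agree_upto (2 * p) (Y (Suc n)) L)"


section \<open>Symmetries and empty blocks\<close>

text \<open>
  No nontrivial relabelling of the sorts in \<open>P\<close> alone fixes a structure. For exponential series,
  the identity \<open>EGF of F(G) = (EGF of F)(EGF of G)\<close> needs this in the sorts into which structures on
  the empty set are substituted: the set species \<open>E\<^sub>2\<close> has series \<open>y\<^sup>2/2\<close>, but \<open>E\<^sub>2(1) = 1\<close> has one
  structure rather than \<open>1/2\<close>. The condition is void for \<open>P = {}\<close>.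
\<close>

definition asymmetric_in :: "('s, 'x) species \<Rightarrow> 's set \<Rightarrow> bool" where
  "asymmetric_in F P \<longleftrightarrow>
     (\<forall>n \<sigma>. \<forall>x \<in> structs F (std n).
        (\<forall>i. \<sigma> i permutes {1..n i}) \<and> (\<forall>i. i \<notin> P \<longrightarrow> \<sigma> i = id) \<and> transport F (std n) \<sigma> x = x
        \<longrightarrow> (\<forall>i. \<sigma> i = id))"

end

theory Submission
  imports Defs
begin

text \<open>
  Both iterations are instances of one: the exponential series of \<open>F\<close> is the cycle index series of
  \<open>F\<close> at \<open>x\<^sub>i\<^sub>,\<^sub>1 = Y\<^sub>i\<close>, \<open>x\<^sub>i\<^sub>,\<^sub>j = 0\<close> for \<open>j > 1\<close>. If \<open>Y\<close> agrees with \<open>S\<close> up to \<open>z\<^sup>p\<close>, then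
  \<open>Y(z\<^sup>j)\<close> agrees with \<open>S(z\<^sup>j)\<close> up to \<open>z\<^sup>2\<^sup>p\<close> for \<open>j > 1\<close>, so modulo \<open>z\<^sup>2\<^sup>p\<close> only the variables
  \<open>x\<^sub>i\<^sub>,\<^sub>1\<close> move; as the cycle index of \<open>\<partial>F/\<partial>Y\<^sub>k\<close> is the derivative in \<open>x\<^sub>k\<^sub>,\<^sub>1\<close>, the Taylor formula
  gives the doubling of correct coefficients. The solution is a fixed point because of the
  composition formulas: Burnside's lemma for structures decorated with colours (ordinary series),
  and a free action of the relabelings (exponential series).

  Let \<open>i\<close> depend on \<open>j\<close> when \<open>\<partial>H\<^sub>i/\<partial>Y\<^sub>j\<close> has a structure that involves only sorts \<open>Y\<^sub>k\<close>
  with \<open>S\<^sub>k(0) \<noteq> 0\<close>. This relation is acyclic in a well-founded system, hence the Jacobian is nilpotent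
  at \<open>z = 0\<close>, and the constant terms of the iterates become correct one after the other along it.
\<close>

text \<open>The iterates are handled as bare power series: no species is attached to them, and
  nothing is known about the signs of their coefficients. That substitution makes sense and that
  \<open>mat 1 - J\<close> is invertible must therefore be secured at each iterate. Both follow from
  one invariant: constant terms vanish outside the set \<open>P\<close> of coordinates with
  \<open>S(0)\<close> nonempty. The system is polynomial in the sorts of \<open>P\<close>, and which
  entries of the Jacobian may have a constant term is decided by the structures of \<open>H\<close>
  and by \<open>P\<close>, whatever the iterate. Acyclicity cannot be read off the equation
  \<open>S = H(Z, S)\<close>, which for \<open>Y = Y\<close> holds for every \<open>S\<close>. It
  comes from convergence of the iteration from the empty species, by counting isomorphism types of
  each size, so the ordinary composition formula serves the exponential half too. The condition on
  \<open>S(0)\<close> ties \<open>P\<close>, which is defined by \<open>S\<close>, to that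
  iteration. Empty blocks can be exchanged without a trace, so relabelings need not act freely on
  composed structures; asymmetry removes this obstacle in the exponential half.\<close>

lemma card_quotient_kernel:
  assumes R: "R = {(x, y). x \<in> X \<and> y \<in> X \<and> f x = f y}"
  shows "card (X // R) = card (f ` X)" and "finite (f ` X) \<Longrightarrow> finite (X // R)"
proof -
  have *: "X // R = (\<lambda>y. {x \<in> X. f x = y}) ` f ` X"
  proof -
    have "R `` {x} = {x' \<in> X. f x' = f x}" if "x \<in> X" for x
      using that by (auto simp: R)
    then have "(\<lambda>x. R `` {x}) ` X = (\<lambda>y. {x \<in> X. f x = y}) ` f ` X"
      unfolding image_image by (rule image_cong[OF refl])
    moreover have "X // R = (\<lambda>x. R `` {x}) ` X" unfolding quotient_def by blast
    ultimately show ?thesis by simp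
  qed
  have "inj_on (\<lambda>y. {x \<in> X. f x = y}) (f ` X)"
    by (rule inj_onI) blast
  then show "card (X // R) = card (f ` X)"
    unfolding * by (rule card_image)
  show "finite (f ` X) \<Longrightarrow> finite (X // R)" unfolding * by (rule finite_imageI)
qed

section \<open>Transport of structures\<close>

lemma species_finite: "is_species F \<Longrightarrow> finite_tuple U \<Longrightarrow> finite (structs F U)"
  by (simp add: is_species_def)

lemma transport_in:
  "is_species F \<Longrightarrow> finite_tuple U \<Longrightarrow> bij_tuple \<sigma> U V \<Longrightarrow> x \<in> structs F U \<Longrightarrow>
    transport F U \<sigma> x \<in> structs F V"
  unfolding is_species_def by blast

lemma transport_cong:
  "is_species F \<Longrightarrow> finite_tuple U \<Longrightarrow> bij_tuple \<sigma> U V \<Longrightarrow> (\<And>i a. a \<in> U i \<Longrightarrow> \<sigma> i a = \<tau> i a) \<Longrightarrow>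
    x \<in> structs F U \<Longrightarrow> transport F U \<sigma> x = transport F U \<tau> x"
  unfolding is_species_def by blast

lemma bij_tuple_id: "bij_tuple (\<lambda>i. id) U U"
  by (simp add: bij_tuple_def)

lemma bij_tuple_comp: "bij_tuple \<sigma> U V \<Longrightarrow> bij_tuple \<tau> V W \<Longrightarrow> bij_tuple (\<lambda>i. \<tau> i \<circ> \<sigma> i) U W"
  by (auto simp: bij_tuple_def intro: bij_betw_trans)

lemma bij_tuple_finite: "bij_tuple \<sigma> U V \<Longrightarrow> finite_tuple U \<Longrightarrow> finite_tuple V"
  by (auto simp: bij_tuple_def finite_tuple_def dest: bij_betw_finite)

lemma bij_tuple_image: "bij_tuple \<sigma> U V \<Longrightarrow> (\<lambda>i. \<sigma> i ` U i) = V"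
  by (auto simp: bij_tuple_def bij_betw_def)

lemma bij_tuple_cong: "(\<And>i a. a \<in> U i \<Longrightarrow> \<sigma> i a = \<tau> i a) \<Longrightarrow> bij_tuple \<sigma> U V \<longleftrightarrow> bij_tuple \<tau> U V"
  by (simp add: bij_tuple_def cong: bij_betw_cong)

lemma bij_tuple_inverse:
  assumes "bij_tuple \<sigma> U V"
  shows "bij_tuple (\<lambda>i. inv_into (U i) (\<sigma> i)) V U"
  using assms by (auto simp: bij_tuple_def intro: bij_betw_inv_into)

lemma transport_id:
  assumes "is_species F" "finite_tuple U" "x \<in> structs F U" "\<And>i a. a \<in> U i \<Longrightarrow> \<sigma> i a = a"
  shows "transport F U \<sigma> x = x"
proof -
  have "transport F U (\<lambda>i. id) x = transport F U \<sigma> x"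
    by (rule transport_cong[OF assms(1,2) bij_tuple_id]) (use assms in auto)
  moreover have "transport F U (\<lambda>i. id) x = x"
    using assms unfolding is_species_def by blast
  ultimately show ?thesis by simp
qed

lemma transport_comp:
  assumes "is_species F" "finite_tuple U" "bij_tuple \<sigma> U V" "bij_tuple \<tau> V W" "x \<in> structs F U"
  shows "transport F V \<tau> (transport F U \<sigma> x) = transport F U (\<lambda>i. \<tau> i \<circ> \<sigma> i) x"
  using assms unfolding is_species_def by metis

lemma transport_inverse:
  assumes "is_species F" "finite_tuple U" "bij_tuple \<sigma> U V" "bij_tuple \<tau> V U" "x \<in> structs F U"
    and "\<And>i a. a \<in> U i \<Longrightarrow> \<tau> i (\<sigma> i a) = a"
  shows "transport F V \<tau> (transport F U \<sigma> x) = x"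
  using assms by (subst transport_comp[where W = U]) (auto intro: transport_id)

lemma bij_betw_transport:
  assumes F: "is_species F" and U: "finite_tuple U" and \<sigma>: "bij_tuple \<sigma> U V"
  shows "bij_betw (transport F U \<sigma>) (structs F U) (structs F V)"
proof (rule bij_betwI[where g = "transport F V (\<lambda>i. inv_into (U i) (\<sigma> i))"])
  note inv = bij_tuple_inverse[OF \<sigma>]
  have V: "finite_tuple V" using bij_tuple_finite \<sigma> U by blast
  show "transport F U \<sigma> \<in> structs F U \<rightarrow> structs F V"
    using transport_in[OF F U \<sigma>] by blast
  show "transport F V (\<lambda>i. inv_into (U i) (\<sigma> i)) \<in> structs F V \<rightarrow> structs F U"
    using transport_in[OF F V inv] by blast
  show "transport F V (\<lambda>i. inv_into (U i) (\<sigma> i)) (transport F U \<sigma> x) = x"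
    if "x \<in> structs F U" for x
    using \<sigma> that by (intro transport_inverse F U \<sigma> inv) (auto simp: bij_tuple_def bij_betw_def)
  show "transport F U \<sigma> (transport F V (\<lambda>i. inv_into (U i) (\<sigma> i)) x) = x"
    if "x \<in> structs F V" for x
  proof (intro transport_inverse F V \<sigma> inv that)
    show "\<sigma> i (inv_into (U i) (\<sigma> i) a) = a" if "a \<in> V i" for i a
      using \<sigma> that bij_betw_inv_into_right unfolding bij_tuple_def by metis
  qed
qed

lemma finite_tuple_std [simp]: "finite_tuple (std n)"
  by (simp add: finite_tuple_def std_def)

lemma finite_tuple_empty [simp]: "finite_tuple (\<lambda>i. {})"
  by (simp add: finite_tuple_def)

lemma std_zero: "std (\<lambda>i. 0) = (\<lambda>i. {})"
  by (simp add: std_def fun_eq_iff)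

lemma ex_bij_tuple:
  assumes "finite_tuple U" "finite_tuple V" "\<And>i. card (U i) = card (V i)"
  obtains \<sigma> where "bij_tuple \<sigma> U V"
proof -
  have "\<forall>i. \<exists>f. bij_betw f (U i) (V i)"
    using assms by (auto simp: finite_tuple_def intro: finite_same_card_bij)
  then show ?thesis using that unfolding bij_tuple_def by metis
qed

lemma card_structs_cong:
  assumes "is_species F" "finite_tuple U" "finite_tuple V" "\<And>i. card (U i) = card (V i)"
  shows "card (structs F U) = card (structs F V)"
  using ex_bij_tuple[OF assms(2-4)] bij_betw_transport[OF assms(1,2)] bij_betw_same_card by metis

lemma structs_nonempty_cong:
  assumes "is_species F" "finite_tuple U" "finite_tuple V" "\<And>i. card (U i) = card (V i)"
    "structs F U \<noteq> {}"
  shows "structs F V \<noteq> {}"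
  using card_structs_cong[OF assms(1-4)] assms species_finite by fastforce

section \<open>Decorated structures\<close>

definition relabelings :: "('s \<Rightarrow> nat) \<Rightarrow> ('s \<Rightarrow> nat \<Rightarrow> nat) set" where
  "relabelings n = {\<sigma>. \<forall>i. \<sigma> i permutes {1..n i}}"

lemma relabelings_PiE: "relabelings n = PiE UNIV (\<lambda>i. {p. p permutes {1..n i}})"
  by (auto simp: relabelings_def PiE_def Pi_def)

lemma finite_relabelings: "finite (relabelings (n :: 's::finite \<Rightarrow> nat))"
  unfolding relabelings_PiE by (intro finite_PiE) (auto simp: finite_permutations)

lemma card_relabelings: "card (relabelings (n :: 's::finite \<Rightarrow> nat)) = (\<Prod>i\<in>UNIV. fact (n i))"
  unfolding relabelings_PiE by (subst card_PiE) (auto simp: card_permutations)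

lemma relabelings_id: "(\<lambda>i. id) \<in> relabelings n"
  by (simp add: relabelings_def permutes_id)

lemma relabelings_comp: "\<sigma> \<in> relabelings n \<Longrightarrow> \<tau> \<in> relabelings n \<Longrightarrow> (\<lambda>i. \<sigma> i \<circ> \<tau> i) \<in> relabelings n"
  by (simp add: relabelings_def permutes_compose)

lemma relabelings_inv: "\<sigma> \<in> relabelings n \<Longrightarrow> (\<lambda>i. inv (\<sigma> i)) \<in> relabelings n"
  by (simp add: relabelings_def permutes_inv)

lemma relabelings_bij: "\<sigma> \<in> relabelings n \<Longrightarrow> bij (\<sigma> i)"
  by (auto simp: relabelings_def dest: permutes_bij)

lemma relabelings_bij_tuple: "\<sigma> \<in> relabelings n \<Longrightarrow> bij_tuple \<sigma> (std n) (std n)"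
  by (auto simp: relabelings_def bij_tuple_def std_def permutes_imp_bij)

text \<open>Bijections of \<open>std n\<close> are arbitrary off the labels, so they do not form a
  group. Extended by the identity they become elements of the finite group
  \<open>relabelings n\<close>, to which orbit counting applies.\<close>

lemma bij_tuple_relabeling:
  assumes "bij_tuple \<sigma> (std n) (std n)"
  obtains \<tau> where "\<tau> \<in> relabelings n" "\<And>i a. a \<in> std n i \<Longrightarrow> \<tau> i a = \<sigma> i a"
proof
  let ?\<tau> = "\<lambda>i a. if a \<in> std n i then \<sigma> i a else a"
  have "bij_betw (?\<tau> i) (std n i) (std n i)" for i
    using assms by (simp add: bij_tuple_def cong: bij_betw_cong)
  then show "?\<tau> \<in> relabelings n"
    by (auto simp: relabelings_def std_def intro!: bij_imp_permutes)
qed simp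

text \<open>A left action in which a decoration travels with its label, whence the inverse. The type
  of decorations is left open: colours, blocks with structures on them, or the trivial
  \<open>unit\<close> will be put in.\<close>

definition relabel ::
  "('s, 'x) species \<Rightarrow> ('s \<Rightarrow> nat) \<Rightarrow> ('s \<Rightarrow> nat \<Rightarrow> nat) \<Rightarrow> 'x \<times> ('s \<Rightarrow> nat \<Rightarrow> 'd) \<Rightarrow> 'x \<times> ('s \<Rightarrow> nat \<Rightarrow> 'd)"
where
  "relabel F n \<sigma> = (\<lambda>(h, d). (transport F (std n) \<sigma> h, \<lambda>i. d i \<circ> inv (\<sigma> i)))"

definition deco_orbit ::
  "('s, 'x) species \<Rightarrow> ('s \<Rightarrow> nat) \<Rightarrow> 'x \<times> ('s \<Rightarrow> nat \<Rightarrow> 'd) \<Rightarrow> ('x \<times> ('s \<Rightarrow> nat \<Rightarrow> 'd)) set" where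
  "deco_orbit F n x = (\<lambda>\<sigma>. relabel F n \<sigma> x) ` relabelings n"

context
  fixes F :: "('s, 'x) species" and n :: "'s \<Rightarrow> nat"
  assumes F: "is_species F"
begin

lemma relabel_in: "\<sigma> \<in> relabelings n \<Longrightarrow> fst x \<in> structs F (std n) \<Longrightarrow> fst (relabel F n \<sigma> x) \<in> structs F (std n)"
  by (auto simp: relabel_def split_beta intro!: transport_in[OF F] relabelings_bij_tuple)

lemma relabel_id: "fst x \<in> structs F (std n) \<Longrightarrow> relabel F n (\<lambda>i. id) x = x"
  by (auto simp: relabel_def split_beta prod_eq_iff intro!: transport_id[OF F])

lemma relabel_comp:
  assumes "\<sigma> \<in> relabelings n" "\<tau> \<in> relabelings n" "fst x \<in> structs F (std n)"
  shows "relabel F n \<sigma> (relabel F n \<tau> x) = relabel F n (\<lambda>i. \<sigma> i \<circ> \<tau> i) x"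
  using assms
  by (auto simp: relabel_def split_beta prod_eq_iff fun_eq_iff o_inv_distrib relabelings_bij
      transport_comp[OF F _ relabelings_bij_tuple relabelings_bij_tuple])

lemma relabel_inv:
  assumes "\<sigma> \<in> relabelings n" "fst x \<in> structs F (std n)"
  shows "relabel F n (\<lambda>i. inv (\<sigma> i)) (relabel F n \<sigma> x) = x"
proof -
  have "(\<lambda>i. inv (\<sigma> i) \<circ> \<sigma> i) = (\<lambda>i. id)"
    using relabelings_bij[OF assms(1)] by (auto simp: fun_eq_iff bij_is_inj)
  then show ?thesis
    using assms by (simp add: relabel_comp relabelings_inv relabel_id)
qed

lemma deco_orbit_self: "fst x \<in> structs F (std n) \<Longrightarrow> x \<in> deco_orbit F n x"
  unfolding deco_orbit_def using relabelings_id relabel_id by (metis image_eqI)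

lemma deco_orbit_relabel:
  assumes "\<sigma> \<in> relabelings n" "fst x \<in> structs F (std n)"
  shows "deco_orbit F n (relabel F n \<sigma> x) = deco_orbit F n x"
proof -
  have *: "deco_orbit F n (relabel F n \<tau> y) \<subseteq> deco_orbit F n y"
    if "\<tau> \<in> relabelings n" "fst y \<in> structs F (std n)" for \<tau> y
    using that by (auto simp: deco_orbit_def relabel_comp intro!: relabelings_comp)
  show ?thesis
    using *[OF assms] *[OF relabelings_inv[OF assms(1)] relabel_in[OF assms]]
    by (simp add: relabel_inv assms)
qed

lemma deco_orbit_eq_iff:
  assumes "fst x \<in> structs F (std n)" "fst y \<in> structs F (std n)"
  shows "deco_orbit F n x = deco_orbit F n y \<longleftrightarrow> (\<exists>\<sigma>\<in>relabelings n. y = relabel F n \<sigma> x)"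
proof
  assume "deco_orbit F n x = deco_orbit F n y"
  then have "y \<in> deco_orbit F n x" using deco_orbit_self assms by blast
  then show "\<exists>\<sigma>\<in>relabelings n. y = relabel F n \<sigma> x" by (auto simp: deco_orbit_def)
next
  assume "\<exists>\<sigma>\<in>relabelings n. y = relabel F n \<sigma> x"
  then show "deco_orbit F n x = deco_orbit F n y" using deco_orbit_relabel assms by metis
qed

end

text \<open>Count the pairs of a relabeling and a decorated structure fixed by it in two ways. In
  each orbit the sizes of the stabilisers add up to the order of the group, so dividing the sum by
  the product of factorials counts orbits.\<close>

lemma burnside_relabel:
  fixes F :: "('s::finite, 'x) species" and X :: "('x \<times> ('s \<Rightarrow> nat \<Rightarrow> 'd)) set"
  assumes F: "is_species F" and fin: "finite X" and X: "\<And>x. x \<in> X \<Longrightarrow> fst x \<in> structs F (std n)"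
    and closed: "\<And>\<sigma> x. \<sigma> \<in> relabelings n \<Longrightarrow> x \<in> X \<Longrightarrow> relabel F n \<sigma> x \<in> X"
  shows "(\<Sum>\<sigma>\<in>relabelings n. card {x \<in> X. relabel F n \<sigma> x = x})
    = card (deco_orbit F n ` X) * (\<Prod>i\<in>UNIV. fact (n i))"
proof -
  let ?G = "relabelings n" and ?a = "relabel F n" and ?O = "deco_orbit F n"
  note finG = finite_relabelings[of n]
  \<comment> \<open>If \<open>x\<close> is the image of \<open>y\<close> under
    \<open>\<tau>\<close>, right translation by \<open>\<tau>\<close> carries the stabiliser of
    \<open>x\<close> onto the coset of relabelings that send \<open>y\<close> to
    \<open>x\<close>.\<close>
  have stab: "card {\<sigma> \<in> ?G. ?a \<sigma> x = x} = card {\<sigma> \<in> ?G. ?a \<sigma> y = x}"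
    if y: "y \<in> X" and x: "x \<in> ?O y" for x y
  proof -
    obtain \<tau> where \<tau>: "\<tau> \<in> ?G" and x: "x = ?a \<tau> y" using x by (auto simp: deco_orbit_def)
    have inv: "(\<lambda>i. \<sigma> i \<circ> inv (\<tau> i) \<circ> \<tau> i) = \<sigma>" "(\<lambda>i. \<sigma> i \<circ> \<tau> i \<circ> inv (\<tau> i)) = \<sigma>" for \<sigma> :: "'s \<Rightarrow> nat \<Rightarrow> nat"
      using relabelings_bij[OF \<tau>] by (auto simp: fun_eq_iff bij_is_inj bij_is_surj surj_f_inv_f)
    have "bij_betw (\<lambda>\<sigma> i. \<sigma> i \<circ> \<tau> i) {\<sigma> \<in> ?G. ?a \<sigma> x = x} {\<sigma> \<in> ?G. ?a \<sigma> y = x}"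
    proof (rule bij_betwI[where g = "\<lambda>\<sigma> i. \<sigma> i \<circ> inv (\<tau> i)"])
      show "(\<lambda>\<sigma> i. \<sigma> i \<circ> \<tau> i) \<in> {\<sigma> \<in> ?G. ?a \<sigma> x = x} \<rightarrow> {\<sigma> \<in> ?G. ?a \<sigma> y = x}"
        using \<tau> X[OF y] by (auto simp: x relabelings_comp simp flip: relabel_comp[OF F])
      show "(\<lambda>\<sigma> i. \<sigma> i \<circ> inv (\<tau> i)) \<in> {\<sigma> \<in> ?G. ?a \<sigma> y = x} \<rightarrow> {\<sigma> \<in> ?G. ?a \<sigma> x = x}"
        using \<tau> X[OF y] relabel_in[OF F \<tau> X[OF y]]
        by (auto simp: x relabelings_comp relabelings_inv relabel_inv[OF F] simp flip: relabel_comp[OF F])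
    qed (simp_all add: inv)
    then show ?thesis by (rule bij_betw_same_card)
  qed
  have sub: "?O y \<subseteq> X" if "y \<in> X" for y unfolding deco_orbit_def using closed[OF _ that] by (rule image_subsetI)
  have orb: "(\<Sum>x\<in>?O y. card {\<sigma> \<in> ?G. ?a \<sigma> x = x}) = card ?G" if y: "y \<in> X" for y
  proof -
    have "(\<Sum>x\<in>?O y. card {\<sigma> \<in> ?G. ?a \<sigma> x = x}) = (\<Sum>x\<in>?O y. card {\<sigma> \<in> ?G. ?a \<sigma> y = x})"
      by (rule sum.cong) (auto simp: stab[OF y])
    also have "\<dots> = (\<Sum>x\<in>(\<lambda>\<sigma>. ?a \<sigma> y) ` ?G. \<Sum>\<sigma>\<in>{\<sigma> \<in> ?G. ?a \<sigma> y = x}. 1)"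
      by (simp add: deco_orbit_def)
    also have "\<dots> = (\<Sum>\<sigma>\<in>?G. 1)" by (rule sum.image_gen[symmetric, OF finG])
    finally show ?thesis by simp
  qed
  have fibre: "{x \<in> X. ?O x = ?O y} = ?O y" if "y \<in> X" for y
  proof -
    have "x \<in> ?O y" if "x \<in> X" "?O x = ?O y" for x
      using deco_orbit_self[OF F, of x n] X that by auto
    moreover have "?O x = ?O y" if "x \<in> ?O y" for x
      using that deco_orbit_relabel[OF F _ X[OF \<open>y \<in> X\<close>]] by (auto simp: deco_orbit_def[of F n y])
    ultimately show ?thesis using sub[OF that] by blast
  qed
  have "(\<Sum>\<sigma>\<in>?G. card {x \<in> X. ?a \<sigma> x = x}) = (\<Sum>x\<in>X. card {\<sigma> \<in> ?G. ?a \<sigma> x = x})"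
    by (rule sum_multicount_gen[OF fin finG, symmetric]) simp
  also have "\<dots> = (\<Sum>z\<in>?O ` X. \<Sum>x\<in>{x \<in> X. ?O x = z}. card {\<sigma> \<in> ?G. ?a \<sigma> x = x})"
    by (rule sum.image_gen[OF fin])
  also have "\<dots> = (\<Sum>z\<in>?O ` X. card ?G)"
    by (rule sum.cong) (auto simp: fibre orb)
  also have "\<dots> = card (?O ` X) * (\<Prod>i\<in>UNIV. fact (n i))"
    by (simp add: card_relabelings)
  finally show ?thesis .
qed

section \<open>Composition of species\<close>

definition restr :: "('s \<Rightarrow> nat) \<Rightarrow> ('s \<Rightarrow> nat \<Rightarrow> 'd) \<Rightarrow> 's \<Rightarrow> nat \<Rightarrow> 'd" where
  "restr n d i = restrict (d i) (std n i)"

lemma restr_cong: "(\<And>i a. a \<in> std n i \<Longrightarrow> d i a = d' i a) \<Longrightarrow> restr n d = restr n d'"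
  by (auto simp: restr_def fun_eq_iff restrict_def)

lemma relabel_restr_iff:
  assumes \<sigma>: "\<sigma> \<in> relabelings n"
  shows "(h', restr n d') = relabel F n \<sigma> (h, restr n d) \<longleftrightarrow>
    h' = transport F (std n) \<sigma> h \<and> (\<forall>i. \<forall>a\<in>std n i. d' i (\<sigma> i a) = d i a)"
proof -
  have p: "\<sigma> i permutes std n i" for i using \<sigma> by (simp add: relabelings_def std_def)
  have "restr n d' = (\<lambda>i. restr n d i \<circ> inv (\<sigma> i)) \<longleftrightarrow> (\<forall>i. \<forall>a\<in>std n i. d' i (\<sigma> i a) = d i a)"
  proof
    assume L: "restr n d' = (\<lambda>i. restr n d i \<circ> inv (\<sigma> i))"
    show "\<forall>i. \<forall>a\<in>std n i. d' i (\<sigma> i a) = d i a"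
    proof (intro allI ballI)
      fix i a assume a: "a \<in> std n i"
      have "restr n d' i (\<sigma> i a) = restr n d i a"
        unfolding L using permutes_inverses[OF p] by simp
      then show "d' i (\<sigma> i a) = d i a"
        using a permutes_in_image[OF p, of i a] by (simp add: restr_def)
    qed
  next
    assume R: "\<forall>i. \<forall>a\<in>std n i. d' i (\<sigma> i a) = d i a"
    show "restr n d' = (\<lambda>i. restr n d i \<circ> inv (\<sigma> i))"
    proof (intro ext)
      fix i a
      have *: "inv (\<sigma> i) a \<in> std n i \<longleftrightarrow> a \<in> std n i" "\<sigma> i (inv (\<sigma> i) a) = a"
        using permutes_inverses(1)[OF p] permutes_in_image[OF permutes_inv[OF p]] by auto
      show "restr n d' i a = (restr n d i \<circ> inv (\<sigma> i)) a"
        using R[rule_format, of "inv (\<sigma> i) a" i] * by (simp add: restr_def)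
    qed
  qed
  then show ?thesis by (simp add: relabel_def)
qed

text \<open>The right-hand side is the identification made in \<open>comp_rel\<close>. As an
  equality of orbits it is an equivalence for free, and its classes can be counted by
  \<open>burnside_relabel\<close>. Restriction to the labels makes equality of decorations ignore
  irrelevant values.\<close>

lemma deco_orbit_restr_eq_iff:
  assumes F: "is_species F" and h: "h \<in> structs F (std n)" "h' \<in> structs F (std n)"
  shows "deco_orbit F n (h, restr n d) = deco_orbit F n (h', restr n d') \<longleftrightarrow>
    (\<exists>\<sigma>. bij_tuple \<sigma> (std n) (std n) \<and> h' = transport F (std n) \<sigma> h \<and>
       (\<forall>i. \<forall>a \<in> std n i. d' i (\<sigma> i a) = d i a))" (is "?R \<longleftrightarrow> ?L")
proof
  assume ?L
  then obtain \<sigma> where \<sigma>: "bij_tuple \<sigma> (std n) (std n)" "h' = transport F (std n) \<sigma> h"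
    "\<forall>i. \<forall>a \<in> std n i. d' i (\<sigma> i a) = d i a" by blast
  obtain \<tau> where \<tau>: "\<tau> \<in> relabelings n" "\<And>i a. a \<in> std n i \<Longrightarrow> \<tau> i a = \<sigma> i a"
    using bij_tuple_relabeling[OF \<sigma>(1)] by blast
  have "h' = transport F (std n) \<tau> h"
    unfolding \<sigma>(2) using \<tau> h by (intro transport_cong[OF F _ \<sigma>(1)]) auto
  then have "(h', restr n d') = relabel F n \<tau> (h, restr n d)"
    using \<sigma> \<tau> by (subst relabel_restr_iff) auto
  then show ?R using \<tau> h deco_orbit_eq_iff[OF F] by (metis fst_conv)
next
  assume ?R
  then obtain \<sigma> where "\<sigma> \<in> relabelings n" "(h', restr n d') = relabel F n \<sigma> (h, restr n d)"
    using h deco_orbit_eq_iff[OF F] by (metis fst_conv)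
  then show ?L using relabelings_bij_tuple relabel_restr_iff by metis
qed

abbreviation deco :: "('s \<Rightarrow> nat) \<Rightarrow> ('s \<Rightarrow> nat \<Rightarrow> 'b) \<Rightarrow> ('s \<Rightarrow> nat \<Rightarrow> 'y) \<Rightarrow> 's \<Rightarrow> nat \<Rightarrow> 'b \<times> 'y" where
  "deco n B g \<equiv> restr n (\<lambda>i a. (B i a, g i a))"

text \<open>A complete invariant of a class of representatives: \<open>comp_rel\<close> is its
  kernel, so the structures of the composition are in bijection with its values, which are pairs of
  a multidegree and an orbit.\<close>

fun comp_key where
  "comp_key F (n, h, B, g) = (n, deco_orbit F n (h, deco n B g))"

lemma comp_rel_eq:
  assumes F: "is_species F"
  shows "comp_rel F G U =
    {(r, r'). r \<in> comp_reps F G U \<and> r' \<in> comp_reps F G U \<and> comp_key F r = comp_key F r'}"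
proof (intro set_eqI, simp only: split_paired_all)
  fix n h B g n' h' B' g'
  show "((n, h, B, g), (n', h', B', g')) \<in> comp_rel F G U \<longleftrightarrow> ((n, h, B, g), (n', h', B', g')) \<in>
    {(r, r'). r \<in> comp_reps F G U \<and> r' \<in> comp_reps F G U \<and> comp_key F r = comp_key F r'}"
  proof (cases "(n, h, B, g) \<in> comp_reps F G U \<and> (n', h', B', g') \<in> comp_reps F G U \<and> n' = n")
    case True
    then have h: "h \<in> structs F (std n)" "h' \<in> structs F (std n)" by (auto simp: comp_reps_def)
    from True show ?thesis
      unfolding comp_rel_def by (simp add: deco_orbit_restr_eq_iff[OF F h])
  qed (auto simp: comp_rel_def)
qed

lemma comp_rel_equiv: "is_species F \<Longrightarrow> equiv (comp_reps F G U) (comp_rel F G U)"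
  by (auto simp: comp_rel_eq equiv_def refl_on_def sym_def trans_def)

section \<open>Finiteness of a composition\<close>

lemma polynomial_in_finite:
  assumes "polynomial_in F P"
  shows "finite {n. (\<Sum>i\<in>-P. n i) \<le> k \<and> structs F (std n) \<noteq> {}}"
proof -
  have "{n. (\<Sum>i\<in>-P. n i) \<le> k \<and> structs F (std n) \<noteq> {}} \<subseteq>
    (\<Union>l\<in>{..k}. fst ` (SIGMA n:{n. (\<Sum>i\<in>-P. n i) = l}. structs F (std n)))"
    by (force simp: image_iff)
  moreover have "finite \<dots>"
    using assms unfolding polynomial_in_def by blast
  ultimately show ?thesis by (rule finite_subset)
qed

lemma comp_reps_block:
  assumes "(n, h, B, g) \<in> comp_reps F G U" "a \<in> std n i"
  shows "B i a t \<subseteq> U t" and "g i a \<in> structs (G i) (B i a)"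
proof -
  have "(\<Union>i. \<Union>a \<in> std n i. B i a t) = U t" using assms(1) by (simp add: comp_reps_def)
  then show "B i a t \<subseteq> U t" using assms(2) by blast
  show "g i a \<in> structs (G i) (B i a)" using assms by (simp add: comp_reps_def)
qed

lemma comp_reps_disjoint:
  assumes "(n, h, B, g) \<in> comp_reps F G U" "a \<in> std n i" "a' \<in> std n i'" "(i, a) \<noteq> (i', a')"
  shows "B i a t \<inter> B i' a' t = {}"
proof -
  have "disjoint_family_on (\<lambda>(i, a). B i a t) (SIGMA i:UNIV. std n i)"
    using assms(1) by (simp add: comp_reps_def)
  from disjoint_family_onD[OF this, of "(i, a)" "(i', a')"] assms(2-) show ?thesis by auto
qed

text \<open>Blocks of sorts without structures on the empty set are nonempty, and all blocks are
  disjoint. Picking a point \<open>f i a\<close> in each of them embeds their index set into the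
  labels of \<open>U\<close>. In the remaining sorts the degree is controlled only by polynomiality
  of \<open>F\<close>.\<close>

lemma comp_reps_size:
  fixes F :: "('s::finite, 'x) species" and G :: "'s \<Rightarrow> ('t::finite, 'y) species"
  assumes r: "(n, h, B, g) \<in> comp_reps F G U" and U: "finite_tuple U"
  shows "(\<Sum>i\<in>-{i. empty_structs (G i) \<noteq> {}}. n i) \<le> (\<Sum>t\<in>UNIV. card (U t))"
proof -
  let ?P = "{i. empty_structs (G i) \<noteq> {}}" and ?I = "SIGMA i:-{i. empty_structs (G i) \<noteq> {}}. std n i"
  define f where "f i a = (SOME p. snd p \<in> B i a (fst p))" for i a
  have ex: "\<exists>t u. u \<in> B i a t" if "i \<notin> ?P" "a \<in> std n i" for i a
  proof (rule ccontr)
    assume "\<nexists>t u. u \<in> B i a t"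
    then have "B i a = (\<lambda>t. {})" by auto
    moreover have "g i a \<in> structs (G i) (B i a)" using comp_reps_block[OF r] that by blast
    ultimately show False using that by auto
  qed
  have f: "snd (f i a) \<in> B i a (fst (f i a))" if "i \<notin> ?P" "a \<in> std n i" for i a
  proof -
    have "\<exists>t u. u \<in> B i a t" using that by (rule ex)
    then obtain t u where "u \<in> B i a t" by blast
    then have "snd (t, u) \<in> B i a (fst (t, u))" by simp
    then show ?thesis unfolding f_def by (rule someI)
  qed
  have "inj_on (\<lambda>x. f (fst x) (snd x)) ?I"
  proof (rule inj_onI)
    fix x y assume *: "x \<in> ?I" "y \<in> ?I" "f (fst x) (snd x) = f (fst y) (snd y)"
    have x: "fst x \<notin> ?P" "snd x \<in> std n (fst x)" and y: "fst y \<notin> ?P" "snd y \<in> std n (fst y)"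
      using * by auto
    let ?p = "f (fst x) (snd x)"
    have "snd ?p \<in> B (fst x) (snd x) (fst ?p) \<inter> B (fst y) (snd y) (fst ?p)"
      using f[OF x] f[OF y] *(3) by simp
    then show "x = y" using comp_reps_disjoint[OF r x(2) y(2)] by (metis empty_iff prod.collapse)
  qed
  moreover have "(\<lambda>x. f (fst x) (snd x)) ` ?I \<subseteq> (SIGMA t:UNIV. U t)"
  proof (rule image_subsetI)
    fix x assume "x \<in> ?I"
    then have x: "fst x \<notin> ?P" "snd x \<in> std n (fst x)" by auto
    then have "snd (f (fst x) (snd x)) \<in> U (fst (f (fst x) (snd x)))"
      using f[OF x] comp_reps_block(1)[OF r x(2)] by blast
    then show "f (fst x) (snd x) \<in> (SIGMA t:UNIV. U t)" by (metis SigmaI UNIV_I prod.collapse)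
  qed
  moreover have "finite (SIGMA t:UNIV. U t)" using U by (auto simp: finite_tuple_def)
  ultimately have "card ?I \<le> card (SIGMA t:UNIV. U t)" by (intro card_inj_on_le)
  then show ?thesis using U by (simp add: finite_tuple_def std_def)
qed

lemma comp_reps_deco_in:
  assumes r: "(n, h, B, g) \<in> comp_reps F G U"
  shows "deco n B g \<in> PiE UNIV (\<lambda>i. PiE (std n i)
    (\<lambda>_. SIGMA V:{V. \<forall>t. V t \<subseteq> U t}. structs (G i) V))"
  using comp_reps_block[OF r] by (auto simp: restr_def)

lemma finite_subtuples:
  assumes "finite_tuple U"
  shows "finite {V :: 't::finite \<Rightarrow> nat set. \<forall>t. V t \<subseteq> U t}"
proof -
  have "finite (PiE UNIV (\<lambda>t. Pow (U t)))" using assms by (intro finite_PiE) (auto simp: finite_tuple_def)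
  moreover have "{V. \<forall>t. V t \<subseteq> U t} = PiE UNIV (\<lambda>t. Pow (U t))" by (auto simp: PiE_def Pi_def)
  ultimately show ?thesis by simp
qed

lemma finite_comp_decos:
  fixes G :: "'s::finite \<Rightarrow> ('t::finite, 'y) species"
  assumes G: "\<And>i. is_species (G i)" and U: "finite_tuple U"
  shows "finite (PiE UNIV (\<lambda>i. PiE (std n i) (\<lambda>_. SIGMA V:{V. \<forall>t. V t \<subseteq> U t}. structs (G i) V)))"
proof -
  have "finite_tuple V" if "\<forall>t. V t \<subseteq> U t" for V
    using U that by (auto simp: finite_tuple_def intro: finite_subset)
  then have "finite (SIGMA V:{V. \<forall>t. V t \<subseteq> U t}. structs (G i) V)" for i
    using finite_subtuples[OF U] species_finite[OF G] by (intro finite_SigmaI) auto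
  then show ?thesis by (intro finite_PiE) (auto simp: std_def)
qed

lemma finite_comp_keys:
  fixes F :: "('s::finite, 'x) species" and G :: "'s \<Rightarrow> ('t::finite, 'y) species"
  assumes F: "is_species F" and G: "\<And>i. is_species (G i)" and c: "composable F G" and U: "finite_tuple U"
  shows "finite (comp_key F ` comp_reps F G U)"
proof -
  let ?N = "{n. (\<Sum>i\<in>-{i. empty_structs (G i) \<noteq> {}}. n i) \<le> (\<Sum>t\<in>UNIV. card (U t)) \<and> structs F (std n) \<noteq> {}}"
  let ?D = "\<lambda>n. PiE UNIV (\<lambda>i. PiE (std n i) (\<lambda>_. SIGMA V:{V. \<forall>t. V t \<subseteq> U t}. structs (G i) V))"
  let ?K = "\<lambda>n. (\<lambda>x. (n, deco_orbit F n x)) ` (structs F (std n) \<times> ?D n)"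
  have "comp_key F r \<in> (\<Union>n\<in>?N. ?K n)" if r: "r \<in> comp_reps F G U" for r
  proof -
    obtain n h B g where r': "r = (n, h, B, g)" by (cases r)
    note r = r[unfolded r']
    have h: "h \<in> structs F (std n)" using r by (simp add: comp_reps_def)
    then have "n \<in> ?N" using comp_reps_size[OF r U] by blast
    moreover have "comp_key F r \<in> ?K n"
      unfolding r' comp_key.simps by (rule imageI) (use h comp_reps_deco_in[OF r] in blast)
    ultimately show ?thesis by blast
  qed
  then have "comp_key F ` comp_reps F G U \<subseteq> (\<Union>n\<in>?N. ?K n)" by blast
  moreover have "finite ?N" using polynomial_in_finite c unfolding composable_def by blast
  then have "finite (\<Union>n\<in>?N. ?K n)"
    by (intro finite_UN_I finite_imageI finite_cartesian_product finite_comp_decos G U species_finite[OF F]) auto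
  ultimately show ?thesis by (rule finite_subset)
qed

section \<open>Functoriality of composition\<close>

lemma comp_rep_transport_in:
  assumes G: "\<And>i. is_species (G i)" and U: "finite_tuple U" and \<tau>: "bij_tuple \<tau> U V"
    and r: "r \<in> comp_reps F G U"
  shows "comp_rep_transport G \<tau> r \<in> comp_reps F G V"
proof -
  obtain n h B g where r': "r = (n, h, B, g)" by (cases r)
  have h: "h \<in> structs F (std n)" and g: "\<And>i a. a \<in> std n i \<Longrightarrow> g i a \<in> structs (G i) (B i a)"
    and un: "\<And>t. (\<Union>i. \<Union>a \<in> std n i. B i a t) = U t"
    using r by (auto simp: comp_reps_def r')
  have sub: "B i a t \<subseteq> U t" if "a \<in> std n i" for i a t
    using comp_reps_block(1) r that unfolding r' by fast
  have inj: "inj_on (\<tau> t) (U t)" and im: "\<tau> t ` U t = V t" for t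
    using \<tau> by (auto simp: bij_tuple_def bij_betw_def)
  have "transport (G i) (B i a) \<tau> (g i a) \<in> structs (G i) (\<lambda>t. \<tau> t ` B i a t)" if a: "a \<in> std n i" for i a
  proof (rule transport_in[OF G])
    show "finite_tuple (B i a)" using U sub[OF a] by (auto simp: finite_tuple_def intro: finite_subset)
    show "bij_tuple \<tau> (B i a) (\<lambda>t. \<tau> t ` B i a t)"
      using inj sub[OF a] by (auto simp: bij_tuple_def bij_betw_def intro: inj_on_subset)
  qed (rule g[OF a])
  moreover have "(\<Union>i. \<Union>a \<in> std n i. \<tau> t ` B i a t) = V t" for t
    unfolding im[symmetric] un[symmetric] by blast
  moreover have "disjoint_family_on (\<lambda>(i, a). \<tau> t ` B i a t) (SIGMA i:UNIV. std n i)" for t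
    unfolding disjoint_family_on_def
  proof (intro ballI impI)
    fix x y assume *: "x \<in> (SIGMA i:UNIV. std n i)" "y \<in> (SIGMA i:UNIV. std n i)" "x \<noteq> y"
    obtain i a i' a' where xy: "x = (i, a)" "y = (i', a')" by (cases x, cases y)
    have "B i a t \<inter> B i' a' t = {}"
      using comp_reps_disjoint[OF r[unfolded r']] * by (auto simp: xy)
    then show "(\<lambda>(i, a). \<tau> t ` B i a t) x \<inter> (\<lambda>(i, a). \<tau> t ` B i a t) y = {}"
      using inj_on_image_Int[OF inj[of t] sub[of a i t] sub[of a' i' t]] * by (simp add: xy)
  qed
  ultimately show ?thesis using h by (simp add: r' comp_rep_transport_def comp_reps_def)
qed

lemma comp_rep_transport_rel:
  assumes "\<And>i. is_species (G i)" "finite_tuple U" "bij_tuple \<tau> U V" "(r, r') \<in> comp_rel F G U"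
  shows "(comp_rep_transport G \<tau> r, comp_rep_transport G \<tau> r') \<in> comp_rel F G V"
proof -
  have "r \<in> comp_reps F G U" "r' \<in> comp_reps F G U" using assms(4) by (auto simp: comp_rel_def)
  note * = this[THEN comp_rep_transport_in[OF assms(1-3)]]
  obtain n h B g n' h' B' g' where r: "r = (n, h, B, g)" "r' = (n', h', B', g')" by (cases r, cases r')
  obtain \<sigma> where \<sigma>: "n' = n" "bij_tuple \<sigma> (std n) (std n)" "h' = transport F (std n) \<sigma> h"
    "\<And>i a. a \<in> std n i \<Longrightarrow> B' i (\<sigma> i a) = B i a \<and> g' i (\<sigma> i a) = g i a"
    using assms(4) by (auto simp: comp_rel_def r)
  show ?thesis
    using * \<sigma>(1) unfolding r comp_rel_def comp_rep_transport_def
    by (auto intro!: exI[of _ \<sigma>] simp: \<sigma>)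
qed

text \<open>Transport of a class was defined through all its representatives at once. Since
  \<open>comp_rep_transport\<close> respects the relation, one representative suffices, and the
  functor laws can be checked on blocks.\<close>

lemma transport_comp_classes:
  assumes F: "is_species F" and G: "\<And>i. is_species (G i)" and U: "finite_tuple U"
    and \<tau>: "bij_tuple \<tau> U V" and r: "r \<in> comp_reps F G U"
  shows "transport (comp_classes F G) U \<tau> (comp_rel F G U `` {r}) = comp_rel F G V `` {comp_rep_transport G \<tau> r}"
proof -
  note rel = comp_rep_transport_rel[OF G U \<tau>, where F = F]
  have *: "comp_rel F G V `` {comp_rep_transport G \<tau> r'} = comp_rel F G V `` {comp_rep_transport G \<tau> r}"
    if "(r, r') \<in> comp_rel F G U" for r'
    using rel[OF that] equiv_class_eq[OF comp_rel_equiv[OF F]] by metis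
  have **: "(r, r) \<in> comp_rel F G U"
    using comp_rel_equiv[OF F] r by (meson equivE refl_onD)
  have "comp_rel F G V `` (comp_rep_transport G \<tau> ` (comp_rel F G U `` {r}))
    = (\<Union>r'\<in>comp_rel F G U `` {r}. comp_rel F G V `` {comp_rep_transport G \<tau> r'})" by blast
  also have "\<dots> = (\<Union>r'\<in>comp_rel F G U `` {r}. comp_rel F G V `` {comp_rep_transport G \<tau> r})"
    using * by (intro SUP_cong refl) blast
  also have "\<dots> = comp_rel F G V `` {comp_rep_transport G \<tau> r}" using ** by blast
  finally show ?thesis by (simp add: comp_classes_def bij_tuple_image[OF \<tau>])
qed

text \<open>Representatives are total functions, and transport may change their irrelevant values;
  the identity relabeling identifies representatives that agree on the labels.\<close>

lemma comp_class_eqI: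
  assumes F: "is_species F" and "(n, h, B, g) \<in> comp_reps F G U" "(n, h, B', g') \<in> comp_reps F G U"
    and "\<And>i a. a \<in> std n i \<Longrightarrow> B i a = B' i a \<and> g i a = g' i a"
  shows "comp_rel F G U `` {(n, h, B, g)} = comp_rel F G U `` {(n, h, B', g')}"
proof (rule equiv_class_eq[OF comp_rel_equiv[OF F]])
  show "((n, h, B, g), (n, h, B', g')) \<in> comp_rel F G U"
    using assms restr_cong[of n "\<lambda>i a. (B i a, g i a)" "\<lambda>i a. (B' i a, g' i a)"] by (simp add: comp_rel_eq[OF F])
qed

lemma comp_classes_species:
  fixes F :: "('s::finite, 'x) species" and G :: "'s \<Rightarrow> ('t::finite, 'y) species"
  assumes F: "is_species F" and G: "\<And>i. is_species (G i)" and c: "composable F G"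
  shows "is_species (comp_classes F G)"
proof -
  let ?C = "comp_classes F G" and ?T = "comp_rep_transport G"
  note T = transport_comp_classes[where F = F and G = G, OF F G]
    and T_in = comp_rep_transport_in[where F = F and G = G, OF G]
  have st: "structs ?C U = comp_reps F G U // comp_rel F G U" for U by (simp add: comp_classes_def)
  have fin: "finite (structs ?C U)" if U: "finite_tuple U" for U
    unfolding st using card_quotient_kernel(2)[OF comp_rel_eq[OF F]] finite_comp_keys[OF F G c U] by blast
  have cl: "\<exists>n h B g. (n, h, B, g) \<in> comp_reps F G U \<and> x = comp_rel F G U `` {(n, h, B, g)}"
    if "x \<in> structs ?C U" for x U
    using that unfolding st by (auto elim!: quotientE)
  have bl: "finite_tuple (B i a) \<and> bij_tuple \<sigma> (B i a) (\<lambda>t. \<sigma> t ` B i a t)"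
    if "finite_tuple U" "bij_tuple \<sigma> U V" "(n, h, B, g) \<in> comp_reps F G U" "a \<in> std n i"
    for U V \<sigma> n h B i a and g :: "'s \<Rightarrow> nat \<Rightarrow> 'y" and F :: "('s, 'x) species"
  proof -
    have "B i a t \<subseteq> U t" for t using comp_reps_block(1)[OF that(3,4)] .
    then show ?thesis
      using that(1,2) finite_subset inj_on_subset
      unfolding finite_tuple_def bij_tuple_def bij_betw_def by metis
  qed
  have 1: "transport ?C U \<sigma> x \<in> structs ?C V" if *: "finite_tuple U" "bij_tuple \<sigma> U V" "x \<in> structs ?C U" for U V \<sigma> x
  proof -
    obtain r where "r \<in> comp_reps F G U" "x = comp_rel F G U `` {r}" using cl[OF *(3)] by blast
    then show ?thesis using T[OF *(1,2)] T_in[OF *(1,2)] by (simp add: st quotientI)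
  qed
  have 2: "transport ?C U \<sigma> x = transport ?C U \<tau> x"
    if *: "finite_tuple U" "bij_tuple \<sigma> U V" "\<forall>i. \<forall>a\<in>U i. \<sigma> i a = \<tau> i a" "x \<in> structs ?C U" for U V \<sigma> \<tau> x
  proof -
    obtain n h B g where r: "(n, h, B, g) \<in> comp_reps F G U" "x = comp_rel F G U `` {(n, h, B, g)}"
      using cl[OF *(4)] by blast
    have \<tau>: "bij_tuple \<tau> U V" using bij_tuple_cong[of U \<sigma> \<tau> V] * by blast
    have "comp_rel F G V `` {?T \<sigma> (n, h, B, g)} = comp_rel F G V `` {?T \<tau> (n, h, B, g)}"
      unfolding comp_rep_transport_def prod.case
    proof (rule comp_class_eqI[OF F])
      show "(n, h, \<lambda>i a t. \<sigma> t ` B i a t, \<lambda>i a. transport (G i) (B i a) \<sigma> (g i a)) \<in> comp_reps F G V"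
        using T_in[OF *(1,2) r(1)] by (simp add: comp_rep_transport_def)
      show "(n, h, \<lambda>i a t. \<tau> t ` B i a t, \<lambda>i a. transport (G i) (B i a) \<tau> (g i a)) \<in> comp_reps F G V"
        using T_in[OF *(1) \<tau> r(1)] by (simp add: comp_rep_transport_def)
      fix i a assume a: "a \<in> std n i"
      note b = comp_reps_block[OF r(1) a]
      have "(\<lambda>t. \<sigma> t ` B i a t) = (\<lambda>t. \<tau> t ` B i a t)"
        using b(1) *(3) by (intro ext image_cong) auto
      moreover have "transport (G i) (B i a) \<sigma> (g i a) = transport (G i) (B i a) \<tau> (g i a)"
        using bl[OF *(1,2) r(1) a] b *(3) by (intro transport_cong[OF G]) auto
      ultimately show "(\<lambda>t. \<sigma> t ` B i a t) = (\<lambda>t. \<tau> t ` B i a t) \<and>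
        transport (G i) (B i a) \<sigma> (g i a) = transport (G i) (B i a) \<tau> (g i a)" by blast
    qed
    then show ?thesis using T[OF *(1,2) r(1)] T[OF *(1) \<tau> r(1)] r(2) by simp
  qed
  have 3: "transport ?C U (\<lambda>i. id) x = x" if *: "finite_tuple U" "x \<in> structs ?C U" for U x
  proof -
    obtain n h B g where r: "(n, h, B, g) \<in> comp_reps F G U" "x = comp_rel F G U `` {(n, h, B, g)}"
      using cl[OF *(2)] by blast
    have "comp_rel F G U `` {?T (\<lambda>i. id) (n, h, B, g)} = comp_rel F G U `` {(n, h, B, g)}"
      unfolding comp_rep_transport_def prod.case
    proof (rule comp_class_eqI[OF F _ r(1)])
      show "(n, h, \<lambda>i a t. id ` B i a t, \<lambda>i a. transport (G i) (B i a) (\<lambda>i. id) (g i a)) \<in> comp_reps F G U"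
        using T_in[OF *(1) bij_tuple_id r(1)] by (simp add: comp_rep_transport_def)
      fix i a assume a: "a \<in> std n i"
      note b = comp_reps_block[OF r(1) a]
      show "(\<lambda>t. id ` B i a t) = B i a \<and> transport (G i) (B i a) (\<lambda>i. id) (g i a) = g i a"
        using bl[OF *(1) bij_tuple_id r(1) a] b by (auto intro!: transport_id[OF G])
    qed
    then show ?thesis using T[OF *(1) bij_tuple_id r(1)] r by simp
  qed
  have 4: "transport ?C U (\<lambda>i. \<tau> i \<circ> \<sigma> i) x = transport ?C V \<tau> (transport ?C U \<sigma> x)"
    if *: "finite_tuple U" "bij_tuple \<sigma> U V" "bij_tuple \<tau> V W" "x \<in> structs ?C U" for U V W \<sigma> \<tau> x
  proof -
    obtain n h B g where r: "(n, h, B, g) \<in> comp_reps F G U" "x = comp_rel F G U `` {(n, h, B, g)}"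
      using cl[OF *(4)] by blast
    note \<tau>\<sigma> = bij_tuple_comp[OF *(2,3)] and V = bij_tuple_finite[OF *(2,1)]
    note rV = T_in[OF *(1,2) r(1)]
    have rV': "(n, h, \<lambda>i a t. \<sigma> t ` B i a t, \<lambda>i a. transport (G i) (B i a) \<sigma> (g i a)) \<in> comp_reps F G V"
      using rV by (simp add: comp_rep_transport_def)
    have "comp_rel F G W `` {?T (\<lambda>i. \<tau> i \<circ> \<sigma> i) (n, h, B, g)} = comp_rel F G W `` {?T \<tau> (?T \<sigma> (n, h, B, g))}"
      unfolding comp_rep_transport_def prod.case
    proof (rule comp_class_eqI[OF F])
      show "(n, h, \<lambda>i a t. (\<tau> t \<circ> \<sigma> t) ` B i a t, \<lambda>i a. transport (G i) (B i a) (\<lambda>i. \<tau> i \<circ> \<sigma> i) (g i a)) \<in> comp_reps F G W"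
        using T_in[OF *(1) \<tau>\<sigma> r(1)] by (simp add: comp_rep_transport_def)
      show "(n, h, \<lambda>i a t. \<tau> t ` \<sigma> t ` B i a t,
          \<lambda>i a. transport (G i) (\<lambda>t. \<sigma> t ` B i a t) \<tau> (transport (G i) (B i a) \<sigma> (g i a))) \<in> comp_reps F G W"
        using T_in[OF V *(3) rV] by (simp add: comp_rep_transport_def)
      fix i a assume a: "a \<in> std n i"
      note b = comp_reps_block[OF r(1) a]
      note b1 = bl[OF *(1,2) r(1) a] and b2 = bl[OF V *(3) rV' a]
      show "(\<lambda>t. (\<tau> t \<circ> \<sigma> t) ` B i a t) = (\<lambda>t. \<tau> t ` \<sigma> t ` B i a t) \<and>
        transport (G i) (B i a) (\<lambda>i. \<tau> i \<circ> \<sigma> i) (g i a) =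
        transport (G i) (\<lambda>t. \<sigma> t ` B i a t) \<tau> (transport (G i) (B i a) \<sigma> (g i a))"
        using transport_comp[OF G conjunct1[OF b1] conjunct2[OF b1] conjunct2[OF b2] b(2)]
        by (simp add: image_comp)
    qed
    then show ?thesis using T[OF *(1) \<tau>\<sigma> r(1)] T[OF *(1,2) r(1)] T[OF V *(3) rV] r(2) by simp
  qed
  show ?thesis unfolding is_species_def
    by (intro conjI allI impI ballI) (erule fin | erule (1) 3 | erule (2) 1 | erule (3) 2 | erule (3) 4)+
qed

section \<open>Renaming structures to natural numbers\<close>

lemma transport_recode:
  assumes F: "is_species F" and U: "finite_tuple U" and \<sigma>: "bij_tuple \<sigma> U V" and x: "x \<in> structs F U"
  shows "transport (recode F) U \<sigma> (to_nat_on (structs F U) x) = to_nat_on (structs F V) (transport F U \<sigma> x)"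
  using x species_finite[OF F U] by (simp add: recode_def bij_tuple_image[OF \<sigma>] countable_finite)

lemma structs_recode: "structs (recode F) U = to_nat_on (structs F U) ` structs F U"
  by (simp add: recode_def)

lemma recode_iso:
  assumes F: "is_species F"
  shows "F \<simeq>\<^sub>s recode F"
  unfolding species_iso_def
proof (intro exI[of _ "\<lambda>U. to_nat_on (structs F U)"] conjI allI impI ballI)
  show "bij_betw (to_nat_on (structs F U)) (structs F U) (structs (recode F) U)" if "finite_tuple U" for U
    unfolding structs_recode
    using species_finite[OF F that] inj_on_to_nat_on countable_finite by (blast intro: inj_on_imp_bij_betw)
qed (simp add: transport_recode[OF F])

lemma recode_species:
  assumes F: "is_species F"
  shows "is_species (recode F)"
proof -
  let ?R = "recode F"
  note T = transport_recode[OF F]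
  have "transport ?R U \<sigma> x = transport ?R U \<tau> x"
    if *: "finite_tuple U" "bij_tuple \<sigma> U V" "\<forall>i. \<forall>a\<in>U i. \<sigma> i a = \<tau> i a" "x \<in> structs ?R U" for U V \<sigma> \<tau> x
  proof -
    have \<tau>: "bij_tuple \<tau> U V" using bij_tuple_cong[of U \<sigma> \<tau> V] * by blast
    obtain y where y: "y \<in> structs F U" "x = to_nat_on (structs F U) y" using *(4) by (auto simp: structs_recode)
    have "transport F U \<sigma> y = transport F U \<tau> y" using *(3) by (intro transport_cong[OF F *(1,2) _ y(1)]) auto
    then show ?thesis using T[OF *(1,2) y(1)] T[OF *(1) \<tau> y(1)] y(2) by simp
  qed
  moreover have "transport ?R U (\<lambda>i. \<tau> i \<circ> \<sigma> i) x = transport ?R V \<tau> (transport ?R U \<sigma> x)"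
    if *: "finite_tuple U" "bij_tuple \<sigma> U V" "bij_tuple \<tau> V W" "x \<in> structs ?R U" for U V W \<sigma> \<tau> x
  proof -
    obtain y where y: "y \<in> structs F U" "x = to_nat_on (structs F U) y" using *(4) by (auto simp: structs_recode)
    show ?thesis
      using T[OF *(1) bij_tuple_comp[OF *(2,3)] y(1)] T[OF *(1,2) y(1)]
        T[OF bij_tuple_finite[OF *(2,1)] *(3) transport_in[OF F *(1,2) y(1)]]
        transport_comp[OF F *(1-3) y(1)] y(2) by simp
  qed
  moreover have "finite (structs ?R U)" if "finite_tuple U" for U
    using species_finite[OF F that] by (simp add: structs_recode)
  moreover have "transport ?R U \<sigma> x \<in> structs ?R V" if "finite_tuple U" "bij_tuple \<sigma> U V" "x \<in> structs ?R U" for U V \<sigma> x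
    using that T[OF that(1,2)] transport_in[OF F that(1,2)] by (auto simp: structs_recode)
  moreover have "transport ?R U (\<lambda>i. id) x = x" if "finite_tuple U" "x \<in> structs ?R U" for U x
    using that T[OF that(1) bij_tuple_id] transport_id[OF F that(1)] by (auto simp: structs_recode)
  ultimately show ?thesis unfolding is_species_def by blast
qed

lemma compose_species:
  fixes F :: "('s::finite, 'x) species" and G :: "'s \<Rightarrow> ('t::finite, 'y) species"
  assumes "is_species F" "\<And>i. is_species (G i)" "composable F G"
  shows "is_species (compose F G)"
  unfolding compose_def by (intro recode_species comp_classes_species assms)

lemma empty_species_species: "is_species empty_species"
  by (simp add: is_species_def empty_species_def)

lemma singleton_species_species: "is_species singleton_species"
  by (auto simp: is_species_def singleton_species_def bij_tuple_def dest: bij_betw_same_card)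

section \<open>Invariance of generating series\<close>

lemma egf_iso:
  fixes F :: "('s::finite, 'x) species"
  assumes "F \<simeq>\<^sub>s G"
  shows "egf F n = egf G n"
  using assms finite_tuple_std bij_betw_same_card unfolding species_iso_def egf_def by metis

text \<open>Any invariant that separates exactly the isomorphism classes may be used for counting
  them. It will be an orbit, an orbit seen through an isomorphism of species, or the type of a
  composed structure.\<close>

lemma ogf_kernel:
  assumes F: "is_species F"
    and f: "\<And>x y. x \<in> structs F (std n) \<Longrightarrow> y \<in> structs F (std n) \<Longrightarrow>
      f x = f y \<longleftrightarrow> (\<exists>\<sigma>. bij_tuple \<sigma> (std n) (std n) \<and> y = transport F (std n) \<sigma> x)"
  shows "ogf F n = of_nat (card (f ` structs F (std n)))"
proof -
  have "{(x, y). x \<in> structs F (std n) \<and> (\<exists>\<sigma>. bij_tuple \<sigma> (std n) (std n) \<and> y = transport F (std n) \<sigma> x)}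
    = {(x, y). x \<in> structs F (std n) \<and> y \<in> structs F (std n) \<and> f x = f y}"
    using f transport_in[OF F finite_tuple_std, of _ n "std n"] by blast
  then show ?thesis unfolding ogf_def by (simp add: card_quotient_kernel(1)[OF refl])
qed

text \<open>Isomorphism classes are orbits of structures with trivial decorations, so the results on
  decorated structures cover them.\<close>

definition iso_type :: "('s, 'x) species \<Rightarrow> ('s \<Rightarrow> nat) \<Rightarrow> 'x \<Rightarrow> ('x \<times> ('s \<Rightarrow> nat \<Rightarrow> unit)) set" where
  "iso_type F n x = deco_orbit F n (x, \<lambda>i a. ())"

lemma iso_type_eq_iff:
  assumes F: "is_species F" and x: "x \<in> structs F (std n)" and y: "y \<in> structs F (std n)"
  shows "iso_type F n x = iso_type F n y \<longleftrightarrow> (\<exists>\<sigma>. bij_tuple \<sigma> (std n) (std n) \<and> y = transport F (std n) \<sigma> x)"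
proof -
  have "iso_type F n x = iso_type F n y \<longleftrightarrow> (\<exists>\<sigma>\<in>relabelings n. y = transport F (std n) \<sigma> x)"
    unfolding iso_type_def by (subst deco_orbit_eq_iff[OF F]) (use x y in \<open>auto simp: relabel_def fun_eq_iff\<close>)
  also have "\<dots> \<longleftrightarrow> (\<exists>\<sigma>. bij_tuple \<sigma> (std n) (std n) \<and> y = transport F (std n) \<sigma> x)"
  proof
    assume "\<exists>\<sigma>. bij_tuple \<sigma> (std n) (std n) \<and> y = transport F (std n) \<sigma> x"
    then obtain \<sigma> where \<sigma>: "bij_tuple \<sigma> (std n) (std n)" "y = transport F (std n) \<sigma> x" by blast
    obtain \<tau> where \<tau>: "\<tau> \<in> relabelings n" "\<And>i a. a \<in> std n i \<Longrightarrow> \<tau> i a = \<sigma> i a"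
      using bij_tuple_relabeling[OF \<sigma>(1)] by blast
    then have "y = transport F (std n) \<tau> x"
      unfolding \<sigma>(2) using x by (intro transport_cong[OF F _ \<sigma>(1)]) auto
    then show "\<exists>\<sigma>\<in>relabelings n. y = transport F (std n) \<sigma> x" using \<tau> by blast
  qed (use relabelings_bij_tuple in blast)
  finally show ?thesis .
qed

lemma ogf_card: "is_species F \<Longrightarrow> ogf F n = of_nat (card (iso_type F n ` structs F (std n)))"
  by (rule ogf_kernel) (auto simp: iso_type_eq_iff)

lemma ogf_iso:
  assumes F: "is_species F" and G: "is_species G" and iso: "F \<simeq>\<^sub>s G"
  shows "ogf F n = ogf G n"
proof -
  obtain \<phi> where \<phi>: "\<And>U. finite_tuple U \<Longrightarrow> bij_betw (\<phi> U) (structs F U) (structs G U)"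
    "\<And>U V \<sigma> x. finite_tuple U \<Longrightarrow> bij_tuple \<sigma> U V \<Longrightarrow> x \<in> structs F U \<Longrightarrow>
      \<phi> V (transport F U \<sigma> x) = transport G U \<sigma> (\<phi> U x)"
    using iso unfolding species_iso_def by blast
  let ?\<phi> = "\<phi> (std n)"
  have bij: "bij_betw ?\<phi> (structs F (std n)) (structs G (std n))" by (simp add: \<phi>(1))
  have "ogf F n = of_nat (card ((iso_type G n \<circ> ?\<phi>) ` structs F (std n)))"
  proof (rule ogf_kernel[OF F])
    fix x y assume x: "x \<in> structs F (std n)" and y: "y \<in> structs F (std n)"
    have *: "?\<phi> y = transport G (std n) \<sigma> (?\<phi> x) \<longleftrightarrow> y = transport F (std n) \<sigma> x"
      if "bij_tuple \<sigma> (std n) (std n)" for \<sigma>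
      unfolding \<phi>(2)[OF finite_tuple_std that x, symmetric]
      using transport_in[OF F finite_tuple_std that x] y bij
      by (auto simp: bij_betw_def inj_on_eq_iff)
    have "?\<phi> x \<in> structs G (std n)" "?\<phi> y \<in> structs G (std n)" using bij x y by (auto simp: bij_betw_apply)
    from iso_type_eq_iff[OF G this] * show "(iso_type G n \<circ> ?\<phi>) x = (iso_type G n \<circ> ?\<phi>) y \<longleftrightarrow>
      (\<exists>\<sigma>. bij_tuple \<sigma> (std n) (std n) \<and> y = transport F (std n) \<sigma> x)"
      by auto
  qed
  also have "(iso_type G n \<circ> ?\<phi>) ` structs F (std n) = iso_type G n ` structs G (std n)"
    using bij by (metis bij_betw_def image_comp)
  finally show ?thesis by (simp add: ogf_card[OF G])
qed

section \<open>Polya's theorem\<close>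

text \<open>Since \<open>card\<close> vanishes on infinite sets, the product rules below assume that
  each weight occurs finitely often.\<close>

definition weight_gf :: "'a set \<Rightarrow> ('a \<Rightarrow> nat) \<Rightarrow> rat fps" where
  "weight_gf A w = Abs_fps (\<lambda>p. of_nat (card {x \<in> A. w x = p}))"

lemma weight_gf_bij:
  assumes f: "bij_betw f A B" and w: "\<And>x. x \<in> A \<Longrightarrow> v (f x) = w x"
  shows "weight_gf A w = weight_gf B v"
proof -
  have "bij_betw f {x \<in> A. w x = p} {x \<in> B. v x = p}" for p
    using f w by (force simp: bij_betw_def inj_on_def)
  then have "card {x \<in> A. w x = p} = card {x \<in> B. v x = p}" for p by (rule bij_betw_same_card)
  then show ?thesis by (simp add: weight_gf_def)
qed

lemma finite_weight_Times:
  fixes w :: "'a \<Rightarrow> nat" and v :: "'b \<Rightarrow> nat"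
  assumes "\<And>p. finite {x \<in> A. w x = p}" "\<And>p. finite {x \<in> B. v x = p}"
  shows "finite {x \<in> A \<times> B. w (fst x) + v (snd x) = p}"
proof -
  have "{x \<in> A \<times> B. w (fst x) + v (snd x) = p} = (\<Union>i\<le>p. {x \<in> A. w x = i} \<times> {x \<in> B. v x = p - i})"
    by auto
  then show ?thesis using assms by simp
qed

lemma weight_gf_Times:
  assumes "\<And>p. finite {x \<in> A. w x = p}" "\<And>p. finite {x \<in> B. v x = p}"
  shows "weight_gf (A \<times> B) (\<lambda>x. w (fst x) + v (snd x)) = weight_gf A w * weight_gf B v"
proof (rule fps_ext)
  fix p
  have "{x \<in> A \<times> B. w (fst x) + v (snd x) = p} = (\<Union>i\<in>{0..p}. {x \<in> A. w x = i} \<times> {x \<in> B. v x = p - i})"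
    by auto
  moreover have "card \<dots> = (\<Sum>i\<in>{0..p}. card ({x \<in> A. w x = i} \<times> {x \<in> B. v x = p - i}))"
    using assms by (intro card_UN_disjoint) auto
  ultimately show "fps_nth (weight_gf (A \<times> B) (\<lambda>x. w (fst x) + v (snd x))) p
    = fps_nth (weight_gf A w * weight_gf B v) p"
    by (simp add: weight_gf_def fps_mult_nth card_cartesian_product)
qed

lemma weight_gf_PiE:
  assumes "finite K" and "\<And>k p. k \<in> K \<Longrightarrow> finite {x \<in> T k. w k x = p}"
  shows "weight_gf (PiE K T) (\<lambda>c. \<Sum>k\<in>K. w k (c k)) = (\<Prod>k\<in>K. weight_gf (T k) (w k))"
proof -
  \<comment> \<open>Finiteness of the weight classes is carried through the induction, because the
    next application of \<open>weight_gf_Times\<close> asks for it on the product built so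
    far.\<close>
  have "weight_gf (PiE K T) (\<lambda>c. \<Sum>k\<in>K. w k (c k)) = (\<Prod>k\<in>K. weight_gf (T k) (w k)) \<and>
    (\<forall>p. finite {c \<in> PiE K T. (\<Sum>k\<in>K. w k (c k)) = p})"
    using assms
  proof (induction K rule: finite_induct)
    case empty
    have "{x. x = (\<lambda>x. undefined) \<and> p = 0} = (if p = 0 then {\<lambda>x. undefined} else {})" for p :: nat
      by auto
    then show ?case by (auto simp: weight_gf_def fps_eq_iff)
  next
    case (insert k K)
    let ?f = "\<lambda>(y, g). g(k := y)" and ?W = "\<lambda>c. \<Sum>j\<in>K. w j (c j)"
    have fin: "\<And>p. finite {x \<in> T k. w k x = p}" "\<And>p. finite {c \<in> PiE K T. ?W c = p}"
      using insert by auto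
    have bij: "bij_betw ?f (T k \<times> PiE K T) (PiE (insert k K) T)"
      using insert(2) by (auto simp: bij_betw_def PiE_insert_eq intro: inj_combinator)
    have wt: "(\<Sum>j\<in>insert k K. w j (?f x j)) = w k (fst x) + ?W (snd x)" if "x \<in> T k \<times> PiE K T" for x
    proof -
      have "(\<Sum>j\<in>K. w j (?f x j)) = ?W (snd x)"
        using insert(2) by (intro sum.cong) (auto simp: split_beta)
      then show ?thesis using insert(1,2) by (simp add: split_beta)
    qed
    have "weight_gf (PiE (insert k K) T) (\<lambda>c. \<Sum>j\<in>insert k K. w j (c j))
      = weight_gf (T k \<times> PiE K T) (\<lambda>x. w k (fst x) + ?W (snd x))"
      by (rule weight_gf_bij[symmetric, OF bij]) (rule wt)
    also have "\<dots> = weight_gf (T k) (w k) * weight_gf (PiE K T) ?W"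
      by (rule weight_gf_Times[OF fin])
    also have "\<dots> = (\<Prod>k\<in>insert k K. weight_gf (T k) (w k))"
      using insert by simp
    finally have 1: "weight_gf (PiE (insert k K) T) (\<lambda>c. \<Sum>j\<in>insert k K. w j (c j))
      = (\<Prod>k\<in>insert k K. weight_gf (T k) (w k))" .
    have "{c \<in> PiE (insert k K) T. (\<Sum>j\<in>insert k K. w j (c j)) = p}
      = ?f ` {x \<in> T k \<times> PiE K T. w k (fst x) + ?W (snd x) = p}" for p
    proof -
      have "PiE (insert k K) T = ?f ` (T k \<times> PiE K T)" using bij by (simp add: bij_betw_def)
      then show ?thesis using wt by (auto simp: image_iff)
    qed
    then show ?case using 1 finite_weight_Times[OF fin] by simp
  qed
  then show ?thesis by blast
qed

text \<open>A colour is a pair of its weight and a number that tells apart the colours of that weight.\<close>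

definition palette :: "(nat \<Rightarrow> nat) \<Rightarrow> (nat \<times> nat) set" where
  "palette y = {(k, l). l < y k}"

lemma fps_nth_compose_X_power:
  assumes "0 < j"
  shows "fps_nth (fps_compose f (fps_X ^ j)) k = (if j dvd k then fps_nth f (k div j) else 0)"
proof -
  have "fps_nth (fps_compose f (fps_X ^ j)) k = (\<Sum>i\<in>{0..k}. fps_nth f i * (if k = j * i then 1 else 0))"
    by (simp add: fps_compose_nth power_mult[symmetric])
  also have "\<dots> = (\<Sum>i\<in>{0..k}. if k = j * i then fps_nth f i else 0)"
    by (intro sum.cong) auto
  also have "\<dots> = (if j dvd k then fps_nth f (k div j) else 0)"
  proof (cases "j dvd k")
    case True
    then obtain l where l: "k = j * l" by blast
    then have "l \<le> k" "k div j = l" "\<And>i. k = j * i \<longleftrightarrow> i = l" using assms by auto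
    then show ?thesis using True by (simp add: sum.delta)
  next
    case False
    then show ?thesis by (auto intro!: sum.neutral)
  qed
  finally show ?thesis .
qed

lemma finite_palette: "0 < m \<Longrightarrow> finite {x \<in> palette y. m * fst x = p}"
proof -
  assume "0 < m"
  then have "{x \<in> palette y. m * fst x = p} \<subseteq> {p div m} \<times> {..<y (p div m)}"
    by (auto simp: palette_def)
  then show ?thesis by (rule finite_subset) auto
qed

text \<open>A colour repeated on a cycle of length \<open>m\<close> counts \<open>m\<close> times,
  and multiplying weights by \<open>m\<close> is the substitution of \<open>z^m\<close> for
  \<open>z\<close>.\<close>

lemma weight_gf_palette:
  assumes "0 < m"
  shows "weight_gf (palette y) (\<lambda>x. m * fst x) = fps_compose (Abs_fps (\<lambda>k. of_nat (y k))) (fps_X ^ m)"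
proof (rule fps_ext)
  fix p
  have "{x \<in> palette y. m * fst x = p} = (if m dvd p then {p div m} \<times> {..<y (p div m)} else {})"
    using assms by (auto simp: palette_def)
  then show "fps_nth (weight_gf (palette y) (\<lambda>x. m * fst x)) p
    = fps_nth (fps_compose (Abs_fps (\<lambda>k. of_nat (y k))) (fps_X ^ m)) p"
    using assms by (simp add: weight_gf_def fps_nth_compose_X_power)
qed

section \<open>Cycles of a permutation as orbits\<close>

lemma
  assumes "\<sigma> permutes S" "finite S"
  shows permutes_self_in_orbit: "x \<in> orbit \<sigma> x"
    and permutes_orbit_eq: "y \<in> orbit \<sigma> x \<Longrightarrow> orbit \<sigma> y = orbit \<sigma> x"
proof -
  have p: "permutation \<sigma>" using assms by (auto simp: permutation_permutes)
  then show "x \<in> orbit \<sigma> x" by (rule permutation_self_in_orbit)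
  show "orbit \<sigma> y = orbit \<sigma> x" if "y \<in> orbit \<sigma> x"
    using orbit_cyclic_eq3[OF cyclic_on_orbit'[OF p] that] .
qed

lemma permutes_orbit_fibre:
  assumes "\<sigma> permutes S" "finite S" "C \<in> orbit \<sigma> ` S"
  shows "{a \<in> S. orbit \<sigma> a = C} = C" "0 < card C" "card C \<le> card S"
proof -
  obtain x where x: "x \<in> S" "C = orbit \<sigma> x" using assms(3) by blast
  have sub: "C \<subseteq> S" using permutes_orbit_subset[OF assms(1) x(1)] x(2) by simp
  then show "{a \<in> S. orbit \<sigma> a = C} = C"
    using permutes_orbit_eq[OF assms(1,2)] permutes_self_in_orbit[OF assms(1,2)] x by blast
  show "card C \<le> card S" using sub assms(2) card_mono by blast
  show "0 < card C" using sub assms(2) x permutes_self_in_orbit[OF assms(1,2), of x]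
    by (metis card_gt_0_iff empty_iff finite_subset)
qed

text \<open>Grouping the cycles by length turns the defining product over \<open>j\<close> into a
  product with one factor per cycle. This is the form in which colours are chosen and in which a
  derivative deletes a factor.\<close>

lemma prod_num_cycles:
  assumes "\<sigma> permutes {1..n}"
  shows "(\<Prod>j\<in>{1..n}. x j ^ num_cycles n j \<sigma>) = (\<Prod>C\<in>orbit \<sigma> ` {1..n}. x (card C))"
proof -
  let ?O = "orbit \<sigma> ` {1..n}"
  have "card ` ?O \<subseteq> {1..n}"
    using permutes_orbit_fibre(2,3)[OF assms finite_atLeastAtMost] by (fastforce simp: Suc_le_eq)
  then have "(\<Prod>C\<in>?O. x (card C)) = (\<Prod>j\<in>{1..n}. \<Prod>C\<in>{C \<in> ?O. card C = j}. x (card C))"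
    by (intro prod.group[symmetric]) auto
  also have "\<dots> = (\<Prod>j\<in>{1..n}. x j ^ num_cycles n j \<sigma>)"
    by (intro prod.cong) (simp_all add: num_cycles_def)
  finally show ?thesis by simp
qed

definition colourings :: "('s::finite \<Rightarrow> nat \<Rightarrow> nat) \<Rightarrow> ('s \<Rightarrow> nat) \<Rightarrow> ('s \<Rightarrow> nat \<Rightarrow> nat \<times> nat) set" where
  "colourings y n = PiE UNIV (\<lambda>i. PiE (std n i) (\<lambda>_. palette (y i)))"

definition weight :: "('s::finite \<Rightarrow> nat) \<Rightarrow> ('s \<Rightarrow> nat \<Rightarrow> nat \<times> nat) \<Rightarrow> nat" where
  "weight n c = (\<Sum>i\<in>UNIV. \<Sum>a\<in>std n i. fst (c i a))"

text \<open>A colouring is fixed iff it is constant on cycles, hence it amounts to one free choice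
  of colour per cycle. A cycle of length \<open>j\<close> in sort \<open>i\<close> then contributes
  the series of \<open>y i\<close> at \<open>z^j\<close>, as in the Polya operator.\<close>

lemma fixed_colourings_gf:
  fixes y :: "'s::finite \<Rightarrow> nat \<Rightarrow> nat"
  assumes \<sigma>: "\<sigma> \<in> relabelings n"
  shows "weight_gf {c \<in> colourings y n. (\<lambda>i. c i \<circ> inv (\<sigma> i)) = c} (weight n)
    = (\<Prod>i\<in>UNIV. \<Prod>C\<in>orbit (\<sigma> i) ` std n i. fps_compose (Abs_fps (\<lambda>k. of_nat (y i k))) (fps_X ^ card C))"
proof -
  have p: "\<sigma> i permutes std n i" and fin [simp]: "finite (std n i)" for i
    using \<sigma> by (simp_all add: relabelings_def std_def)
  note fib = permutes_orbit_fibre[OF p fin]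
  let ?K = "SIGMA i:UNIV. orbit (\<sigma> i) ` std n i"
  let ?T = "\<lambda>(i, C). palette (y i)" and ?w = "\<lambda>(i, C) x. card C * fst x"
  let ?X = "{c \<in> colourings y n. (\<lambda>i. c i \<circ> inv (\<sigma> i)) = c}"
  let ?f = "\<lambda>d. restr n (\<lambda>i a. d (i, orbit (\<sigma> i) a))"
  \<comment> \<open>Reads the colour of a cycle off an arbitrary point of it; by
    \<open>const\<close> the choice is immaterial.\<close>
  let ?g = "\<lambda>c. \<lambda>k\<in>?K. c (fst k) (SOME a. a \<in> snd k)"
  have const: "c i a' = c i a" if c: "c \<in> ?X" and a: "a' \<in> orbit (\<sigma> i) a" for c i a a'
  proof -
    have step: "c i (\<sigma> i b) = c i b" for b
    proof -
      have "(c i \<circ> inv (\<sigma> i)) (\<sigma> i b) = c i (\<sigma> i b)" using c by (simp add: fun_eq_iff)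
      then show ?thesis using permutes_inverses(2)[OF p] by simp
    qed
    show ?thesis using a by (induct rule: orbit.induct) (simp_all add: step)
  qed
  have some: "(SOME a. a \<in> orbit (\<sigma> i) b) \<in> orbit (\<sigma> i) b" for i b
    using permutes_self_in_orbit[OF p fin] by (rule someI)
  have "bij_betw ?f (PiE ?K ?T) ?X"
  proof (rule bij_betwI[where g = ?g])
    show "?f \<in> PiE ?K ?T \<rightarrow> ?X"
    proof
      fix d assume d: "d \<in> PiE ?K ?T"
      have "orbit (\<sigma> i) (inv (\<sigma> i) a) = orbit (\<sigma> i) a" for i a
        using permutes_orbit_eq[OF p fin, of a i "inv (\<sigma> i) a"] orbit.base[of "\<sigma> i" "inv (\<sigma> i) a"]
          permutes_inverses(1)[OF p] by simp
      then have "(\<lambda>i. ?f d i \<circ> inv (\<sigma> i)) = ?f d"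
        using permutes_in_image[OF permutes_inv[OF p]] by (auto simp: restr_def fun_eq_iff restrict_def)
      moreover have "?f d \<in> colourings y n" using d by (fastforce simp: colourings_def restr_def)
      ultimately show "?f d \<in> ?X" by simp
    qed
    show "?g \<in> ?X \<rightarrow> PiE ?K ?T"
    proof
      fix c assume c: "c \<in> ?X"
      have "c i (SOME a. a \<in> orbit (\<sigma> i) b) \<in> palette (y i)" if "b \<in> std n i" for i b
        using some[of i b] permutes_orbit_subset[OF p that] c by (auto simp: colourings_def PiE_iff)
      then show "?g c \<in> PiE ?K ?T" by auto
    qed
    show "?g (?f d) = d" if d: "d \<in> PiE ?K ?T" for d
    proof (rule ext)
      fix k
      show "?g (?f d) k = d k"
      proof (cases "k \<in> ?K")
        case True
        then obtain i b where k: "k = (i, orbit (\<sigma> i) b)" "b \<in> std n i" by auto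
        then show ?thesis
          using some[of i b] permutes_orbit_subset[OF p k(2)] permutes_orbit_eq[OF p fin some[of i b]] True
          by (auto simp: restr_def)
      next
        case False
        then show ?thesis using PiE_arb[OF d] by simp
      qed
    qed
    show "?f (?g c) = c" if c: "c \<in> ?X" for c
    proof (intro ext)
      fix i a
      show "?f (?g c) i a = c i a"
      proof (cases "a \<in> std n i")
        case True
        then show ?thesis using const[OF c some] by (simp add: restr_def)
      next
        case False
        then show ?thesis using c by (auto simp: restr_def colourings_def PiE_iff extensional_def)
      qed
    qed
  qed
  moreover have "weight n (?f d) = (\<Sum>k\<in>?K. ?w k (d k))" for d
  proof -
    have "(\<Sum>a\<in>std n i. fst (d (i, orbit (\<sigma> i) a))) = (\<Sum>C\<in>orbit (\<sigma> i) ` std n i. card C * fst (d (i, C)))" for i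
    proof -
      have "(\<Sum>a\<in>std n i. fst (d (i, orbit (\<sigma> i) a)))
        = (\<Sum>C\<in>orbit (\<sigma> i) ` std n i. \<Sum>a\<in>{a \<in> std n i. orbit (\<sigma> i) a = C}. fst (d (i, orbit (\<sigma> i) a)))"
        by (rule sum.image_gen) simp
      also have "\<dots> = (\<Sum>C\<in>orbit (\<sigma> i) ` std n i. \<Sum>a\<in>{a \<in> std n i. orbit (\<sigma> i) a = C}. fst (d (i, C)))"
        by (intro sum.cong) auto
      also have "\<dots> = (\<Sum>C\<in>orbit (\<sigma> i) ` std n i. card C * fst (d (i, C)))"
        by (intro sum.cong) (simp_all add: fib(1))
      finally show ?thesis .
    qed
    then have "weight n (?f d) = (\<Sum>i\<in>UNIV. \<Sum>C\<in>orbit (\<sigma> i) ` std n i. card C * fst (d (i, C)))"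
      by (simp add: weight_def restr_def)
    also have "\<dots> = (\<Sum>k\<in>?K. ?w k (d k))"
      by (subst sum.Sigma) (auto simp: split_beta)
    finally show ?thesis .
  qed
  ultimately have "weight_gf ?X (weight n) = weight_gf (PiE ?K ?T) (\<lambda>d. \<Sum>k\<in>?K. ?w k (d k))"
    by (intro weight_gf_bij[symmetric])
  also have "\<dots> = (\<Prod>k\<in>?K. weight_gf (?T k) (?w k))"
    by (rule weight_gf_PiE) (auto intro!: finite_palette fib(2))
  also have "\<dots> = (\<Prod>i\<in>UNIV. \<Prod>C\<in>orbit (\<sigma> i) ` std n i. weight_gf (?T (i, C)) (?w (i, C)))"
    by (subst prod.Sigma) (auto simp: split_beta)
  also have "\<dots> = (\<Prod>i\<in>UNIV. \<Prod>C\<in>orbit (\<sigma> i) ` std n i. fps_compose (Abs_fps (\<lambda>k. of_nat (y i k))) (fps_X ^ card C))"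
  proof (intro prod.cong refl)
    fix i C assume "C \<in> orbit (\<sigma> i) ` std n i"
    from weight_gf_palette[OF fib(2)[OF this], of "y i"]
    show "weight_gf (?T (i, C)) (?w (i, C)) = fps_compose (Abs_fps (\<lambda>k. of_nat (y i k))) (fps_X ^ card C)"
      by simp
  qed
  finally show ?thesis .
qed

lemma finite_colourings: "finite {c \<in> colourings y n. weight n c = p}"
proof -
  have "c i a \<in> Sigma {..p} (\<lambda>k. {..<y i k})" if "c \<in> colourings y n" "weight n c = p" "a \<in> std n i" for c i a
  proof -
    have "fst (c i a) \<le> (\<Sum>a\<in>std n i. fst (c i a))"
      using that(3) by (intro member_le_sum) (auto simp: std_def)
    also have "\<dots> \<le> weight n c" unfolding weight_def by (intro member_le_sum) auto
    finally have "fst (c i a) \<le> p" using that by simp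
    moreover have "c i a \<in> palette (y i)" using that by (auto simp: colourings_def PiE_iff)
    ultimately show ?thesis by (auto simp: palette_def)
  qed
  moreover have "c i \<in> extensional (std n i)" if "c \<in> colourings y n" for c i
    using that by (auto simp: colourings_def PiE_iff)
  ultimately have "{c \<in> colourings y n. weight n c = p} \<subseteq>
    PiE UNIV (\<lambda>i. PiE (std n i) (\<lambda>_. Sigma {..p} (\<lambda>k. {..<y i k})))"
    by (simp add: subset_iff PiE_iff del: mem_Sigma_iff)
  moreover have "finite \<dots>" by (intro finite_PiE) (auto simp: std_def)
  ultimately show ?thesis by (rule finite_subset)
qed

definition coloured :: "('s::finite, 'x) species \<Rightarrow> ('s \<Rightarrow> nat \<Rightarrow> nat) \<Rightarrow> ('s \<Rightarrow> nat) \<Rightarrow> nat \<Rightarrow>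
    ('x \<times> ('s \<Rightarrow> nat \<Rightarrow> nat \<times> nat)) set" where
  "coloured F y n p = structs F (std n) \<times> {c \<in> colourings y n. weight n c = p}"

lemma weight_relabel:
  assumes "\<sigma> \<in> relabelings n"
  shows "weight n (\<lambda>i. c i \<circ> inv (\<sigma> i)) = weight n c"
  unfolding weight_def
proof (rule sum.cong[OF refl])
  fix i
  have "inv (\<sigma> i) permutes std n i" using assms by (simp add: relabelings_def std_def permutes_inv)
  from sum.permute[OF this, of "\<lambda>a. fst (c i a)"]
  show "(\<Sum>a\<in>std n i. fst ((c i \<circ> inv (\<sigma> i)) a)) = (\<Sum>a\<in>std n i. fst (c i a))" by (simp add: o_def)
qed

lemma colourings_relabel:
  assumes "\<sigma> \<in> relabelings n" "c \<in> colourings y n"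
  shows "(\<lambda>i. c i \<circ> inv (\<sigma> i)) \<in> colourings y n"
proof -
  have "inv (\<sigma> i) permutes std n i" for i using assms by (simp add: relabelings_def std_def permutes_inv)
  from permutes_in_image[OF this] show ?thesis
    using assms(2) by (auto simp: colourings_def PiE_iff extensional_def)
qed

text \<open>A fixed coloured structure is a fixed structure together with a fixed colouring, so the
  number of fixed points in weight \<open>p\<close> is a coefficient of \<open>num_fixed\<close>
  times the cycle monomial. Averaging over the relabelings counts orbits.\<close>

theorem cycle_index_term_colours:
  fixes F :: "('s::finite, 'x) species"
  assumes F: "is_species F"
  shows "fps_nth (cycle_index_term F (\<lambda>i j. fps_compose (Abs_fps (\<lambda>k. of_nat (y i k))) (fps_X ^ j)) n) p
    = of_nat (card (deco_orbit F n ` coloured F y n p))"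
proof -
  let ?x = "\<lambda>i j. fps_compose (Abs_fps (\<lambda>k. of_nat (y i k) :: rat)) (fps_X ^ j)"
  let ?X = "coloured F y n p"
  have fix1: "{x \<in> ?X. relabel F n \<sigma> x = x} = {h \<in> structs F (std n). transport F (std n) \<sigma> h = h} \<times>
      {c \<in> {c \<in> colourings y n. (\<lambda>i. c i \<circ> inv (\<sigma> i)) = c}. weight n c = p}" for \<sigma>
    by (auto simp: coloured_def relabel_def)
  have fix2: "of_nat (card {x \<in> ?X. relabel F n \<sigma> x = x}) =
      fps_nth (of_nat (num_fixed F n \<sigma>) * (\<Prod>i\<in>UNIV. \<Prod>j\<in>{1..n i}. ?x i j ^ num_cycles (n i) j (\<sigma> i))) p"
    if \<sigma>: "\<sigma> \<in> relabelings n" for \<sigma>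
  proof -
    have "(\<Prod>i\<in>UNIV. \<Prod>j\<in>{1..n i}. ?x i j ^ num_cycles (n i) j (\<sigma> i))
      = (\<Prod>i\<in>UNIV. \<Prod>C\<in>orbit (\<sigma> i) ` std n i. ?x i (card C))"
      using \<sigma> unfolding std_def by (intro prod.cong refl prod_num_cycles) (simp add: relabelings_def)
    also have "\<dots> = weight_gf {c \<in> colourings y n. (\<lambda>i. c i \<circ> inv (\<sigma> i)) = c} (weight n)"
      by (rule fixed_colourings_gf[OF \<sigma>, symmetric])
    finally show ?thesis
      unfolding fix1 card_cartesian_product
      by (simp add: num_fixed_def weight_gf_def fps_of_nat[symmetric])
  qed
  have "fps_nth (cycle_index_term F ?x n) p = (1 / (\<Prod>i\<in>UNIV. fact (n i))) *
      (\<Sum>\<sigma>\<in>relabelings n. of_nat (card {x \<in> ?X. relabel F n \<sigma> x = x}))"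
    unfolding cycle_index_term_def fps_mult_left_const_nth
    by (simp add: fps_sum_nth fix2 relabelings_def)
  also have "(\<Sum>\<sigma>\<in>relabelings n. of_nat (card {x \<in> ?X. relabel F n \<sigma> x = x}))
      = (of_nat (card (deco_orbit F n ` ?X) * (\<Prod>i\<in>UNIV. fact (n i))) :: rat)"
  proof (subst burnside_relabel[OF F, symmetric])
    show "finite ?X" unfolding coloured_def
      using finite_colourings[of y n p] species_finite[OF F] by (intro finite_cartesian_product) auto
    show "relabel F n \<sigma> x \<in> ?X" if "\<sigma> \<in> relabelings n" "x \<in> ?X" for \<sigma> x
      using that relabel_in[OF F that(1), of x] weight_relabel[OF that(1)] colourings_relabel[OF that(1)]
      by (auto simp: coloured_def relabel_def)
  qed (auto simp: coloured_def)
  also have "(1 / (\<Prod>i\<in>UNIV. fact (n i))) * \<dots> = of_nat (card (deco_orbit F n ` ?X))"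
    by simp
  finally show ?thesis .
qed

section \<open>Ordinary generating series of a composition\<close>

definition type_count :: "(unit, 'y) species \<Rightarrow> nat \<Rightarrow> nat" where
  "type_count G k = card (iso_type G (\<lambda>_. k) ` structs G (std (\<lambda>_. k)))"

lemma ogf_type_count: "is_species G \<Longrightarrow> ogf G (\<lambda>_. k) = of_nat (type_count G k)"
  by (simp add: ogf_card type_count_def)

text \<open>Types are numbered on the standard set of each size and moved to any \<open>B\<close>
  along a chosen bijection \<open>\<beta> B\<close>. The number therefore compares structures on
  different sets of equal size, and every number below \<open>type_count\<close> is attained on
  every such set.\<close>

lemma ex_type_index:
  fixes G :: "(unit, 'y) species"
  assumes G: "is_species G"
  shows "\<exists>idx. (\<forall>B g. finite_tuple B \<longrightarrow> g \<in> structs G B \<longrightarrow> idx B g < type_count G (card (B ()))) \<and>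
    (\<forall>B g B' g'. finite_tuple B \<longrightarrow> finite_tuple B' \<longrightarrow> g \<in> structs G B \<longrightarrow> g' \<in> structs G B' \<longrightarrow>
       card (B ()) = card (B' ()) \<longrightarrow>
       (idx B g = idx B' g' \<longleftrightarrow> (\<exists>\<tau>. bij_tuple \<tau> B B' \<and> g' = transport G B \<tau> g))) \<and>
    (\<forall>B l. finite_tuple B \<longrightarrow> l < type_count G (card (B ())) \<longrightarrow> (\<exists>g\<in>structs G B. idx B g = l))"
proof -
  define \<beta> where "\<beta> B = (SOME \<beta>. bij_tuple \<beta> B (std (\<lambda>_::unit. card (B ()))))" for B
  define T where "T k = iso_type G (\<lambda>_. k) ` structs G (std (\<lambda>_. k))" for k
  define idx where "idx B g = to_nat_on (T (card (B ()))) (iso_type G (\<lambda>_. card (B ())) (transport G B (\<beta> B) g))" for B g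
  have \<beta>: "bij_tuple (\<beta> B) B (std (\<lambda>_. card (B ())))" if B: "finite_tuple B" for B
  proof -
    obtain \<sigma> where "bij_tuple \<sigma> B (std (\<lambda>_. card (B ())))"
    proof (rule ex_bij_tuple[OF B finite_tuple_std])
      show "card (B i) = card (std (\<lambda>_. card (B ())) i)" for i by (cases i) (simp add: std_def)
    qed
    then show ?thesis
      unfolding \<beta>_def by (rule someI[of "\<lambda>\<beta>. bij_tuple \<beta> B (std (\<lambda>_. card (B ())))"])
  qed
  have finT: "finite (T k)" for k
    using species_finite[OF G finite_tuple_std] by (simp add: T_def)
  have cT: "type_count G k = card (T k)" for k by (simp add: type_count_def T_def)
  have inT: "iso_type G (\<lambda>_. card (B ())) (transport G B (\<beta> B) g) \<in> T (card (B ()))"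
    if "finite_tuple B" "g \<in> structs G B" for B g
    using transport_in[OF G that(1) \<beta>[OF that(1)] that(2)] by (simp add: T_def)
  have bijT: "bij_betw (to_nat_on (T k)) (T k) {..<card (T k)}" for k
    using to_nat_on_finite[OF finT] .
  have 1: "idx B g < type_count G (card (B ()))" if "finite_tuple B" "g \<in> structs G B" for B g
    using bij_betw_apply[OF bijT inT[OF that]] by (simp add: idx_def cT)
  have 2: "idx B g = idx B' g' \<longleftrightarrow> (\<exists>\<tau>. bij_tuple \<tau> B B' \<and> g' = transport G B \<tau> g)"
    if B: "finite_tuple B" "g \<in> structs G B" and B': "finite_tuple B'" "g' \<in> structs G B'"
      and c: "card (B ()) = card (B' ())" for B g B' g'
  proof -
    let ?k = "\<lambda>_::unit. card (B' ())"
    let ?S = "std ?k" and ?t = "transport G B (\<beta> B) g" and ?t' = "transport G B' (\<beta> B') g'"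
    note b = \<beta>[OF B(1), unfolded c] and b' = \<beta>[OF B'(1)]
    note i = bij_tuple_inverse[OF b] and i' = bij_tuple_inverse[OF b']
    have t: "?t \<in> structs G ?S" "?t' \<in> structs G ?S"
      using transport_in[OF G B(1) b B(2)] transport_in[OF G B'(1) b' B'(2)] by auto
    have ret: "transport G ?S (\<lambda>i. inv_into (B i) (\<beta> B i)) ?t = g"
      using b by (intro transport_inverse[OF G B(1) b i B(2)]) (auto simp: bij_tuple_def bij_betw_def)
    have ret': "transport G ?S (\<lambda>i. inv_into (B' i) (\<beta> B' i)) ?t' = g'"
      using b' by (intro transport_inverse[OF G B'(1) b' i' B'(2)]) (auto simp: bij_tuple_def bij_betw_def)
    have "idx B g = idx B' g' \<longleftrightarrow> iso_type G ?k ?t = iso_type G ?k ?t'"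
      unfolding idx_def c using inj_on_eq_iff[OF bij_betw_imp_inj_on[OF bijT] inT[OF B, unfolded c] inT[OF B']] .
    also have "\<dots> \<longleftrightarrow> (\<exists>\<sigma>. bij_tuple \<sigma> ?S ?S \<and> ?t' = transport G ?S \<sigma> ?t)"
      by (rule iso_type_eq_iff[OF G t])
    also have "\<dots> \<longleftrightarrow> (\<exists>\<tau>. bij_tuple \<tau> B B' \<and> g' = transport G B \<tau> g)"
    proof
      assume "\<exists>\<sigma>. bij_tuple \<sigma> ?S ?S \<and> ?t' = transport G ?S \<sigma> ?t"
      then obtain \<sigma> where \<sigma>: "bij_tuple \<sigma> ?S ?S" "?t' = transport G ?S \<sigma> ?t" by blast
      note \<sigma>b = bij_tuple_comp[OF b \<sigma>(1)]
      have "g' = transport G ?S (\<lambda>i. inv_into (B' i) (\<beta> B' i)) (transport G B (\<lambda>i. \<sigma> i \<circ> \<beta> B i) g)"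
        using ret' unfolding \<sigma>(2) by (simp add: transport_comp[OF G B(1) b \<sigma>(1) B(2)])
      also have "\<dots> = transport G B (\<lambda>i. inv_into (B' i) (\<beta> B' i) \<circ> (\<sigma> i \<circ> \<beta> B i)) g"
        by (rule transport_comp[OF G B(1) \<sigma>b i' B(2)])
      finally show "\<exists>\<tau>. bij_tuple \<tau> B B' \<and> g' = transport G B \<tau> g"
        using bij_tuple_comp[OF \<sigma>b i'] by blast
    next
      assume "\<exists>\<tau>. bij_tuple \<tau> B B' \<and> g' = transport G B \<tau> g"
      then obtain \<tau> where \<tau>: "bij_tuple \<tau> B B'" "g' = transport G B \<tau> g" by blast
      note \<tau>i = bij_tuple_comp[OF i \<tau>(1)]
      have "g' = transport G ?S (\<lambda>j. \<tau> j \<circ> inv_into (B j) (\<beta> B j)) ?t"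
        unfolding \<tau>(2) using transport_comp[OF G finite_tuple_std i \<tau>(1) t(1)] ret by simp
      then have "?t' = transport G ?S (\<lambda>j. \<beta> B' j \<circ> (\<tau> j \<circ> inv_into (B j) (\<beta> B j))) ?t"
        using transport_comp[OF G finite_tuple_std \<tau>i b' t(1)] by simp
      then show "\<exists>\<sigma>. bij_tuple \<sigma> ?S ?S \<and> ?t' = transport G ?S \<sigma> ?t"
        using bij_tuple_comp[OF \<tau>i b'] by blast
    qed
    finally show ?thesis .
  qed
  have 3: "\<exists>g\<in>structs G B. idx B g = l" if B: "finite_tuple B" and l: "l < type_count G (card (B ()))" for B l
  proof -
    have "l \<in> to_nat_on (T (card (B ()))) ` T (card (B ()))"
      using bijT l by (simp add: bij_betw_def cT)
    then obtain x where x: "x \<in> structs G (std (\<lambda>_. card (B ())))"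
      "l = to_nat_on (T (card (B ()))) (iso_type G (\<lambda>_. card (B ())) x)" by (auto simp: T_def)
    then obtain g where "g \<in> structs G B" "x = transport G B (\<beta> B) g"
      using bij_betw_transport[OF G B \<beta>[OF B]] by (auto simp: bij_betw_def)
    then show ?thesis using x by (auto simp: idx_def)
  qed
  show ?thesis by (rule exI[of _ idx]) (use 1 2 3 in simp)
qed

text \<open>Cut off one block at a time. A width \<open>w k = 0\<close> is allowed, as blocks may be
  empty.\<close>

lemma ex_blocks:
  assumes "finite K" "finite U" "(\<Sum>k\<in>K. w k) = card U"
  shows "\<exists>B. (\<forall>k\<in>K. card (B k) = w k) \<and> disjoint_family_on B K \<and> (\<Union>k\<in>K. B k) = U"
  using assms
proof (induction K arbitrary: U rule: finite_induct)
  case (insert k K)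
  then have "w k \<le> card U" by simp
  then obtain V where V: "V \<subseteq> U" "card V = w k" by (meson obtain_subset_with_card_n)
  have "(\<Sum>k\<in>K. w k) = card (U - V)"
    using insert V by (simp add: card_Diff_subset finite_subset)
  then obtain B where B: "\<forall>k\<in>K. card (B k) = w k" "disjoint_family_on B K" "(\<Union>k\<in>K. B k) = U - V"
    using insert.IH[of "U - V"] insert.prems by auto
  let ?B = "B(k := V)"
  have eq: "?B j = B j" if "j \<in> K" for j using that insert by auto
  have "\<forall>j\<in>insert k K. card (?B j) = w j" using B V eq by simp
  moreover have "(\<Union>j\<in>K. ?B j) = (\<Union>j\<in>K. B j)" by (rule SUP_cong[OF refl]) (rule eq)
  then have "(\<Union>j\<in>insert k K. ?B j) = V \<union> (U - V)" unfolding B(3) UN_insert by simp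
  then have "(\<Union>j\<in>insert k K. ?B j) = U" using V(1) by blast
  moreover have "disjoint_family_on ?B (insert k K)"
    unfolding disjoint_family_on_def
  proof (intro ballI impI)
    fix i j assume "i \<in> insert k K" "j \<in> insert k K" "i \<noteq> j"
    then show "?B i \<inter> ?B j = {}" using B(2,3) by (auto simp: disjoint_family_on_def)
  qed
  ultimately show ?case by blast
qed (simp add: disjoint_family_on_def)

locale type_colours =
  fixes F :: "('s::finite, 'x) species" and G :: "'s \<Rightarrow> (unit, 'y) species"
    and idx :: "'s \<Rightarrow> (unit \<Rightarrow> nat set) \<Rightarrow> 'y \<Rightarrow> nat"
  assumes F: "is_species F" and G: "\<And>i. is_species (G i)" and comp: "composable F G"
    and idx_less: "finite_tuple B \<Longrightarrow> g \<in> structs (G i) B \<Longrightarrow> idx i B g < type_count (G i) (card (B ()))"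
    and idx_eq: "finite_tuple B \<Longrightarrow> finite_tuple B' \<Longrightarrow> g \<in> structs (G i) B \<Longrightarrow> g' \<in> structs (G i) B' \<Longrightarrow>
       card (B ()) = card (B' ()) \<Longrightarrow>
       idx i B g = idx i B' g' \<longleftrightarrow> (\<exists>\<tau>. bij_tuple \<tau> B B' \<and> g' = transport (G i) B \<tau> g)"
    and idx_surj: "finite_tuple B \<Longrightarrow> l < type_count (G i) (card (B ())) \<Longrightarrow> \<exists>g\<in>structs (G i) B. idx i B g = l"
begin

definition col :: "'s \<Rightarrow> (unit \<Rightarrow> nat set) \<Rightarrow> 'y \<Rightarrow> nat \<times> nat" where
  "col i B g = (card (B ()), idx i B g)"

lemma col_eq_iff:
  assumes "finite_tuple B" "finite_tuple B'" "g \<in> structs (G i) B" "g' \<in> structs (G i) B'"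
  shows "col i B g = col i B' g' \<longleftrightarrow> (\<exists>\<tau>. bij_tuple \<tau> B B' \<and> g' = transport (G i) B \<tau> g)"
proof
  assume "\<exists>\<tau>. bij_tuple \<tau> B B' \<and> g' = transport (G i) B \<tau> g"
  moreover from this have "card (B ()) = card (B' ())" by (auto simp: bij_tuple_def bij_betw_same_card)
  ultimately show "col i B g = col i B' g'" using idx_eq[OF assms] by (simp add: col_def)
qed (use idx_eq[OF assms] in \<open>simp add: col_def\<close>)

text \<open>Compared with \<open>comp_key\<close>, a block is remembered only by its size and the
  type of the structure on it, which is what survives when the labels of \<open>U\<close> are
  permuted.\<close>

fun comp_type :: "('s, 'x, unit, 'y) comp_rep \<Rightarrow> ('s \<Rightarrow> nat) \<times> ('x \<times> ('s \<Rightarrow> nat \<Rightarrow> nat \<times> nat)) set" where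
  "comp_type (n, h, B, g) = (n, deco_orbit F n (h, restr n (\<lambda>i a. col i (B i a) (g i a))))"

lemma finite_block:
  "(n, h, B, g) \<in> comp_reps F G U \<Longrightarrow> finite_tuple U \<Longrightarrow> a \<in> std n i \<Longrightarrow> finite_tuple (B i a)"
  using comp_reps_block(1) finite_subset unfolding finite_tuple_def by metis

lemma comp_type_rel:
  assumes "(r, r') \<in> comp_rel F G U"
  shows "comp_type r = comp_type r'"
proof -
  obtain n h B g where r: "r = (n, h, B, g)" by (cases r)
  obtain n' h' B' g' where r': "r' = (n', h', B', g')" by (cases r')
  obtain \<sigma> where \<sigma>: "n' = n" "bij_tuple \<sigma> (std n) (std n)" "h' = transport F (std n) \<sigma> h"
    "\<And>i a. a \<in> std n i \<Longrightarrow> B' i (\<sigma> i a) = B i a \<and> g' i (\<sigma> i a) = g i a"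
    and h: "h \<in> structs F (std n)" "h' \<in> structs F (std n)"
    using assms by (auto simp: comp_rel_def comp_reps_def r r')
  have "deco_orbit F n (h, restr n (\<lambda>i a. col i (B i a) (g i a)))
    = deco_orbit F n (h', restr n (\<lambda>i a. col i (B' i a) (g' i a)))"
    unfolding deco_orbit_restr_eq_iff[OF F h] using \<sigma>(2,3) by (intro exI[of _ \<sigma>]) (simp add: \<sigma>(4))
  then show ?thesis by (simp add: r r' \<sigma>(1))
qed

lemma comp_type_transport:
  assumes r: "r \<in> comp_reps F G U" and U: "finite_tuple U" and \<tau>: "bij_tuple \<tau> U V"
  shows "comp_type (comp_rep_transport G \<tau> r) = comp_type r"
proof -
  obtain n h B g where r': "r = (n, h, B, g)" by (cases r)
  note r = r[unfolded r']
  have "restr n (\<lambda>i a. col i (\<lambda>t. \<tau> t ` B i a t) (transport (G i) (B i a) \<tau> (g i a)))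
    = restr n (\<lambda>i a. col i (B i a) (g i a))"
  proof (rule restr_cong)
    fix i a assume a: "a \<in> std n i"
    have b: "bij_tuple \<tau> (B i a) (\<lambda>t. \<tau> t ` B i a t)"
      using comp_reps_block(1)[OF r a] \<tau> unfolding bij_tuple_def bij_betw_def by (metis inj_on_subset)
    note B = finite_block[OF r U a] and g = comp_reps_block(2)[OF r a]
    have "col i (B i a) (g i a) = col i (\<lambda>t. \<tau> t ` B i a t) (transport (G i) (B i a) \<tau> (g i a))"
      using b col_eq_iff[OF B bij_tuple_finite[OF b B] g transport_in[OF G B b g]] by blast
    then show "col i (\<lambda>t. \<tau> t ` B i a t) (transport (G i) (B i a) \<tau> (g i a)) = col i (B i a) (g i a)" by simp
  qed
  then show ?thesis by (simp add: r' comp_rep_transport_def)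
qed

text \<open>Equal types provide a relabeling \<open>\<sigma>\<close> of the outer labels under which
  colours match, and matching colours provide an isomorphism from each block to its partner. As the
  blocks are disjoint and cover everything, these isomorphisms glue to one bijection.\<close>

lemma comp_type_eqD:
  assumes r: "r \<in> comp_reps F G U" and r': "r' \<in> comp_reps F G V" and U: "finite_tuple U" and V: "finite_tuple V"
    and eq: "comp_type r = comp_type r'"
  shows "\<exists>\<tau>. bij_tuple \<tau> U V \<and> (comp_rep_transport G \<tau> r, r') \<in> comp_rel F G V"
proof -
  obtain n h B g where rr: "r = (n, h, B, g)" by (cases r)
  obtain n' h' B' g' where rr': "r' = (n', h', B', g')" by (cases r')
  have n: "n' = n" using eq by (simp add: rr rr')
  note rU = r[unfolded rr] and rV = r'[unfolded rr' n]
  have h: "h \<in> structs F (std n)" "h' \<in> structs F (std n)"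
    using rU rV by (auto simp: comp_reps_def)
  obtain \<sigma> where \<sigma>: "bij_tuple \<sigma> (std n) (std n)" "h' = transport F (std n) \<sigma> h"
    and c: "\<And>i a. a \<in> std n i \<Longrightarrow> col i (B' i (\<sigma> i a)) (g' i (\<sigma> i a)) = col i (B i a) (g i a)"
    using eq by (auto simp: rr rr' n deco_orbit_restr_eq_iff[OF F h])
  have \<sigma>_in: "\<sigma> i a \<in> std n i" if "a \<in> std n i" for i a
    using \<sigma>(1) that bij_betw_apply unfolding bij_tuple_def by metis
  define t where "t i a = (SOME \<tau>. bij_tuple \<tau> (B i a) (B' i (\<sigma> i a)) \<and>
    g' i (\<sigma> i a) = transport (G i) (B i a) \<tau> (g i a))" for i a
  have t: "bij_tuple (t i a) (B i a) (B' i (\<sigma> i a)) \<and> g' i (\<sigma> i a) = transport (G i) (B i a) (t i a) (g i a)"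
    if a: "a \<in> std n i" for i a
  proof -
    have "\<exists>\<tau>. bij_tuple \<tau> (B i a) (B' i (\<sigma> i a)) \<and> g' i (\<sigma> i a) = transport (G i) (B i a) \<tau> (g i a)"
      using c[OF a] col_eq_iff[OF finite_block[OF rU U a] finite_block[OF rV V \<sigma>_in[OF a]]
        comp_reps_block(2)[OF rU a] comp_reps_block(2)[OF rV \<sigma>_in[OF a]]] by simp
    from someI_ex[OF this] show ?thesis unfolding t_def .
  qed
  \<comment> \<open>The unique block that contains \<open>u\<close>; it decides which of the block
    isomorphisms acts on \<open>u\<close>.\<close>
  define own where "own s u = (SOME x. snd x \<in> std n (fst x) \<and> u \<in> B (fst x) (snd x) s)" for s u
  have own: "own s u = (i, a)" if "a \<in> std n i" "u \<in> B i a s" for s u i a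
  proof -
    have "snd (own s u) \<in> std n (fst (own s u)) \<and> u \<in> B (fst (own s u)) (snd (own s u)) s"
      unfolding own_def by (rule someI[of _ "(i, a)"]) (use that in simp)
    then show ?thesis using comp_reps_disjoint[OF rU that(1)] that(2) by (metis IntI emptyE prod.collapse)
  qed
  define \<tau> where "\<tau> s u = t (fst (own s u)) (snd (own s u)) s u" for s u
  have \<tau>: "\<tau> s u = t i a s u" if "a \<in> std n i" "u \<in> B i a s" for s u i a
    using own[OF that] by (simp add: \<tau>_def)
  have covU: "\<exists>i. \<exists>a\<in>std n i. u \<in> B i a s" if "u \<in> U s" for u s
  proof -
    have "(\<Union>i. \<Union>a \<in> std n i. B i a s) = U s" using rU by (simp add: comp_reps_def)
    then show ?thesis using that by blast
  qed
  have covV: "\<exists>i. \<exists>a\<in>std n i. u \<in> B' i a s" if "u \<in> V s" for u s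
  proof -
    have "(\<Union>i. \<Union>a \<in> std n i. B' i a s) = V s" using rV by (simp add: comp_reps_def)
    then show ?thesis using that by blast
  qed
  have blk: "bij_betw (\<tau> s) (B i a s) (B' i (\<sigma> i a) s)" if a: "a \<in> std n i" for i a s
  proof -
    have "bij_betw (t i a s) (B i a s) (B' i (\<sigma> i a) s)" using t[OF a] by (simp add: bij_tuple_def)
    then show ?thesis using \<tau>[OF a] bij_betw_cong[of "B i a s" "\<tau> s" "t i a s"] by blast
  qed
  have bij: "bij_tuple \<tau> U V"
    unfolding bij_tuple_def bij_betw_def
  proof (intro allI conjI)
    fix s
    show "inj_on (\<tau> s) (U s)"
    proof (rule inj_onI)
      fix u u' assume u: "u \<in> U s" "u' \<in> U s" "\<tau> s u = \<tau> s u'"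
      obtain i a where a: "a \<in> std n i" "u \<in> B i a s" using covU u(1) by blast
      obtain i' a' where a': "a' \<in> std n i'" "u' \<in> B i' a' s" using covU u(2) by blast
      have "\<tau> s u \<in> B' i (\<sigma> i a) s \<inter> B' i' (\<sigma> i' a') s"
        using bij_betw_apply[OF blk[OF a(1)] a(2)] bij_betw_apply[OF blk[OF a'(1)] a'(2)] u(3) by simp
      then have "i = i'" "\<sigma> i a = \<sigma> i' a'"
        using comp_reps_disjoint[OF rV \<sigma>_in[OF a(1)] \<sigma>_in[OF a'(1)]] by (metis emptyE prod.inject)+
      then have "a = a'"
        using \<sigma>(1) a(1) a'(1) unfolding bij_tuple_def bij_betw_def by (metis inj_on_eq_iff)
      then show "u = u'"
        using blk[OF a(1), of s] a(2) a'(2) u(3) \<open>i = i'\<close> unfolding bij_betw_def by (metis inj_on_eq_iff)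
    qed
    show "\<tau> s ` U s = V s"
    proof (intro equalityI subsetI)
      fix v assume "v \<in> \<tau> s ` U s"
      then obtain u where u: "u \<in> U s" "v = \<tau> s u" by blast
      obtain i a where a: "a \<in> std n i" "u \<in> B i a s" using covU u(1) by blast
      show "v \<in> V s"
        using bij_betw_apply[OF blk[OF a(1)] a(2)] comp_reps_block(1)[OF rV \<sigma>_in[OF a(1)]] u(2) by blast
    next
      fix v assume "v \<in> V s"
      then obtain i b where b: "b \<in> std n i" "v \<in> B' i b s" using covV by blast
      then obtain a where a: "a \<in> std n i" "b = \<sigma> i a"
        using \<sigma>(1) unfolding bij_tuple_def bij_betw_def by blast
      then obtain u where "u \<in> B i a s" "v = \<tau> s u"
        using blk[OF a(1), of s] b(2) unfolding bij_betw_def by blast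
      then show "v \<in> \<tau> s ` U s" using comp_reps_block(1)[OF rU a(1)] by blast
    qed
  qed
  have "B' i (\<sigma> i a) = (\<lambda>s. \<tau> s ` B i a s) \<and> g' i (\<sigma> i a) = transport (G i) (B i a) \<tau> (g i a)"
    if a: "a \<in> std n i" for i a
  proof
    show "B' i (\<sigma> i a) = (\<lambda>s. \<tau> s ` B i a s)" using blk[OF a] by (auto simp: bij_betw_def)
    have "transport (G i) (B i a) (t i a) (g i a) = transport (G i) (B i a) \<tau> (g i a)"
      using t[OF a] by (intro transport_cong[OF G finite_block[OF rU U a] _ _ comp_reps_block(2)[OF rU a]]) (auto simp: \<tau>[OF a])
    then show "g' i (\<sigma> i a) = transport (G i) (B i a) \<tau> (g i a)" using t[OF a] by simp
  qed
  moreover have "comp_rep_transport G \<tau> r \<in> comp_reps F G V" by (rule comp_rep_transport_in[OF G U bij r])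
  ultimately have "(comp_rep_transport G \<tau> r, r') \<in> comp_rel F G V"
    using rV \<sigma> unfolding comp_rel_def rr rr' n comp_rep_transport_def by auto
  with bij show ?thesis by blast
qed

abbreviation "y \<equiv> \<lambda>i. type_count (G i)"

text \<open>The sizes of the blocks add up to \<open>p\<close>, which explains the weight.
  Conversely a colouring of weight \<open>p\<close> prescribes sizes and types: cut
  \<open>{1..p}\<close> into blocks of these sizes and choose structures of these types.\<close>

lemma comp_type_range:
  "comp_type ` comp_reps F G (std (\<lambda>_. p)) = (SIGMA n:UNIV. deco_orbit F n ` coloured F y n p)"
proof (intro equalityI subsetI)
  fix z assume "z \<in> comp_type ` comp_reps F G (std (\<lambda>_. p))"
  then obtain n h B g where r: "(n, h, B, g) \<in> comp_reps F G (std (\<lambda>_. p))" and z: "z = comp_type (n, h, B, g)"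
    by auto
  let ?c = "restr n (\<lambda>i a. col i (B i a) (g i a))" and ?K = "SIGMA i:UNIV. std n i"
  have "?c \<in> colourings y n"
    using idx_less[OF finite_block[OF r finite_tuple_std] comp_reps_block(2)[OF r]]
    by (auto simp: colourings_def restr_def palette_def col_def)
  moreover have "weight n ?c = p"
  proof -
    have "weight n ?c = (\<Sum>i\<in>UNIV. \<Sum>a\<in>std n i. card (B i a ()))"
      by (simp add: weight_def restr_def col_def)
    also have "\<dots> = (\<Sum>k\<in>?K. card (B (fst k) (snd k) ()))"
      by (subst sum.Sigma) (auto simp: split_beta std_def)
    also have "\<dots> = card (\<Union>k\<in>?K. B (fst k) (snd k) ())"
    proof (rule card_UN_disjoint[symmetric])
      show "finite ?K" by (auto simp: std_def)
      show "\<forall>k\<in>?K. finite (B (fst k) (snd k) ())"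
        using finite_block[OF r finite_tuple_std] by (auto simp: finite_tuple_def)
      show "\<forall>k\<in>?K. \<forall>k'\<in>?K. k \<noteq> k' \<longrightarrow> B (fst k) (snd k) () \<inter> B (fst k') (snd k') () = {}"
        using comp_reps_disjoint[OF r] by (auto simp: prod_eq_iff)
    qed
    also have "(\<Union>k\<in>?K. B (fst k) (snd k) ()) = (\<Union>i. \<Union>a \<in> std n i. B i a ())" by fastforce
    also have "\<dots> = std (\<lambda>_. p) ()" using r by (simp add: comp_reps_def)
    finally show ?thesis by (simp add: std_def)
  qed
  moreover have "h \<in> structs F (std n)" using r by (simp add: comp_reps_def)
  ultimately show "z \<in> (SIGMA n:UNIV. deco_orbit F n ` coloured F y n p)"
    by (simp add: z coloured_def)
next
  fix z assume "z \<in> (SIGMA n:UNIV. deco_orbit F n ` coloured F y n p)"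
  then obtain n h c where z: "z = (n, deco_orbit F n (h, c))" and h: "h \<in> structs F (std n)"
    and c: "c \<in> colourings y n" and w: "weight n c = p"
    by (auto simp: coloured_def)
  let ?K = "SIGMA i:UNIV. std n i"
  have "(\<Sum>k\<in>?K. fst (c (fst k) (snd k))) = card {1..p}"
    unfolding w[symmetric] weight_def by (subst sum.Sigma) (auto simp: split_beta std_def)
  from ex_blocks[OF _ _ this] obtain K where K: "\<forall>k\<in>?K. card (K k) = fst (c (fst k) (snd k))"
    "disjoint_family_on K ?K" "(\<Union>k\<in>?K. K k) = {1..p}" by (auto simp: std_def)
  define B where "B i a = (\<lambda>_::unit. K (i, a))" for i a
  have B: "card (B i a ()) = fst (c i a)" if "a \<in> std n i" for i a using K(1) that by (auto simp: B_def)
  have fin: "finite_tuple (B i a)" if "a \<in> std n i" for i a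
  proof -
    have "K (i, a) \<subseteq> {1..p}" unfolding K(3)[symmetric] using that by blast
    then show ?thesis by (auto simp: finite_tuple_def B_def intro: finite_subset)
  qed
  have pal: "snd (c i a) < y i (fst (c i a))" if "a \<in> std n i" for i a
  proof -
    have "c i a \<in> palette (y i)" using c that by (auto simp: colourings_def PiE_iff)
    then show ?thesis by (auto simp: palette_def)
  qed
  define g where "g i a = (SOME x. x \<in> structs (G i) (B i a) \<and> idx i (B i a) x = snd (c i a))" for i a
  have g: "g i a \<in> structs (G i) (B i a) \<and> idx i (B i a) (g i a) = snd (c i a)" if a: "a \<in> std n i" for i a
  proof -
    have "\<exists>x. x \<in> structs (G i) (B i a) \<and> idx i (B i a) x = snd (c i a)"
      using idx_surj[OF fin[OF a], of "snd (c i a)" i] pal[OF a] B[OF a] by auto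
    from someI_ex[OF this] show ?thesis unfolding g_def .
  qed
  have "(n, h, B, g) \<in> comp_reps F G (std (\<lambda>_. p))"
  proof -
    have "(\<Union>i. \<Union>a \<in> std n i. B i a t) = std (\<lambda>_. p) t" for t
    proof -
      have "(\<Union>i. \<Union>a \<in> std n i. B i a t) = (\<Union>k\<in>?K. K k)" by (auto simp: B_def)
      then show ?thesis using K(3) by (simp add: std_def)
    qed
    moreover have "disjoint_family_on (\<lambda>(i, a). B i a t) ?K" for t
      using K(2) by (simp add: B_def disjoint_family_on_def)
    ultimately show ?thesis using h g by (simp add: comp_reps_def)
  qed
  moreover have "restr n (\<lambda>i a. col i (B i a) (g i a)) = c"
  proof (intro ext)
    fix i a
    show "restr n (\<lambda>i a. col i (B i a) (g i a)) i a = c i a"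
    proof (cases "a \<in> std n i")
      case True
      then show ?thesis using g B by (simp add: restr_def col_def)
    next
      case False
      then show ?thesis using c by (auto simp: restr_def colourings_def PiE_iff extensional_def)
    qed
  qed
  ultimately show "z \<in> comp_type ` comp_reps F G (std (\<lambda>_. p))"
    unfolding z by (intro image_eqI[of _ _ "(n, h, B, g)"]) simp_all
qed

lemma ogf_compose':
  "ogf (compose F G) (\<lambda>_. p) = of_nat (card (SIGMA n:UNIV. deco_orbit F n ` coloured F y n p))"
  "finite (SIGMA n:UNIV. deco_orbit F n ` coloured F y n p)"
proof -
  let ?U = "std (\<lambda>_::unit. p)" and ?C = "comp_classes F G"
  let ?R = "comp_reps F G ?U" and ?E = "comp_rel F G ?U"
  have C: "is_species ?C" by (rule comp_classes_species[OF F G comp])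
  have st: "structs ?C ?U = ?R // ?E" by (simp add: comp_classes_def)
  have refl: "(r, r) \<in> ?E" if "r \<in> ?R" for r
    using comp_rel_equiv[OF F] that by (meson equivE refl_onD)
  \<comment> \<open>\<open>comp_type\<close> is constant on a class, so its image of the class is a
    singleton: an invariant defined on classes.\<close>
  have im: "comp_type ` (?E `` {r}) = {comp_type r}" if "r \<in> ?R" for r
    using comp_type_rel refl[OF that] by (fastforce simp: image_iff)
  have img: "(\<lambda>c. comp_type ` c) ` structs ?C ?U = (\<lambda>x. {x}) ` comp_type ` ?R"
  proof -
    have "structs ?C ?U = (\<lambda>r. ?E `` {r}) ` ?R" unfolding st quotient_def by blast
    then show ?thesis unfolding image_image by (simp add: image_image im cong: image_cong)
  qed
  have "ogf ?C (\<lambda>_. p) = of_nat (card ((\<lambda>c. comp_type ` c) ` structs ?C ?U))"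
  proof (rule ogf_kernel[OF C])
    fix c c' assume "c \<in> structs ?C ?U" "c' \<in> structs ?C ?U"
    then obtain r r' where r: "r \<in> ?R" "c = ?E `` {r}" and r': "r' \<in> ?R" "c' = ?E `` {r'}"
      unfolding st by (auto elim!: quotientE)
    have tr: "transport ?C ?U \<tau> c = ?E `` {comp_rep_transport G \<tau> r}" if "bij_tuple \<tau> ?U ?U" for \<tau>
      unfolding r(2) by (rule transport_comp_classes[OF F G finite_tuple_std that r(1)])
    have "comp_type ` c = comp_type ` c' \<longleftrightarrow> comp_type r = comp_type r'"
      using im r r' by auto
    also have "\<dots> \<longleftrightarrow> (\<exists>\<tau>. bij_tuple \<tau> ?U ?U \<and> (comp_rep_transport G \<tau> r, r') \<in> ?E)"
    proof
      assume "comp_type r = comp_type r'"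
      then show "\<exists>\<tau>. bij_tuple \<tau> ?U ?U \<and> (comp_rep_transport G \<tau> r, r') \<in> ?E"
        by (rule comp_type_eqD[OF r(1) r'(1) finite_tuple_std finite_tuple_std])
    next
      assume "\<exists>\<tau>. bij_tuple \<tau> ?U ?U \<and> (comp_rep_transport G \<tau> r, r') \<in> ?E"
      then show "comp_type r = comp_type r'"
        using comp_type_rel comp_type_transport[OF r(1) finite_tuple_std] by metis
    qed
    also have "\<dots> \<longleftrightarrow> (\<exists>\<tau>. bij_tuple \<tau> ?U ?U \<and> c' = transport ?C ?U \<tau> c)"
    proof -
      have "(comp_rep_transport G \<tau> r, r') \<in> ?E \<longleftrightarrow> c' = transport ?C ?U \<tau> c" if "bij_tuple \<tau> ?U ?U" for \<tau>
        unfolding tr[OF that] r'(2)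
        using eq_equiv_class_iff[OF comp_rel_equiv[OF F] comp_rep_transport_in[OF G finite_tuple_std that r(1)] r'(1)]
        by blast
      then show ?thesis by blast
    qed
    finally show "comp_type ` c = comp_type ` c' \<longleftrightarrow> (\<exists>\<sigma>. bij_tuple \<sigma> ?U ?U \<and> c' = transport ?C ?U \<sigma> c)" .
  qed
  also have "\<dots> = of_nat (card (comp_type ` ?R))"
    unfolding img by (subst card_image) auto
  finally show "ogf (compose F G) (\<lambda>_. p) = of_nat (card (SIGMA n:UNIV. deco_orbit F n ` coloured F y n p))"
    using ogf_iso[OF C recode_species[OF C] recode_iso[OF C], of "\<lambda>_. p"]
    by (simp add: compose_def comp_type_range)
  have "finite ((\<lambda>x. {x}) ` comp_type ` ?R)"
    unfolding img[symmetric] using species_finite[OF C, of ?U] by simp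
  then have "finite (comp_type ` ?R)" by (rule finite_imageD) simp
  then show "finite (SIGMA n:UNIV. deco_orbit F n ` coloured F y n p)" by (simp add: comp_type_range)
qed

end

theorem ogf_compose:
  fixes F :: "('s::finite, 'x) species" and G :: "'s \<Rightarrow> (unit, 'y) species"
  assumes F: "is_species F" and G: "\<And>i. is_species (G i)" and comp: "composable F G"
  defines "y \<equiv> \<lambda>i. type_count (G i)"
  shows "ogf (compose F G) (\<lambda>_. p) = of_nat (card (SIGMA n:UNIV. deco_orbit F n ` coloured F y n p))"
    and "finite (SIGMA n:UNIV. deco_orbit F n ` coloured F y n p)"
proof -
  have "\<forall>i. \<exists>idx. (\<forall>B g. finite_tuple B \<longrightarrow> g \<in> structs (G i) B \<longrightarrow> idx B g < type_count (G i) (card (B ()))) \<and>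
    (\<forall>B g B' g'. finite_tuple B \<longrightarrow> finite_tuple B' \<longrightarrow> g \<in> structs (G i) B \<longrightarrow> g' \<in> structs (G i) B' \<longrightarrow>
       card (B ()) = card (B' ()) \<longrightarrow>
       (idx B g = idx B' g' \<longleftrightarrow> (\<exists>\<tau>. bij_tuple \<tau> B B' \<and> g' = transport (G i) B \<tau> g))) \<and>
    (\<forall>B l. finite_tuple B \<longrightarrow> l < type_count (G i) (card (B ())) \<longrightarrow> (\<exists>g\<in>structs (G i) B. idx B g = l))"
    using ex_type_index[OF G] by blast
  from choice[OF this] obtain idx where "type_colours F G idx"
    unfolding type_colours_def using F G comp by blast
  then interpret type_colours F G idx .
  show "ogf (compose F G) (\<lambda>_. p) = of_nat (card (SIGMA n:UNIV. deco_orbit F n ` coloured F y n p))"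
    "finite (SIGMA n:UNIV. deco_orbit F n ` coloured F y n p)"
    unfolding y_def by (rule ogf_compose')+
qed

section \<open>Exponential generating series of a composition\<close>

text \<open>The sum runs over nonzero terms only, to match the definition of
  \<open>fps_Sum\<close>.\<close>

lemma card_Sigma_UNIV:
  assumes "finite (Sigma UNIV A)"
  shows "card (Sigma UNIV A) = (\<Sum>n | card (A n) \<noteq> 0. card (A n))"
proof -
  have A: "finite (A n)" for n
  proof -
    have "A n \<subseteq> snd ` Sigma UNIV A" by force
    then show ?thesis using assms by (meson finite_imageI finite_subset)
  qed
  then have N: "{n. card (A n) \<noteq> 0} = fst ` Sigma UNIV A" by (force simp: image_iff)
  have "finite {n. card (A n) \<noteq> 0}" unfolding N using assms by (rule finite_imageI)
  moreover have "Sigma UNIV A = Sigma {n. card (A n) \<noteq> 0} A" using A by auto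
  ultimately show ?thesis using A card_SigmaI[of "{n. card (A n) \<noteq> 0}" A] by (simp only:) auto
qed

text \<open>The structures on \<open>U\<close> of the product, over \<open>K\<close>, of the
  labelled classes \<open>Q k\<close>; blocks may be empty. Extensionality makes each of them a
  single function.\<close>

definition assemblies :: "('k \<Rightarrow> nat set \<Rightarrow> 'y set) \<Rightarrow> 'k set \<Rightarrow> nat set \<Rightarrow> ('k \<Rightarrow> nat set \<times> 'y) set" where
  "assemblies Q K U = {e \<in> extensional K. (\<forall>k\<in>K. snd (e k) \<in> Q k (fst (e k))) \<and>
     (\<forall>k\<in>K. \<forall>l\<in>K. k \<noteq> l \<longrightarrow> fst (e k) \<inter> fst (e l) = {}) \<and> (\<Union>k\<in>K. fst (e k)) = U}"

lemma assembliesI: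
  assumes "e \<in> extensional K" "\<And>k. k \<in> K \<Longrightarrow> snd (e k) \<in> Q k (fst (e k))"
    "\<And>k l. k \<in> K \<Longrightarrow> l \<in> K \<Longrightarrow> k \<noteq> l \<Longrightarrow> fst (e k) \<inter> fst (e l) = {}" "(\<Union>k\<in>K. fst (e k)) = U"
  shows "e \<in> assemblies Q K U"
  using assms by (simp add: assemblies_def)

lemma assembliesD:
  assumes "e \<in> assemblies Q K U"
  shows "e \<in> extensional K" "\<And>k. k \<in> K \<Longrightarrow> snd (e k) \<in> Q k (fst (e k))"
    "\<And>k l. k \<in> K \<Longrightarrow> l \<in> K \<Longrightarrow> k \<noteq> l \<Longrightarrow> fst (e k) \<inter> fst (e l) = {}" "(\<Union>k\<in>K. fst (e k)) = U"
  using assms by (simp_all add: assemblies_def)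

lemma assemblies_insert:
  assumes "k \<notin> K"
  shows "bij_betw (\<lambda>(x, e). e(k := x)) (SIGMA x:(SIGMA V:Pow U. Q k V). assemblies Q K (U - fst x))
    (assemblies Q (insert k K) U)"
proof (rule bij_betwI[where g = "\<lambda>e. (e k, e(k := undefined))"])
  show "(\<lambda>(x, e). e(k := x)) \<in> (SIGMA x:(SIGMA V:Pow U. Q k V). assemblies Q K (U - fst x))
    \<rightarrow> assemblies Q (insert k K) U"
  proof (rule funcsetI)
    fix z assume "z \<in> (SIGMA x:(SIGMA V:Pow U. Q k V). assemblies Q K (U - fst x))"
    then obtain V q e where z: "z = ((V, q), e)" "V \<subseteq> U" "q \<in> Q k V" and e: "e \<in> assemblies Q K (U - V)"
      by auto
    let ?e = "e(k := (V, q))"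
    have eq: "?e j = e j" if "j \<in> K" for j using that assms by auto
    note un = assembliesD(4)[OF e]
    then have V: "fst (e j) \<inter> V = {}" if "j \<in> K" for j using that by blast
    have "(\<Union>j\<in>K. fst (?e j)) = (\<Union>j\<in>K. fst (e j))" using eq by (intro SUP_cong) auto
    then have "(\<Union>j\<in>insert k K. fst (?e j)) = V \<union> (U - V)" unfolding un UN_insert by simp
    then have 1: "(\<Union>j\<in>insert k K. fst (?e j)) = U" using z by blast
    have 2: "fst (?e i) \<inter> fst (?e j) = {}" if "i \<in> insert k K" "j \<in> insert k K" "i \<noteq> j" for i j
      using that V[of i] V[of j] assembliesD(3)[OF e, of i j] by (simp add: Int_commute) blast
    have 3: "?e \<in> extensional (insert k K)"
      using assembliesD(1)[OF e] by (simp add: extensional_def)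
    have 4: "snd (?e j) \<in> Q j (fst (?e j))" if "j \<in> insert k K" for j
      using that z assembliesD(2)[OF e, of j] by auto
    show "(\<lambda>(x, e). e(k := x)) z \<in> assemblies Q (insert k K) U"
      unfolding z(1) prod.case by (rule assembliesI) (rule 3, erule 4, erule (2) 2, rule 1)
  qed
  show "(\<lambda>e. (e k, e(k := undefined))) \<in> assemblies Q (insert k K) U
    \<rightarrow> (SIGMA x:(SIGMA V:Pow U. Q k V). assemblies Q K (U - fst x))"
  proof (rule funcsetI)
    fix e assume e: "e \<in> assemblies Q (insert k K) U"
    have un: "fst (e k) \<union> (\<Union>j\<in>K. fst (e j)) = U" using assembliesD(4)[OF e] by simp
    have dj: "fst (e k) \<inter> fst (e j) = {}" if "j \<in> K" for j
      using assms that by (intro assembliesD(3)[OF e]) auto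
    let ?e = "e(k := undefined)"
    have eq: "?e j = e j" if "j \<in> K" for j using that assms by auto
    have "(\<Union>j\<in>K. fst (?e j)) = (\<Union>j\<in>K. fst (e j))" using eq by (intro SUP_cong) auto
    also have "\<dots> = U - fst (e k)" using un dj by blast
    finally have 1: "(\<Union>j\<in>K. fst (?e j)) = U - fst (e k)" .
    have "?e \<in> assemblies Q K (U - fst (e k))"
    proof (rule assembliesI[OF _ _ _ 1])
      show "?e \<in> extensional K" using assembliesD(1)[OF e] by (simp add: extensional_def)
      show "snd (?e j) \<in> Q j (fst (?e j))" if "j \<in> K" for j
        unfolding eq[OF that] using that by (intro assembliesD(2)[OF e]) simp
      show "fst (?e i) \<inter> fst (?e j) = {}" if "i \<in> K" "j \<in> K" "i \<noteq> j" for i j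
        unfolding eq[OF that(1)] eq[OF that(2)] using that by (intro assembliesD(3)[OF e]) simp_all
    qed
    moreover have "(fst (e k), snd (e k)) \<in> (SIGMA V:Pow U. Q k V)"
      using un assembliesD(2)[OF e, of k] by blast
    ultimately show "(e k, ?e) \<in> (SIGMA x:(SIGMA V:Pow U. Q k V). assemblies Q K (U - fst x))" by simp
  qed
  show "(\<lambda>e. (e k, e(k := undefined))) ((\<lambda>(x, e). e(k := x)) z) = z"
    if "z \<in> (SIGMA x:(SIGMA V:Pow U. Q k V). assemblies Q K (U - fst x))" for z
    using that assms by (auto dest!: assembliesD(1) simp: extensional_def fun_eq_iff)
  show "(\<lambda>(x, e). e(k := x)) (e k, e(k := undefined)) = e" for e :: "'a \<Rightarrow> nat set \<times> 'b" by simp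
qed

text \<open>Splitting off the block of one index gives a binomial convolution, which division by
  factorials turns into a product of series.\<close>

lemma card_assemblies:
  fixes q :: "'k \<Rightarrow> nat \<Rightarrow> nat"
  assumes "finite K" "finite U"
    and "\<And>k V. k \<in> K \<Longrightarrow> finite V \<Longrightarrow> finite (Q k V) \<and> card (Q k V) = q k (card V)"
  shows "finite (assemblies Q K U)"
    and "(of_nat (card (assemblies Q K U)) :: rat) =
      fact (card U) * fps_nth (\<Prod>k\<in>K. Abs_fps (\<lambda>j. of_nat (q k j) / fact j)) (card U)"
proof -
  have "finite (assemblies Q K U) \<and> (of_nat (card (assemblies Q K U)) :: rat) =
      fact (card U) * fps_nth (\<Prod>k\<in>K. Abs_fps (\<lambda>j. of_nat (q k j) / fact j)) (card U)"
    using assms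
  proof (induction K arbitrary: U rule: finite_induct)
    case empty
    have "assemblies Q {} U = (if U = {} then {\<lambda>_. undefined} else {})"
      by (auto simp: assemblies_def)
    then show ?case using empty by auto
  next
    case (insert k K)
    let ?A = "\<lambda>V. assemblies Q K (U - V)" and ?p = "card U"
    let ?R = "\<Prod>k\<in>K. Abs_fps (\<lambda>j. of_nat (q k j) / fact j) :: rat fps"
    have finU: "finite U" by (rule insert.prems)
    have Q: "finite (Q k V) \<and> card (Q k V) = q k (card V)" if "V \<subseteq> U" for V
      using insert.prems(2)[of k V] finite_subset[OF that finU] by simp
    have IH: "finite (?A V) \<and> (of_nat (card (?A V)) :: rat) = fact (?p - card V) * fps_nth ?R (?p - card V)"
      if "V \<subseteq> U" for V
      using insert.IH[of "U - V"] insert.prems that by (simp add: card_Diff_subset finite_subset)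
    note bij = assemblies_insert[OF insert(2), of U Q]
    have fin1: "finite (SIGMA V:Pow U. Q k V)" using finU Q by (intro finite_SigmaI) auto
    have fin2: "finite (SIGMA x:(SIGMA V:Pow U. Q k V). ?A (fst x))"
      by (rule finite_SigmaI[OF fin1]) (use IH in auto)
    have "of_nat (card (assemblies Q (insert k K) U)) =
      (\<Sum>x\<in>(SIGMA V:Pow U. Q k V). of_nat (card (?A (fst x))) :: rat)"
      unfolding bij_betw_same_card[OF bij, symmetric] using IH finU Q by (subst card_SigmaI[OF fin1]) auto
    also have "\<dots> = (\<Sum>V\<in>Pow U. \<Sum>x\<in>Q k V. of_nat (card (?A V)))"
      using finU Q by (subst sum.Sigma) (auto simp: split_beta)
    also have "\<dots> = (\<Sum>V\<in>Pow U. of_nat (q k (card V)) * (fact (?p - card V) * fps_nth ?R (?p - card V)))"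
      using Q IH by (intro sum.cong) auto
    also have "\<dots> = (\<Sum>j\<in>{0..?p}. \<Sum>V\<in>{V \<in> Pow U. card V = j}.
        of_nat (q k (card V)) * (fact (?p - card V) * fps_nth ?R (?p - card V)))"
      using finU by (intro sum.group[symmetric]) (auto simp: card_mono)
    also have "\<dots> = (\<Sum>j\<in>{0..?p}. of_nat (?p choose j) * (of_nat (q k j) * (fact (?p - j) * fps_nth ?R (?p - j))))"
    proof (intro sum.cong refl)
      fix j
      have "card {V \<in> Pow U. card V = j} = ?p choose j" using n_subsets[OF finU, of j] by simp
      then show "(\<Sum>V\<in>{V \<in> Pow U. card V = j}.
          of_nat (q k (card V)) * (fact (?p - card V) * fps_nth ?R (?p - card V)))
        = of_nat (?p choose j) * (of_nat (q k j) * (fact (?p - j) * fps_nth ?R (?p - j)))"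
        by simp
    qed
    also have "\<dots> = (\<Sum>j\<in>{0..?p}. fact ?p * (of_nat (q k j) / fact j * fps_nth ?R (?p - j)))"
      by (intro sum.cong refl) (simp add: binomial_fact)
    also have "\<dots> = fact ?p * fps_nth (\<Prod>k\<in>insert k K. Abs_fps (\<lambda>j. of_nat (q k j) / fact j)) ?p"
      using insert(1,2) by (simp add: fps_mult_nth sum_distrib_left)
    finally show ?case using bij_betw_finite[OF bij] fin2 by simp
  qed
  then show "finite (assemblies Q K U)" "(of_nat (card (assemblies Q K U)) :: rat) =
      fact (card U) * fps_nth (\<Prod>k\<in>K. Abs_fps (\<lambda>j. of_nat (q k j) / fact j)) (card U)" by blast+
qed

section \<open>Blocks as labelled decorations\<close>

definition blocks :: "('s \<Rightarrow> ('t, 'y) species) \<Rightarrow> ('s \<Rightarrow> nat) \<Rightarrow> ('t \<Rightarrow> nat set) \<Rightarrow>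
    ('s \<Rightarrow> nat \<Rightarrow> 't \<Rightarrow> nat set) \<Rightarrow> ('s \<Rightarrow> nat \<Rightarrow> 'y) \<Rightarrow> bool" where
  "blocks G n U B g \<longleftrightarrow> (\<forall>i. \<forall>a \<in> std n i. g i a \<in> structs (G i) (B i a)) \<and>
        (\<forall>t. (\<Union>i. \<Union>a \<in> std n i. B i a t) = U t \<and>
             disjoint_family_on (\<lambda>(i, a). B i a t) (SIGMA i:UNIV. std n i))"

lemma comp_reps_iff: "(n, h, B, g) \<in> comp_reps F G U \<longleftrightarrow> h \<in> structs F (std n) \<and> blocks G n U B g"
  by (simp add: comp_reps_def blocks_def)

text \<open>Collects the decorations without reference to \<open>F\<close>, so that the decorated
  structures of multidegree \<open>n\<close> form a full product of \<open>structs F (std n)\<close>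
  with this set.\<close>

definition labelled :: "('s \<Rightarrow> ('t, 'y) species) \<Rightarrow> ('s \<Rightarrow> nat) \<Rightarrow> ('t \<Rightarrow> nat set) \<Rightarrow> ('s \<Rightarrow> nat \<Rightarrow> ('t \<Rightarrow> nat set) \<times> 'y) set" where
  "labelled G n U = {deco n B g |B g. blocks G n U B g}"

lemma comp_key_range:
  "comp_key F ` comp_reps F G U = (SIGMA n:UNIV. deco_orbit F n ` (structs F (std n) \<times> labelled G n U))"
proof (intro equalityI subsetI)
  fix z assume "z \<in> comp_key F ` comp_reps F G U"
  then obtain n h B g where r: "(n, h, B, g) \<in> comp_reps F G U" "z = comp_key F (n, h, B, g)" by auto
  then have "h \<in> structs F (std n)" "deco n B g \<in> labelled G n U"
    unfolding labelled_def comp_reps_iff by blast+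
  then show "z \<in> (SIGMA n:UNIV. deco_orbit F n ` (structs F (std n) \<times> labelled G n U))"
    unfolding r(2) comp_key.simps by blast
next
  fix z assume "z \<in> (SIGMA n:UNIV. deco_orbit F n ` (structs F (std n) \<times> labelled G n U))"
  then obtain n h d where z: "z = (n, deco_orbit F n (h, d))" "h \<in> structs F (std n)" "d \<in> labelled G n U" by auto
  then obtain B g where "d = deco n B g" "(n, h, B, g) \<in> comp_reps F G U"
    unfolding labelled_def comp_reps_iff by blast
  then have "z = comp_key F (n, h, B, g)" "(n, h, B, g) \<in> comp_reps F G U" using z by simp_all
  then show "z \<in> comp_key F ` comp_reps F G U" by (rule image_eqI)
qed

text \<open>Indexing the blocks by pairs of a sort and a label makes these decorations assemblies.
  The \<open>n i\<close> labels of sort \<open>i\<close> give equal factors, hence the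
  powers.\<close>

lemma card_labelled:
  fixes G :: "'s::finite \<Rightarrow> (unit, 'y) species"
  assumes G: "\<And>i. is_species (G i)"
  shows "finite (labelled G n (std (\<lambda>_. p)))"
    and "of_nat (card (labelled G n (std (\<lambda>_. p)))) =
      fact p * fps_nth (\<Prod>i\<in>UNIV. univariate (egf (G i)) ^ n i) p"
proof -
  let ?K = "SIGMA i:UNIV. std n i" and ?U = "std (\<lambda>_::unit. p)"
  let ?Q = "\<lambda>k V. structs (G (fst k)) (\<lambda>_. V)" and ?q = "\<lambda>k j. card (structs (G (fst k)) (std (\<lambda>_. j)))"
  let ?f = "\<lambda>e. restr n (\<lambda>i a. ((\<lambda>_::unit. fst (e (i, a))), snd (e (i, a))))"
  have Q: "finite (?Q k V) \<and> card (?Q k V) = ?q k (card V)" if "finite V" for k :: "'s \<times> nat" and V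
    using that species_finite[OF G, of "\<lambda>_. V"] card_structs_cong[OF G, of "\<lambda>_. V" "std (\<lambda>_. card V)"]
    by (auto simp: finite_tuple_def std_def)
  have K: "finite ?K" by (auto simp: std_def)
  have fin: "finite (assemblies ?Q ?K {1..p})"
    and card: "of_nat (card (assemblies ?Q ?K {1..p})) =
      (fact (card {1..p}) * fps_nth (\<Prod>k\<in>?K. Abs_fps (\<lambda>j. of_nat (?q k j) / fact j)) (card {1..p}) :: rat)"
    using card_assemblies[where Q = ?Q and q = ?q and K = ?K and U = "{1..p}"] K Q by blast+
  have bij: "bij_betw ?f (assemblies ?Q ?K {1..p}) (labelled G n ?U)"
    unfolding bij_betw_def
  proof
    show "inj_on ?f (assemblies ?Q ?K {1..p})"
    proof (rule inj_onI)
      fix e e' assume e: "e \<in> assemblies ?Q ?K {1..p}" "e' \<in> assemblies ?Q ?K {1..p}" "?f e = ?f e'"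
      have "e k = e' k" if kK: "k \<in> ?K" for k
      proof -
        obtain i a where k: "k = (i, a)" "a \<in> std n i" using kK by auto
        have "?f e i a = ?f e' i a" using e(3) by simp
        then show ?thesis unfolding k(1) using k(2) by (simp add: restr_def prod_eq_iff fun_eq_iff)
      qed
      then show "e = e'" using e(1,2) by (intro extensionalityI[of _ ?K]) (auto simp: assemblies_def)
    qed
    show "?f ` assemblies ?Q ?K {1..p} = labelled G n ?U"
    proof (intro equalityI subsetI)
      fix d assume "d \<in> ?f ` assemblies ?Q ?K {1..p}"
      then obtain e where e: "e \<in> assemblies ?Q ?K {1..p}" and d: "d = ?f e" by blast
      have un: "(\<Union>k\<in>?K. fst (e k)) = {1..p}" and Qe: "\<And>k. k \<in> ?K \<Longrightarrow> snd (e k) \<in> ?Q k (fst (e k))"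
        and dj: "\<And>k l. k \<in> ?K \<Longrightarrow> l \<in> ?K \<Longrightarrow> k \<noteq> l \<Longrightarrow> fst (e k) \<inter> fst (e l) = {}"
        using assembliesD(2-4)[OF e] by auto
      have "(\<Union>i. \<Union>a \<in> std n i. fst (e (i, a))) = (\<Union>k\<in>?K. fst (e k))" by fastforce
      then have 1: "(\<Union>i. \<Union>a \<in> std n i. fst (e (i, a))) = ?U t" for t unfolding un by (simp add: std_def)
      have 2: "disjoint_family_on (\<lambda>(i, a). fst (e (i, a))) ?K"
        unfolding disjoint_family_on_def using dj by auto
      have 3: "\<forall>i. \<forall>a \<in> std n i. snd (e (i, a)) \<in> structs (G i) (\<lambda>_. fst (e (i, a)))" using Qe by force
      show "d \<in> labelled G n ?U"
        unfolding d labelled_def mem_Collect_eq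
        by (rule exI[of _ "\<lambda>i a _. fst (e (i, a))"], rule exI[of _ "\<lambda>i a. snd (e (i, a))"])
          (use 1 2 3 in \<open>simp add: blocks_def\<close>)
    next
      fix d assume "d \<in> labelled G n ?U"
      then obtain B g where d: "d = deco n B g" and g: "\<And>i a. a \<in> std n i \<Longrightarrow> g i a \<in> structs (G i) (B i a)"
        and un: "\<And>t. (\<Union>i. \<Union>a \<in> std n i. B i a t) = ?U t"
        and dj: "\<And>t. disjoint_family_on (\<lambda>(i, a). B i a t) ?K"
        unfolding labelled_def blocks_def by auto
      let ?e = "\<lambda>k\<in>?K. (B (fst k) (snd k) (), g (fst k) (snd k))"
      have "(\<Union>k\<in>?K. fst (?e k)) = (\<Union>i. \<Union>a \<in> std n i. B i a ())" by fastforce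
      then have 1: "(\<Union>k\<in>?K. fst (?e k)) = {1..p}" using un by (simp add: std_def)
      have 2: "fst (?e k) \<inter> fst (?e l) = {}" if "k \<in> ?K" "l \<in> ?K" "k \<noteq> l" for k l
        using disjoint_family_onD[OF dj[of "()"] that] that(1,2) by (simp add: split_beta)
      have B: "(\<lambda>_. B i a ()) = B i a" for i a by (simp add: fun_eq_iff)
      have 3: "snd (?e k) \<in> ?Q k (fst (?e k))" if "k \<in> ?K" for k using g that by (auto simp: B)
      have "?e \<in> assemblies ?Q ?K {1..p}"
        by (rule assembliesI) (rule restrict_extensional, erule 3, erule (2) 2, rule 1)
      moreover have "d = ?f ?e" unfolding d by (rule restr_cong) (simp add: B)
      ultimately show "d \<in> ?f ` assemblies ?Q ?K {1..p}"
        by (intro image_eqI[where f = ?f and x = ?e])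
    qed
  qed
  show "finite (labelled G n ?U)" using bij_betw_finite[OF bij] fin by simp
  have "(\<Prod>k\<in>?K. Abs_fps (\<lambda>j. of_nat (?q k j) / fact j)) = (\<Prod>k\<in>?K. univariate (egf (G (fst k))))"
    by (intro prod.cong refl) (simp add: univariate_def egf_def UNIV_unit)
  also have "\<dots> = (\<Prod>i\<in>UNIV. \<Prod>a\<in>std n i. univariate (egf (G i)))"
    by (subst prod.Sigma) (auto simp: split_beta std_def)
  also have "\<dots> = (\<Prod>i\<in>UNIV. univariate (egf (G i)) ^ n i)" by (simp add: std_def)
  finally show "of_nat (card (labelled G n ?U)) = fact p * fps_nth (\<Prod>i\<in>UNIV. univariate (egf (G i)) ^ n i) p"
    using card unfolding bij_betw_same_card[OF bij] by simp
qed

lemma labelled_relabel: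
  assumes \<sigma>: "\<sigma> \<in> relabelings n" and d: "d \<in> labelled G n U"
  shows "(\<lambda>i. d i \<circ> inv (\<sigma> i)) \<in> labelled G n U"
proof -
  obtain B g where d: "d = deco n B g" and g: "\<And>i a. a \<in> std n i \<Longrightarrow> g i a \<in> structs (G i) (B i a)"
    and un: "\<And>t. (\<Union>i. \<Union>a \<in> std n i. B i a t) = U t"
    and dj: "\<And>t. disjoint_family_on (\<lambda>(i, a). B i a t) (SIGMA i:UNIV. std n i)"
    using d unfolding labelled_def blocks_def by auto
  have p: "inv (\<sigma> i) permutes std n i" for i using \<sigma> by (simp add: relabelings_def std_def permutes_inv)
  note im = permutes_in_image[OF p] and im' = permutes_image[OF p] and inj = permutes_inj[OF p]
  let ?B = "\<lambda>i a. B i (inv (\<sigma> i) a)" and ?g = "\<lambda>i a. g i (inv (\<sigma> i) a)"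
  have "(\<lambda>i. d i \<circ> inv (\<sigma> i)) = deco n ?B ?g"
    unfolding d by (auto simp: restr_def fun_eq_iff restrict_def im)
  moreover have "(\<Union>i. \<Union>a \<in> std n i. ?B i a t) = U t" for t
  proof -
    have "(\<Union>a \<in> std n i. ?B i a t) = (\<Union>a \<in> inv (\<sigma> i) ` std n i. B i a t)" for i by simp
    then show ?thesis unfolding im' un[symmetric] by simp
  qed
  moreover have "disjoint_family_on (\<lambda>(i, a). ?B i a t) (SIGMA i:UNIV. std n i)" for t
    unfolding disjoint_family_on_def
  proof (intro ballI impI)
    fix x y assume *: "x \<in> (SIGMA i:UNIV. std n i)" "y \<in> (SIGMA i:UNIV. std n i)" "x \<noteq> y"
    obtain i a j b where xy: "x = (i, a)" "y = (j, b)" by (cases x, cases y)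
    have "(i, inv (\<sigma> i) a) \<noteq> (j, inv (\<sigma> j) b)" using * xy inj by (auto simp: inj_eq)
    from disjoint_family_onD[OF dj[of t] _ _ this] show
      "(case x of (i, a) \<Rightarrow> ?B i a t) \<inter> (case y of (i, a) \<Rightarrow> ?B i a t) = {}"
      using * xy im by auto
  qed
  moreover have "\<forall>i. \<forall>a\<in>std n i. ?g i a \<in> structs (G i) (?B i a)" using g im by auto
  ultimately have "blocks G n U ?B ?g" unfolding blocks_def by blast
  with \<open>(\<lambda>i. d i \<circ> inv (\<sigma> i)) = deco n ?B ?g\<close> show ?thesis
    unfolding labelled_def mem_Collect_eq by (intro exI conjI)
qed

text \<open>A nonempty block is disjoint from the others, so a relabeling that preserves the
  decoration cannot move its label. What remains are permutations of sorts that admit empty blocks,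
  and these are excluded by the asymmetry of \<open>F\<close>.\<close>

lemma labelled_relabel_free:
  assumes asym: "asymmetric_in F {i. empty_structs (G i) \<noteq> {}}"
    and \<sigma>: "\<sigma> \<in> relabelings n" and h: "h \<in> structs F (std n)" and d: "d \<in> labelled G n U"
    and fixd: "relabel F n \<sigma> (h, d) = (h, d)"
  shows "\<sigma> = (\<lambda>i. id)"
proof -
  obtain B g where d: "d = deco n B g" and g: "\<And>i a. a \<in> std n i \<Longrightarrow> g i a \<in> structs (G i) (B i a)"
    and dj: "\<And>t. disjoint_family_on (\<lambda>(i, a). B i a t) (SIGMA i:UNIV. std n i)"
    using d unfolding labelled_def blocks_def by auto
  have "h = transport F (std n) \<sigma> h" and B: "\<And>i a. a \<in> std n i \<Longrightarrow> B i (\<sigma> i a) = B i a"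
    using fixd[symmetric] unfolding d relabel_restr_iff[OF \<sigma>] by auto
  have p: "\<sigma> i permutes std n i" for i using \<sigma> by (simp add: relabelings_def std_def)
  have "\<sigma> i = id" if i: "i \<notin> {i. empty_structs (G i) \<noteq> {}}" for i
  proof
    fix a
    show "\<sigma> i a = id a"
    proof (cases "a \<in> std n i")
      case True
      have "B i a \<noteq> (\<lambda>t. {})" using g[OF True] i by auto
      then obtain t where t: "B i a t \<noteq> {}" by (auto simp: fun_eq_iff)
      show ?thesis
      proof (rule ccontr)
        assume "\<sigma> i a \<noteq> id a"
        then have "B i (\<sigma> i a) t \<inter> B i a t = {}"
          using disjoint_family_onD[OF dj[of t], of "(i, \<sigma> i a)" "(i, a)"] True permutes_in_image[OF p] by auto
        then show False using B[OF True] t by simp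
      qed
    next
      case False
      then show ?thesis using p[of i] by (simp add: permutes_def)
    qed
  qed
  then have "(\<forall>i. \<sigma> i permutes {1..n i}) \<and> (\<forall>i. i \<notin> {i. empty_structs (G i) \<noteq> {}} \<longrightarrow> \<sigma> i = id) \<and>
      transport F (std n) \<sigma> h = h"
    using \<sigma> \<open>h = transport F (std n) \<sigma> h\<close> unfolding relabelings_def by simp
  then have "\<forall>i. \<sigma> i = id" using asym h unfolding asymmetric_in_def by blast
  then show ?thesis by auto
qed

theorem egf_compose:
  fixes F :: "('s::finite, 'x) species" and G :: "'s \<Rightarrow> (unit, 'y) species"
  assumes F: "is_species F" and G: "\<And>i. is_species (G i)" and comp: "composable F G"
    and asym: "asymmetric_in F {i. empty_structs (G i) \<noteq> {}}"
  shows "univariate (egf (compose F G)) = series_eval (egf F) (\<lambda>i. univariate (egf (G i)))"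
proof (rule fps_ext)
  fix p
  let ?U = "std (\<lambda>_::unit. p)"
  let ?X = "\<lambda>n. structs F (std n) \<times> labelled G n ?U"
  let ?A = "\<lambda>n. deco_orbit F n ` ?X n" and ?t = "series_term (egf F) (\<lambda>i. univariate (egf (G i)))"
  have C: "is_species (comp_classes F G)" by (rule comp_classes_species[OF F G comp])
  have fin: "finite (Sigma UNIV ?A)"
    using finite_comp_keys[OF F G comp, of ?U] by (simp add: comp_key_range)
  have "egf (compose F G) (\<lambda>_. p) = egf (comp_classes F G) (\<lambda>_. p)"
    unfolding compose_def by (rule egf_iso[OF recode_iso[OF C], symmetric])
  also have "\<dots> = of_nat (card (comp_reps F G ?U // comp_rel F G ?U)) / fact p"
    by (simp add: egf_def comp_classes_def UNIV_unit)
  also have "card (comp_reps F G ?U // comp_rel F G ?U) = card (Sigma UNIV ?A)"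
    using card_quotient_kernel(1)[OF comp_rel_eq[OF F]] by (simp add: comp_key_range)
  also have "\<dots> = (\<Sum>n | card (?A n) \<noteq> 0. card (?A n))" by (rule card_Sigma_UNIV[OF fin])
  finally have eq: "egf (compose F G) (\<lambda>_. p) = (\<Sum>n | card (?A n) \<noteq> 0. of_nat (card (?A n)) / fact p)"
    by (simp add: sum_divide_distrib)
  have coeff: "of_nat (card (?A n)) / fact p = fps_nth (?t n) p" for n
  proof -
    have finX: "finite (?X n)"
      using species_finite[OF F finite_tuple_std] card_labelled(1)[where G = G, OF G] by blast
    have "(\<Sum>\<sigma>\<in>relabelings n. card {x \<in> ?X n. relabel F n \<sigma> x = x}) = card (?A n) * (\<Prod>i\<in>UNIV. fact (n i))"
    proof (rule burnside_relabel[OF F finX])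
      show "relabel F n \<sigma> x \<in> ?X n" if "\<sigma> \<in> relabelings n" "x \<in> ?X n" for \<sigma> x
        using that relabel_in[OF F that(1), of x] labelled_relabel[OF that(1)] by (auto simp: relabel_def)
    qed auto
    \<comment> \<open>Only the identity has fixed points, so the sum collapses and all orbits have
      full size; the product of factorials is then absorbed into \<open>egf F n\<close>.\<close>
    also have "(\<Sum>\<sigma>\<in>relabelings n. card {x \<in> ?X n. relabel F n \<sigma> x = x})
      = (\<Sum>\<sigma>\<in>{\<lambda>i. id}. card {x \<in> ?X n. relabel F n \<sigma> x = x})"
    proof (rule sum.mono_neutral_right)
      show "\<forall>\<sigma>\<in>relabelings n - {\<lambda>i. id}. card {x \<in> ?X n. relabel F n \<sigma> x = x} = 0"
      proof
        fix \<sigma> assume \<sigma>: "\<sigma> \<in> relabelings n - {\<lambda>i. id}"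
        then have "{x \<in> ?X n. relabel F n \<sigma> x = x} = {}"
          using labelled_relabel_free[OF asym] by blast
        then show "card {x \<in> ?X n. relabel F n \<sigma> x = x} = 0" by (simp only: card.empty)
      qed
    qed (auto simp: finite_relabelings relabelings_id)
    also have "\<dots> = card {x \<in> ?X n. relabel F n (\<lambda>i. id) x = x}"
      by (simp only: sum.insert sum.empty finite.emptyI empty_iff not_False_eq_True add_0_right)
    also have "{x \<in> ?X n. relabel F n (\<lambda>i. id) x = x} = ?X n"
      using relabel_id[OF F] by auto
    finally have "card (?X n) = card (?A n) * (\<Prod>i\<in>UNIV. fact (n i))" .
    then have "of_nat (card (structs F (std n))) * (of_nat (card (labelled G n ?U)) :: rat)
      = of_nat (card (?A n) * (\<Prod>i\<in>UNIV. fact (n i)))"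
      unfolding card_cartesian_product by (metis of_nat_mult)
    then have "of_nat (card (?A n)) * (\<Prod>i\<in>UNIV. fact (n i)) =
      of_nat (card (structs F (std n))) * (of_nat (card (labelled G n ?U)) :: rat)" by simp
    then have "of_nat (card (?A n)) = egf F n * of_nat (card (labelled G n ?U))"
      unfolding egf_def by (simp add: field_simps)
    then show ?thesis unfolding card_labelled(2)[where G = G, OF G] by (simp add: series_term_def)
  qed
  have "{n. card (?A n) \<noteq> 0} = {n. fps_nth (?t n) p \<noteq> 0}"
    unfolding coeff[symmetric] by simp
  then show "fps_nth (univariate (egf (compose F G))) p
    = fps_nth (series_eval (egf F) (\<lambda>i. univariate (egf (G i)))) p"
    by (simp add: univariate_def series_eval_def fps_Sum_def eq coeff)
qed

section \<open>Formal sums of power series\<close>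

text \<open>Agreement of coefficients below \<open>q\<close> is treated as divisibility, so that
  congruences can be added and multiplied in the ring.\<close>

lemma fps_X_power_dvd_iff: "fps_X ^ q dvd (f :: rat fps) \<longleftrightarrow> (\<forall>k<q. fps_nth f k = 0)"
proof
  assume "fps_X ^ q dvd f"
  then obtain g where "f = fps_X ^ q * g" by blast
  then show "\<forall>k<q. fps_nth f k = 0" by (simp add: fps_X_power_mult_nth)
next
  assume "\<forall>k<q. fps_nth f k = 0"
  then have "f = fps_X ^ q * fps_shift q f" by (auto simp: fps_eq_iff fps_X_power_mult_nth)
  then show "fps_X ^ q dvd f" by (metis dvd_triv_left)
qed

text \<open>Any finite set containing the support may serve, which allows several formal sums to be
  compared over one index set.\<close>

lemma fps_nth_Sum:
  assumes "finite A" "{a. fps_nth (f a) k \<noteq> 0} \<subseteq> A"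
  shows "fps_nth (fps_Sum f) k = (\<Sum>a\<in>A. fps_nth (f a) k)"
proof -
  have "(\<Sum>a | fps_nth (f a) k \<noteq> 0. fps_nth (f a) k) = (\<Sum>a\<in>A. fps_nth (f a) k)"
    using assms by (intro sum.mono_neutral_left) auto
  then show ?thesis by (simp add: fps_Sum_def)
qed

lemma fps_Sum_reindex:
  assumes "inj g" "\<And>a. f' (g a) = f a" "\<And>b. b \<notin> range g \<Longrightarrow> f' b = 0"
  shows "fps_Sum f' = fps_Sum f"
proof (rule fps_ext)
  fix k
  have "{b. fps_nth (f' b) k \<noteq> 0} = g ` {a. fps_nth (f a) k \<noteq> 0}"
    using assms(2,3) by (auto simp: image_iff) (metis fps_zero_nth rangeE)
  then show "fps_nth (fps_Sum f') k = fps_nth (fps_Sum f) k"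
    using assms(1) by (simp add: fps_Sum_def sum.reindex inj_on_subset[OF _ subset_UNIV] assms(2))
qed

section \<open>The cycle index as a sum over permutations\<close>

definition cycle_monomial :: "('s::finite \<Rightarrow> nat) \<Rightarrow> ('s \<Rightarrow> nat \<Rightarrow> rat fps) \<Rightarrow> ('s \<Rightarrow> nat \<Rightarrow> nat) \<Rightarrow> rat fps" where
  "cycle_monomial n x \<sigma> = (\<Prod>i\<in>UNIV. \<Prod>C\<in>orbit (\<sigma> i) ` {1..n i}. x i (card C))"

lemma cycle_index_term_monomial:
  "cycle_index_term F x n = fps_const (1 / (\<Prod>i\<in>UNIV. fact (n i))) *
    (\<Sum>\<sigma>\<in>relabelings n. of_nat (num_fixed F n \<sigma>) * cycle_monomial n x \<sigma>)"
proof -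
  have "(\<Prod>i\<in>UNIV. \<Prod>j\<in>{1..n i}. x i j ^ num_cycles (n i) j (\<sigma> i)) = cycle_monomial n x \<sigma>"
    if "\<sigma> \<in> relabelings n" for \<sigma>
    unfolding cycle_monomial_def using that by (intro prod.cong refl prod_num_cycles) (simp add: relabelings_def)
  then show ?thesis
    unfolding cycle_index_term_def relabelings_def[symmetric] by (simp cong: sum.cong)
qed

lemma relabelings_permutes: "\<sigma> \<in> relabelings n \<Longrightarrow> \<sigma> i permutes {1..n i}"
  by (simp add: relabelings_def)

lemma sum_card_orbits:
  assumes "\<sigma> permutes {1..n}"
  shows "(\<Sum>C\<in>orbit \<sigma> ` {1..n}. card C) = n"
proof -
  have "n = (\<Sum>a\<in>{1..n}. 1)" by simp
  also have "\<dots> = (\<Sum>C\<in>orbit \<sigma> ` {1..n}. \<Sum>a\<in>{a \<in> {1..n}. orbit \<sigma> a = C}. 1)"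
    by (rule sum.image_gen) simp
  also have "\<dots> = (\<Sum>C\<in>orbit \<sigma> ` {1..n}. card C)"
    using permutes_orbit_fibre(1)[OF assms] by (intro sum.cong) auto
  finally show ?thesis by simp
qed

text \<open>A cycle of length \<open>j\<close> contributes a multiple of \<open>fps_X ^ j\<close>,
  and the lengths of the cycles in sort \<open>i\<close> add up to \<open>n i\<close>.\<close>

lemma cycle_monomial_dvd:
  assumes x: "\<And>i j. i \<notin> P \<Longrightarrow> 0 < j \<Longrightarrow> fps_X ^ j dvd x i j" and \<sigma>: "\<sigma> \<in> relabelings n"
  shows "fps_X ^ (\<Sum>i\<in>-P. n i) dvd cycle_monomial n x \<sigma>"
proof -
  have *: "fps_X ^ n i dvd (\<Prod>C\<in>orbit (\<sigma> i) ` {1..n i}. x i (card C))" if "i \<notin> P" for i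
  proof -
    have "fps_X ^ n i = (fps_X :: rat fps) ^ (\<Sum>C\<in>orbit (\<sigma> i) ` {1..n i}. card C)"
      using sum_card_orbits[OF relabelings_permutes[OF \<sigma>], of i] by simp
    also have "\<dots> = (\<Prod>C\<in>orbit (\<sigma> i) ` {1..n i}. fps_X ^ card C)" by (rule power_sum)
    also have "\<dots> dvd (\<Prod>C\<in>orbit (\<sigma> i) ` {1..n i}. x i (card C))"
      using permutes_orbit_fibre(2)[OF relabelings_permutes[OF \<sigma>]] x[OF that] by (intro prod_dvd_prod) auto
    finally show ?thesis .
  qed
  have "fps_X ^ (\<Sum>i\<in>-P. n i) = (\<Prod>i\<in>-P. (fps_X :: rat fps) ^ n i)" by (rule power_sum)
  also have "\<dots> dvd (\<Prod>i\<in>-P. \<Prod>C\<in>orbit (\<sigma> i) ` {1..n i}. x i (card C))"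
    using * by (intro prod_dvd_prod) auto
  also have "\<dots> dvd cycle_monomial n x \<sigma>"
    unfolding cycle_monomial_def by (intro prod_dvd_prod_subset) auto
  finally show ?thesis .
qed

lemma cycle_index_term_dvd:
  assumes "\<And>i j. i \<notin> P \<Longrightarrow> 0 < j \<Longrightarrow> fps_X ^ j dvd x i j"
  shows "fps_X ^ (\<Sum>i\<in>-P. n i) dvd cycle_index_term F x n"
  unfolding cycle_index_term_monomial
  by (intro dvd_mult dvd_sum cycle_monomial_dvd[where P = P]) (simp_all add: assms)

lemma cycle_index_term_nonzero:
  assumes "cycle_index_term F x n \<noteq> 0"
  shows "structs F (std n) \<noteq> {}"
proof
  assume "structs F (std n) = {}"
  then have "num_fixed F n \<sigma> = 0" for \<sigma> by (simp add: num_fixed_def)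
  then show False using assms by (simp add: cycle_index_term_monomial)
qed

lemma cycle_index_term_nth_nonzero:
  assumes x: "\<And>i j. i \<notin> P \<Longrightarrow> 0 < j \<Longrightarrow> fps_X ^ j dvd x i j"
    and nz: "fps_nth (cycle_index_term F x n) k \<noteq> 0"
  shows "structs F (std n) \<noteq> {}" "(\<Sum>i\<in>-P. n i) \<le> k"
proof -
  show "structs F (std n) \<noteq> {}"
    by (rule cycle_index_term_nonzero[of F x]) (use nz in auto)
  show "(\<Sum>i\<in>-P. n i) \<le> k"
    using cycle_index_term_dvd[where P = P and n = n and F = F, OF x] nz unfolding fps_X_power_dvd_iff by (meson not_le)
qed

text \<open>A coefficient of order \<open>k\<close> only sees multidegrees of total degree at most
  \<open>k\<close> outside \<open>P\<close>, and polynomiality leaves finitely many of these with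
  structures.\<close>

lemma cycle_index_locally_finite:
  fixes F :: "('s::finite, 'x) species"
  assumes P: "polynomial_in F P" and x: "\<And>i j. i \<notin> P \<Longrightarrow> 0 < j \<Longrightarrow> fps_X ^ j dvd x i j"
  shows "locally_finite (cycle_index_term F x)"
  unfolding locally_finite_def
proof
  fix k
  have "{n. fps_nth (cycle_index_term F x n) k \<noteq> 0} \<subseteq> {n. (\<Sum>i\<in>-P. n i) \<le> k \<and> structs F (std n) \<noteq> {}}"
    using cycle_index_term_nth_nonzero[where P = P and x = x and F = F, OF x] by auto
  then show "finite {n. fps_nth (cycle_index_term F x n) k \<noteq> 0}"
    using polynomial_in_finite[OF P] by (rule finite_subset)
qed

section \<open>Derivatives\<close>

abbreviation inc :: "'s \<Rightarrow> ('s \<Rightarrow> nat) \<Rightarrow> 's \<Rightarrow> nat" where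
  "inc k n \<equiv> n(k := Suc (n k))"

lemma finite_tuple_add_point: "finite_tuple (add_point k (std n))"
  by (simp add: finite_tuple_def add_point_def std_def)

lemma card_add_point: "card (add_point k (std n) i) = card (std (inc k n) i)"
  by (simp add: add_point_def std_def card_image)

lemma structs_partial_deriv: "structs (partial_deriv k F) U = structs F (add_point k U)"
  by (simp add: partial_deriv_def)

lemma structs_partial_deriv_nonempty:
  assumes F: "is_species F" and "structs (partial_deriv k F) (std n) \<noteq> {}"
  shows "structs F (std (inc k n)) \<noteq> {}"
  by (rule structs_nonempty_cong[OF F finite_tuple_add_point finite_tuple_std card_add_point])
    (use assms(2) in \<open>simp add: structs_partial_deriv\<close>)

text \<open>Structures of the derivative in multidegree \<open>n\<close> are structures of
  \<open>F\<close> in multidegree \<open>inc k n\<close>, and \<open>inc k\<close> is injective and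
  raises the degree outside \<open>P\<close> by at most one.\<close>

lemma polynomial_in_partial_deriv:
  fixes F :: "('s::finite, 'x) species"
  assumes F: "is_species F" and P: "polynomial_in F P"
  shows "polynomial_in (partial_deriv k F) P"
  unfolding polynomial_in_def
proof
  fix l
  let ?N = "{n. (\<Sum>i\<in>-P. n i) = l \<and> structs (partial_deriv k F) (std n) \<noteq> {}}"
  have "inc k ` ?N \<subseteq> {n. (\<Sum>i\<in>-P. n i) \<le> Suc l \<and> structs F (std n) \<noteq> {}}"
  proof (rule image_subsetI)
    fix n assume n: "n \<in> ?N"
    have "(\<Sum>i\<in>-P. inc k n i) \<le> (\<Sum>i\<in>-P. n i + (if i = k then 1 else 0))" by (intro sum_mono) auto
    also have "\<dots> \<le> Suc (\<Sum>i\<in>-P. n i)" by (simp add: sum.distrib)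
    finally show "inc k n \<in> {n. (\<Sum>i\<in>-P. n i) \<le> Suc l \<and> structs F (std n) \<noteq> {}}"
      using n structs_partial_deriv_nonempty[OF F] by simp
  qed
  then have "finite (inc k ` ?N)" using polynomial_in_finite[OF P] by (rule finite_subset)
  moreover have "inj_on (inc k) ?N" by (intro inj_onI) (auto simp: fun_eq_iff split: if_splits; metis)
  ultimately have "finite ?N" by (rule finite_imageD)
  moreover have "finite (structs (partial_deriv k F) (std n))" for n
    using species_finite[OF F finite_tuple_add_point] by (simp add: structs_partial_deriv)
  ultimately have "finite (SIGMA n:?N. structs (partial_deriv k F) (std n))" by (rule finite_SigmaI)
  moreover have "(SIGMA n:{n. (\<Sum>i\<in>-P. n i) = l}. structs (partial_deriv k F) (std n))
    = (SIGMA n:?N. structs (partial_deriv k F) (std n))" by auto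
  ultimately show "finite (SIGMA n:{n. (\<Sum>i\<in>-P. n i) = l}. structs (partial_deriv k F) (std n))" by simp
qed

section \<open>Cycle index of a derivative\<close>

lemma orbit_conj:
  assumes "bij \<pi>"
  shows "orbit (\<pi> \<circ> f \<circ> inv \<pi>) (\<pi> b) = \<pi> ` orbit f b"
proof -
  have "((\<pi> \<circ> f \<circ> inv \<pi>) ^^ m) (\<pi> b) = \<pi> ((f ^^ m) b)" for m
    using assms by (induct m) (simp_all add: bij_is_inj)
  then show ?thesis by (auto simp: orbit_altdef)
qed

text \<open>For a fixed point \<open>a\<close> of \<open>\<sigma> k\<close>, this is the cycle
  monomial with the factor of the cycle \<open>{a}\<close> deleted; summed over \<open>a\<close> it
  is the derivative of the monomial in the variable \<open>x k 1\<close>.\<close>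

definition monomial_without ::
  "('s::finite \<Rightarrow> nat) \<Rightarrow> ('s \<Rightarrow> nat \<Rightarrow> rat fps) \<Rightarrow> ('s \<Rightarrow> nat \<Rightarrow> nat) \<Rightarrow> 's \<Rightarrow> nat \<Rightarrow> rat fps" where
  "monomial_without n x \<sigma> k a =
    (\<Prod>i\<in>UNIV. \<Prod>C\<in>orbit (\<sigma> i) ` {1..n i} - (if i = k then {{a}} else {}). x i (card C))"

text \<open>A structure with a distinguished label is a structure of the derivative, and a
  relabeling that fixes this label acts on the rest. Renaming \<open>a\<close> to the adjoined point
  identifies the two sums, so the left-hand side is the same for every \<open>a\<close>.\<close>

lemma sum_fixing_point:
  fixes F :: "('s::finite, 'x) species"
  assumes F: "is_species F" and a: "a \<in> {1..Suc (n k)}"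
  shows "(\<Sum>\<sigma>\<in>{\<sigma> \<in> relabelings (inc k n). \<sigma> k a = a}.
      of_nat (num_fixed F (inc k n) \<sigma>) * monomial_without (inc k n) x \<sigma> k a)
    = (\<Sum>\<tau>\<in>relabelings n. of_nat (num_fixed (partial_deriv k F) n \<tau>) * cycle_monomial n x \<tau>)"
proof -
  let ?N = "inc k n" and ?m = "Suc (n k)"
  \<comment> \<open>Exchanges \<open>a\<close> with the last label, so that the labels other than
    \<open>a\<close> are the images of \<open>{1..n k}\<close>.\<close>
  define \<pi> where "\<pi> = Transposition.transpose a ?m"
  have pp [simp]: "\<pi> (\<pi> b) = b" and inv\<pi>: "inv \<pi> = \<pi>" and bij: "bij \<pi>" and \<pi>m: "\<pi> ?m = a" and \<pi>a: "\<pi> a = ?m" for b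
    by (simp_all add: \<pi>_def)
  have inj: "inj \<pi>" using bij by (rule bij_is_inj)
  have perm: "\<pi> permutes {1..?m}" unfolding \<pi>_def using a by (intro permutes_swap_id) auto
  have low: "\<pi> b \<in> {1..?m} \<and> \<pi> b \<noteq> a" if "b \<in> {1..n k}" for b
    using that permutes_in_image[OF perm, of b] \<pi>a pp[of b] by auto
  have ins: "{1..?m} = insert a (\<pi> ` {1..n k})"
  proof -
    have "{1..?m} = \<pi> ` {1..?m}" using permutes_image[OF perm] by simp
    also have "\<dots> = \<pi> ` insert ?m {1..n k}" by (rule arg_cong[where f = "image \<pi>"]) auto
    finally show ?thesis using \<pi>m by simp
  qed
  define up where "up \<tau> = \<tau>(k := \<pi> \<circ> \<tau> k \<circ> \<pi>)" for \<tau> :: "'s \<Rightarrow> nat \<Rightarrow> nat"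
  have upup: "up (up \<tau>) = \<tau>" for \<tau> by (auto simp: up_def fun_eq_iff)
  have p1: "up \<tau> \<in> relabelings ?N \<and> up \<tau> k a = a" if \<tau>: "\<tau> \<in> relabelings n" for \<tau>
  proof
    have m: "\<tau> k ?m = ?m" using relabelings_permutes[OF \<tau>, of k] by (simp add: permutes_def)
    then show "up \<tau> k a = a" by (simp add: up_def \<pi>a \<pi>m)
    have "\<tau> k permutes {1..?m}" using relabelings_permutes[OF \<tau>, of k] by (rule permutes_subset) auto
    then have "\<pi> \<circ> \<tau> k \<circ> \<pi> permutes {1..?m}" by (intro permutes_compose perm)
    then show "up \<tau> \<in> relabelings ?N" using \<tau> by (simp add: relabelings_def up_def)
  qed
  have p2: "up \<sigma> \<in> relabelings n" if \<sigma>: "\<sigma> \<in> relabelings ?N" "\<sigma> k a = a" for \<sigma>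
  proof -
    have "\<sigma> k permutes {1..?m}" using relabelings_permutes[OF \<sigma>(1), of k] by simp
    then have c: "\<pi> \<circ> \<sigma> k \<circ> \<pi> permutes {1..?m}" by (intro permutes_compose perm)
    have "(\<pi> \<circ> \<sigma> k \<circ> \<pi>) ?m = ?m" by (simp add: \<pi>m \<sigma>(2) \<pi>a)
    then have "\<pi> \<circ> \<sigma> k \<circ> \<pi> permutes {1..n k}"
      by (intro permutes_superset[OF c]) (auto simp: le_Suc_eq)
    moreover have "\<sigma> i permutes {1..n i}" if "i \<noteq> k" for i
      using relabelings_permutes[OF \<sigma>(1), of i] that by simp
    ultimately show ?thesis by (simp add: relabelings_def up_def)
  qed
  have bij_up: "bij_betw up (relabelings n) {\<sigma> \<in> relabelings ?N. \<sigma> k a = a}"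
  proof (rule bij_betwI[where g = up])
    show "up \<in> relabelings n \<rightarrow> {\<sigma> \<in> relabelings ?N. \<sigma> k a = a}" using p1 by blast
    show "up \<in> {\<sigma> \<in> relabelings ?N. \<sigma> k a = a} \<rightarrow> relabelings n" using p2 by blast
  qed (rule upup)+
  have fixed: "num_fixed F ?N (up \<tau>) = num_fixed (partial_deriv k F) n \<tau>" if \<tau>: "\<tau> \<in> relabelings n" for \<tau>
  proof -
    let ?A = "add_point k (std n)" and ?\<tau> = "\<tau>(k := case_nat 0 (\<lambda>a. Suc (\<tau> k a)))"
    \<comment> \<open>Sends the adjoined point \<open>0\<close> to \<open>a\<close> and undoes the
      shift of the old labels, placing them around \<open>a\<close> by \<open>\<pi>\<close>.\<close>
    define \<rho> where "\<rho> = (\<lambda>i. id)(k := case_nat a \<pi>)"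
    have \<rho>: "bij_tuple \<rho> ?A (std ?N)"
      unfolding bij_tuple_def
    proof
      fix i
      show "bij_betw (\<rho> i) (?A i) (std ?N i)"
      proof (cases "i = k")
        case True
        have "case_nat a \<pi> ` insert 0 (Suc ` {1..n k}) = {1..?m}"
          unfolding ins by (simp only: image_insert image_image nat.case)
        moreover have "inj_on (case_nat a \<pi>) (insert 0 (Suc ` {1..n k}))"
        proof (rule inj_onI)
          fix b c assume "b \<in> insert 0 (Suc ` {1..n k})" "c \<in> insert 0 (Suc ` {1..n k})"
            "case_nat a \<pi> b = case_nat a \<pi> c"
          then show "b = c" using low inj by (cases b; cases c) (auto simp: inj_eq)
        qed
        ultimately show ?thesis using True by (simp add: \<rho>_def bij_betw_def add_point_def std_def)
      qed (simp add: \<rho>_def add_point_def std_def)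
    qed
    have \<tau>': "bij_tuple ?\<tau> ?A ?A"
      unfolding bij_tuple_def
    proof
      fix i
      show "bij_betw (?\<tau> i) (?A i) (?A i)"
      proof (cases "i = k")
        case True
        have p: "\<tau> k permutes {1..n k}" by (rule relabelings_permutes[OF \<tau>])
        have "case_nat 0 (\<lambda>a. Suc (\<tau> k a)) ` insert 0 (Suc ` {1..n k}) = insert 0 (Suc ` \<tau> k ` {1..n k})"
          by (simp only: image_insert image_image nat.case)
        then have "case_nat 0 (\<lambda>a. Suc (\<tau> k a)) ` insert 0 (Suc ` {1..n k}) = insert 0 (Suc ` {1..n k})"
          by (simp only: permutes_image[OF p])
        moreover have "inj_on (case_nat 0 (\<lambda>a. Suc (\<tau> k a))) (insert 0 (Suc ` {1..n k}))"
        proof (rule inj_onI)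
          fix b c assume "case_nat 0 (\<lambda>a. Suc (\<tau> k a)) b = case_nat 0 (\<lambda>a. Suc (\<tau> k a)) c"
          then show "b = c" using permutes_inj[OF p] by (cases b; cases c) (auto simp: inj_eq)
        qed
        ultimately show ?thesis using True by (simp add: bij_betw_def add_point_def std_def)
      next
        case False
        then show ?thesis using permutes_imp_bij[OF relabelings_permutes[OF \<tau>, of i]]
          by (simp add: add_point_def std_def)
      qed
    qed
    have up_bij: "bij_tuple (up \<tau>) (std ?N) (std ?N)" using p1[OF \<tau>] relabelings_bij_tuple by blast
    have comm: "transport F (std ?N) (up \<tau>) (transport F ?A \<rho> h) = transport F ?A \<rho> (transport F ?A ?\<tau> h)"
      if h: "h \<in> structs F ?A" for h
    proof -
      have m: "\<tau> k ?m = ?m" using relabelings_permutes[OF \<tau>, of k] by (simp add: permutes_def)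
      have "up \<tau> i (\<rho> i b) = \<rho> i (?\<tau> i b)" for i b
        by (cases "i = k") (auto simp: up_def \<rho>_def \<pi>a \<pi>m m split: nat.split)
      then show ?thesis
        unfolding transport_comp[OF F finite_tuple_add_point \<rho> up_bij h] transport_comp[OF F finite_tuple_add_point \<tau>' \<rho> h]
        by (simp add: o_def)
    qed
    note b = bij_betw_transport[OF F finite_tuple_add_point \<rho>]
    have "bij_betw (transport F ?A \<rho>) {h \<in> structs F ?A. transport F ?A ?\<tau> h = h}
      {h \<in> structs F (std ?N). transport F (std ?N) (up \<tau>) h = h}"
    proof (rule bij_betw_subset[OF b])
      show "transport F ?A \<rho> ` {h \<in> structs F ?A. transport F ?A ?\<tau> h = h}
        = {h \<in> structs F (std ?N). transport F (std ?N) (up \<tau>) h = h}"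
      proof (intro equalityI subsetI)
        fix h' assume "h' \<in> {h \<in> structs F (std ?N). transport F (std ?N) (up \<tau>) h = h}"
        then have h': "h' \<in> structs F (std ?N)" "transport F (std ?N) (up \<tau>) h' = h'" by auto
        then obtain h where h: "h \<in> structs F ?A" "h' = transport F ?A \<rho> h" using b by (auto simp: bij_betw_def)
        have "transport F ?A \<rho> (transport F ?A ?\<tau> h) = transport F ?A \<rho> h" using comm[OF h(1)] h' h(2) by simp
        then have "transport F ?A ?\<tau> h = h"
          using b transport_in[OF F finite_tuple_add_point \<tau>' h(1)] h(1) by (auto simp: bij_betw_def inj_on_eq_iff)
        then show "h' \<in> transport F ?A \<rho> ` {h \<in> structs F ?A. transport F ?A ?\<tau> h = h}" using h by blast
      qed (use comm transport_in[OF F finite_tuple_add_point \<rho>] in auto)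
    qed auto
    from bij_betw_same_card[OF this] show ?thesis by (simp add: num_fixed_def partial_deriv_def)
  qed
  have mono: "monomial_without ?N x (up \<tau>) k a = cycle_monomial n x \<tau>" if \<tau>: "\<tau> \<in> relabelings n" for \<tau>
    unfolding monomial_without_def cycle_monomial_def
  proof (rule prod.cong[OF refl])
    fix i
    show "(\<Prod>C\<in>orbit (up \<tau> i) ` {1..?N i} - (if i = k then {{a}} else {}). x i (card C))
      = (\<Prod>C\<in>orbit (\<tau> i) ` {1..n i}. x i (card C))"
    proof (cases "i = k")
      case True
      have o: "orbit (up \<tau> k) (\<pi> b) = \<pi> ` orbit (\<tau> k) b" for b
        using orbit_conj[OF bij, of "\<tau> k" b] by (simp add: up_def inv\<pi>)
      have oa: "orbit (up \<tau> k) a = {a}" using p1[OF \<tau>] by (simp add: orbit_eq_singleton_iff)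
      have na: "\<pi> ` orbit (\<tau> k) b \<noteq> {a}" if "b \<in> {1..n k}" for b
      proof -
        have "b \<in> orbit (\<tau> k) b" by (rule permutes_self_in_orbit[OF relabelings_permutes[OF \<tau>]]) simp
        then show ?thesis using low[OF that] by blast
      qed
      have "orbit (up \<tau> k) ` {1..?m} - {{a}} = (\<lambda>C. \<pi> ` C) ` orbit (\<tau> k) ` {1..n k}"
        unfolding ins using na by (auto simp: oa o image_image)
      moreover have "inj_on (\<lambda>C. \<pi> ` C) A" for A using inj by (simp add: inj_on_def inj_image_eq_iff)
      moreover have "card (\<pi> ` C) = card C" for C using inj by (simp add: card_image inj_on_subset)
      ultimately show ?thesis using True by (simp add: prod.reindex)
    qed (simp add: up_def)
  qed
  show ?thesis
    by (rule sum.reindex_bij_betw[OF bij_up, symmetric, THEN trans]) (intro sum.cong refl, simp add: fixed mono)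
qed

text \<open>The cycle index of the derivative is the derivative of the cycle index in
  \<open>x k 1\<close>, one multidegree at a time. After exchanging the sums, each of the
  \<open>n k + 1\<close> labels contributes equally, and this factor turns the factorial of
  \<open>n k + 1\<close> into that of \<open>n k\<close>.\<close>

lemma cycle_index_term_partial_deriv:
  fixes F :: "('s::finite, 'x) species"
  assumes F: "is_species F"
  shows "fps_const (1 / (\<Prod>i\<in>UNIV. fact (inc k n i))) *
     (\<Sum>\<sigma>\<in>relabelings (inc k n). of_nat (num_fixed F (inc k n) \<sigma>) *
        (\<Sum>a | a \<in> {1..inc k n k} \<and> \<sigma> k a = a. monomial_without (inc k n) x \<sigma> k a))
    = cycle_index_term (partial_deriv k F) x n"
proof -
  let ?N = "inc k n" and ?m = "Suc (n k)"
  let ?T = "\<Sum>\<tau>\<in>relabelings n. of_nat (num_fixed (partial_deriv k F) n \<tau>) * cycle_monomial n x \<tau>"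
  let ?s = "\<lambda>\<sigma> a. of_nat (num_fixed F ?N \<sigma>) * monomial_without ?N x \<sigma> k a"
  have "(\<Sum>\<sigma>\<in>relabelings ?N. of_nat (num_fixed F ?N \<sigma>) *
        (\<Sum>a | a \<in> {1..?N k} \<and> \<sigma> k a = a. monomial_without ?N x \<sigma> k a))
    = (\<Sum>\<sigma>\<in>relabelings ?N. \<Sum>a | a \<in> {1..?m} \<and> \<sigma> k a = a. ?s \<sigma> a)"
    by (simp add: sum_distrib_left)
  also have "\<dots> = (\<Sum>a\<in>{1..?m}. \<Sum>\<sigma> | \<sigma> \<in> relabelings ?N \<and> \<sigma> k a = a. ?s \<sigma> a)"
    by (rule sum.swap_restrict) (simp_all add: finite_relabelings)
  also have "\<dots> = (\<Sum>a\<in>{1..?m}. ?T)"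
    by (intro sum.cong refl sum_fixing_point[OF F])
  also have "\<dots> = of_nat ?m * ?T" by simp
  finally have "(\<Sum>\<sigma>\<in>relabelings ?N. of_nat (num_fixed F ?N \<sigma>) *
        (\<Sum>a | a \<in> {1..?N k} \<and> \<sigma> k a = a. monomial_without ?N x \<sigma> k a)) = of_nat ?m * ?T" .
  moreover have "(\<Prod>i\<in>UNIV. fact (?N i)) = (of_nat ?m * (\<Prod>i\<in>UNIV. fact (n i)) :: rat)"
  proof -
    have "(\<Prod>i\<in>UNIV. fact (?N i)) = (\<Prod>i\<in>UNIV. (if i = k then of_nat ?m else 1) * fact (n i) :: rat)"
      by (intro prod.cong) auto
    then show ?thesis by (simp add: prod.distrib)
  qed
  moreover have "fps_const (1 / (of_nat ?m * c)) * (of_nat ?m * f) = fps_const (1 / c) * f" for c :: rat and f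
    by (simp add: fps_of_nat[symmetric] mult.assoc[symmetric] del: of_nat_Suc)
  ultimately show ?thesis by (simp only: cycle_index_term_monomial)
qed

section \<open>Taylor expansion of the cycle index\<close>

text \<open>The first-order term is taken at \<open>u\<close>, not at \<open>v\<close>: later
  \<open>u\<close> comes from the current iterate, where Newton's method evaluates the Jacobian, and
  \<open>v\<close> from the solution. Adding one factor creates an error that is a product of two
  differences.\<close>

lemma prod_taylor:
  fixes u v :: "'k \<Rightarrow> 'a::comm_ring_1"
  assumes "finite K" "\<And>k. k \<in> K \<Longrightarrow> d dvd u k - v k"
  shows "d * d dvd prod u K - prod v K - (\<Sum>k\<in>K. (u k - v k) * prod u (K - {k}))"
  using assms
proof (induction K rule: finite_induct)
  case (insert k K)
  let ?S = "\<Sum>j\<in>K. (u j - v j) * prod u (K - {j})"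
  have "(\<Sum>j\<in>K. (u j - v j) * prod u (insert k K - {j})) = (\<Sum>j\<in>K. u k * ((u j - v j) * prod u (K - {j})))"
  proof (rule sum.cong[OF refl])
    fix j assume "j \<in> K"
    then have "insert k K - {j} = insert k (K - {j})" using insert by auto
    then show "(u j - v j) * prod u (insert k K - {j}) = u k * ((u j - v j) * prod u (K - {j}))"
      using insert by (simp add: algebra_simps)
  qed
  also have "\<dots> = u k * ?S" by (simp add: sum_distrib_left)
  finally have S: "(\<Sum>j\<in>K. (u j - v j) * prod u (insert k K - {j})) = u k * ?S" .
  have "insert k K - {k} = K" using insert by auto
  then have eq: "prod u (insert k K) - prod v (insert k K) - (\<Sum>j\<in>insert k K. (u j - v j) * prod u (insert k K - {j}))
    = v k * (prod u K - prod v K - ?S) - (u k - v k) * ?S"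
    using insert(1,2) by (simp add: S) (simp add: algebra_simps)
  have "d dvd ?S" using insert by (intro dvd_sum dvd_mult2) auto
  moreover have "d dvd u k - v k" using insert by blast
  ultimately have "d * d dvd (u k - v k) * ?S" by (intro mult_dvd_mono)
  moreover have "d * d dvd v k * (prod u K - prod v K - ?S)" using insert by (intro dvd_mult) auto
  ultimately show ?case unfolding eq by (intro dvd_diff)
qed simp

lemma orbits_card_1:
  assumes "\<sigma> permutes {1..n :: nat}"
  shows "{C \<in> orbit \<sigma> ` {1..n}. card C = 1} = (\<lambda>a. {a}) ` {a \<in> {1..n}. \<sigma> a = a}"
proof (intro equalityI subsetI)
  fix C assume "C \<in> {C \<in> orbit \<sigma> ` {1..n}. card C = 1}"
  then obtain a where a: "a \<in> {1..n}" "C = orbit \<sigma> a" "card C = 1" by auto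
  have "a \<in> C" using permutes_self_in_orbit[OF assms finite_atLeastAtMost, of a] a by simp
  then have "C = {a}" using a(3) by (metis card_1_singletonE singletonD)
  then show "C \<in> (\<lambda>a. {a}) ` {a \<in> {1..n}. \<sigma> a = a}"
    using a orbit_eq_singleton_iff[of \<sigma> a] by blast
next
  fix C assume "C \<in> (\<lambda>a. {a}) ` {a \<in> {1..n}. \<sigma> a = a}"
  then obtain a where a: "a \<in> {1..n}" "\<sigma> a = a" "C = {a}" by auto
  then have "orbit \<sigma> a = C" by (simp add: orbit_eq_singleton_iff)
  then show "C \<in> {C \<in> orbit \<sigma> ` {1..n}. card C = 1}" using a by auto
qed

lemma cycle_monomial_taylor:
  fixes x t :: "'s::finite \<Rightarrow> nat \<Rightarrow> rat fps"
  assumes \<sigma>: "\<sigma> \<in> relabelings n"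
    and xt: "\<And>i j. 0 < j \<Longrightarrow> fps_X ^ p dvd x i j - t i j"
    and xt2: "\<And>i j. 1 < j \<Longrightarrow> fps_X ^ (2 * p) dvd x i j - t i j"
  shows "fps_X ^ (2 * p) dvd cycle_monomial n x \<sigma> - cycle_monomial n t \<sigma> -
    (\<Sum>k\<in>UNIV. (x k 1 - t k 1) * (\<Sum>a | a \<in> {1..n k} \<and> \<sigma> k a = a. monomial_without n x \<sigma> k a))"
proof -
  let ?O = "\<lambda>i. orbit (\<sigma> i) ` {1..n i}"
  let ?K = "SIGMA i:UNIV. ?O i"
  let ?u = "\<lambda>k. x (fst k) (card (snd k))" and ?v = "\<lambda>k. t (fst k) (card (snd k))"
  let ?w = "\<lambda>k. (?u k - ?v k) * prod ?u (?K - {k})"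
  note p = relabelings_permutes[OF \<sigma>]
  have pos: "0 < card C" if "C \<in> ?O i" for i C using permutes_orbit_fibre(2)[OF p _ that] by simp
  have mono: "cycle_monomial n y \<sigma> = (\<Prod>k\<in>?K. y (fst k) (card (snd k)))" for y
    unfolding cycle_monomial_def by (subst prod.Sigma) (auto simp: split_beta)
  have d: "fps_X ^ p dvd ?u k - ?v k" if "k \<in> ?K" for k
    by (rule xt) (use that pos[of "snd k" "fst k"] in auto)
  have "fps_X ^ p * fps_X ^ p dvd cycle_monomial n x \<sigma> - cycle_monomial n t \<sigma> - (\<Sum>k\<in>?K. ?w k)"
    unfolding mono by (rule prod_taylor) (use d in auto)
  then have 1: "fps_X ^ (2 * p) dvd cycle_monomial n x \<sigma> - cycle_monomial n t \<sigma> - (\<Sum>k\<in>?K. ?w k)"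
    by (simp add: mult_2 power_add)
  have without: "prod ?u (?K - {(i, {a})}) = monomial_without n x \<sigma> i a" for i a
  proof -
    have "?K - {(i, {a})} = (SIGMA j:UNIV. ?O j - (if j = i then {{a}} else {}))"
      by (auto split: if_splits)
    then show ?thesis unfolding monomial_without_def by (subst prod.Sigma) (auto simp: split_beta)
  qed
  \<comment> \<open>Among the first-order terms of sort \<open>i\<close>, those of longer cycles
    vanish modulo \<open>fps_X ^ (2 * p)\<close> by \<open>xt2\<close>; cycles of length one are the
    fixed points of \<open>\<sigma> i\<close>.\<close>
  have 2: "fps_X ^ (2 * p) dvd (\<Sum>C\<in>?O i. ?w (i, C)) -
      (x i 1 - t i 1) * (\<Sum>a | a \<in> {1..n i} \<and> \<sigma> i a = a. monomial_without n x \<sigma> i a)" for i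
  proof -
    have "(\<Sum>C\<in>{C \<in> ?O i. card C = 1}. ?w (i, C)) = (\<Sum>a\<in>{a \<in> {1..n i}. \<sigma> i a = a}. ?w (i, {a}))"
      unfolding orbits_card_1[OF p] by (subst sum.reindex) (auto simp: inj_on_def)
    also have "\<dots> = (\<Sum>a | a \<in> {1..n i} \<and> \<sigma> i a = a. (x i 1 - t i 1) * monomial_without n x \<sigma> i a)"
      by (rule sum.cong[OF refl]) (simp only: without fst_conv snd_conv, simp)
    also have "\<dots> = (x i 1 - t i 1) * (\<Sum>a | a \<in> {1..n i} \<and> \<sigma> i a = a. monomial_without n x \<sigma> i a)"
      by (simp add: sum_distrib_left)
    finally have one: "(\<Sum>C\<in>{C \<in> ?O i. card C = 1}. ?w (i, C)) = \<dots>" .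
    have "(\<Sum>C\<in>?O i. ?w (i, C)) = (\<Sum>C\<in>{C \<in> ?O i. card C = 1}. ?w (i, C)) + (\<Sum>C\<in>{C \<in> ?O i. card C \<noteq> 1}. ?w (i, C))"
      by (subst sum.union_disjoint[symmetric]) (auto intro!: sum.cong)
    moreover have "fps_X ^ (2 * p) dvd (\<Sum>C\<in>{C \<in> ?O i. card C \<noteq> 1}. ?w (i, C))"
    proof (intro dvd_sum dvd_mult2)
      fix C assume "C \<in> {C \<in> ?O i. card C \<noteq> 1}"
      then have "1 < card C" using pos[of C i] by simp
      then show "fps_X ^ (2 * p) dvd ?u (i, C) - ?v (i, C)" using xt2 by simp
    qed
    ultimately show ?thesis unfolding one by simp
  qed
  have "(\<Sum>k\<in>?K. ?w k) = (\<Sum>i\<in>UNIV. \<Sum>C\<in>?O i. ?w (i, C))"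
    by (subst sum.Sigma) (auto simp: split_beta)
  then have "fps_X ^ (2 * p) dvd (\<Sum>k\<in>?K. ?w k) -
    (\<Sum>i\<in>UNIV. (x i 1 - t i 1) * (\<Sum>a | a \<in> {1..n i} \<and> \<sigma> i a = a. monomial_without n x \<sigma> i a))"
    using 2 by (simp only: sum_subtractf[symmetric]) (intro dvd_sum, simp)
  moreover have "d dvd a - s" if "d dvd a - w" "d dvd w - s" for a w s d :: "rat fps"
    using dvd_add[OF that] by simp
  ultimately show ?thesis using 1 by blast
qed

text \<open>The terms of the derivative, indexed by the multidegree of \<open>F\<close> they come
  from, so that in the Taylor formula terms of equal index belong together. The case
  \<open>n k = 0\<close> is set to zero because \<open>n k - 1\<close> would truncate.\<close>

definition deriv_term :: "('s::finite, 'x) species \<Rightarrow> ('s \<Rightarrow> nat \<Rightarrow> rat fps) \<Rightarrow> 's \<Rightarrow> ('s \<Rightarrow> nat) \<Rightarrow> rat fps" where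
  "deriv_term F x k n =
    (if n k = 0 then 0 else cycle_index_term (partial_deriv k F) x (n(k := n k - 1)))"

lemma deriv_term_eq:
  assumes F: "is_species F"
  shows "deriv_term F x k n = fps_const (1 / (\<Prod>i\<in>UNIV. fact (n i))) *
    (\<Sum>\<sigma>\<in>relabelings n. of_nat (num_fixed F n \<sigma>) *
        (\<Sum>a | a \<in> {1..n k} \<and> \<sigma> k a = a. monomial_without n x \<sigma> k a))"
proof (cases "n k = 0")
  case False
  define n' where "n' = n(k := n k - 1)"
  have n: "inc k n' = n" using False by (simp add: n'_def)
  from False cycle_index_term_partial_deriv[OF F, of n' k x] show ?thesis
    unfolding n deriv_term_def n'_def[symmetric] by simp
qed (simp add: deriv_term_def)

lemma fps_Sum_deriv_term: "fps_Sum (deriv_term F x k) = cycle_index_eval (partial_deriv k F) x"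
  unfolding cycle_index_eval_def
proof (rule fps_Sum_reindex[where g = "inc k"])
  show "inj (inc k)" by (intro injI) (auto simp: fun_eq_iff split: if_splits; metis)
  show "deriv_term F x k (inc k n) = cycle_index_term (partial_deriv k F) x n" for n
    by (simp add: deriv_term_def)
  fix n assume n: "n \<notin> range (inc k)"
  have "n k = 0"
  proof (rule ccontr)
    assume "n k \<noteq> 0"
    then have "n = inc k (n(k := n k - 1))" by simp
    then show False using n by blast
  qed
  then show "deriv_term F x k n = 0" by (simp add: deriv_term_def)
qed

lemma deriv_term_locally_finite:
  assumes "locally_finite (cycle_index_term (partial_deriv k F) x)"
  shows "locally_finite (deriv_term F x k)"
  unfolding locally_finite_def
proof
  fix l
  have "{n. fps_nth (deriv_term F x k n) l \<noteq> 0} \<subseteq>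
    inc k ` {n. fps_nth (cycle_index_term (partial_deriv k F) x n) l \<noteq> 0}"
  proof
    fix n assume n: "n \<in> {n. fps_nth (deriv_term F x k n) l \<noteq> 0}"
    then have "n k \<noteq> 0" by (auto simp: deriv_term_def split: if_splits)
    then have "n = inc k (n(k := n k - 1))" by simp
    moreover have "n(k := n k - 1) \<in> {n. fps_nth (cycle_index_term (partial_deriv k F) x n) l \<noteq> 0}"
      using n \<open>n k \<noteq> 0\<close> by (simp add: deriv_term_def)
    ultimately show "n \<in> inc k ` {n. fps_nth (cycle_index_term (partial_deriv k F) x n) l \<noteq> 0}" by (rule image_eqI)
  qed
  then show "finite {n. fps_nth (deriv_term F x k n) l \<noteq> 0}"
    using assms unfolding locally_finite_def by (meson finite_imageI finite_subset)
qed

lemma fps_nth_mult_Sum: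
  assumes "finite A" "\<And>l. l \<le> j \<Longrightarrow> {a. fps_nth (f a) l \<noteq> 0} \<subseteq> A"
  shows "fps_nth (g * fps_Sum f) j = fps_nth (g * (\<Sum>a\<in>A. f a)) j"
  unfolding fps_mult_nth using fps_nth_Sum[OF assms(1), of f] assms(2)
  by (intro sum.cong) (auto simp: fps_sum_nth)

theorem cycle_index_taylor:
  fixes F :: "('s::finite, 'x) species"
  assumes F: "is_species F"
    and lx: "locally_finite (cycle_index_term F x)" and lt: "locally_finite (cycle_index_term F t)"
    and ld: "\<And>k. locally_finite (cycle_index_term (partial_deriv k F) x)"
    and xt: "\<And>i j. 0 < j \<Longrightarrow> fps_X ^ p dvd x i j - t i j"
    and xt2: "\<And>i j. 1 < j \<Longrightarrow> fps_X ^ (2 * p) dvd x i j - t i j"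
  shows "fps_X ^ (2 * p) dvd cycle_index_eval F x - cycle_index_eval F t -
    (\<Sum>k\<in>UNIV. (x k 1 - t k 1) * cycle_index_eval (partial_deriv k F) x)"
  unfolding fps_X_power_dvd_iff
proof (intro allI impI)
  fix j assume j: "j < 2 * p"
  \<comment> \<open>A finite set that carries all coefficients up to order \<open>j\<close> of all
    the sums; lower orders are included because of the products with
    \<open>x k 1 - t k 1\<close>.\<close>
  let ?A = "\<Union>l\<in>{..j}. {n. fps_nth (cycle_index_term F x n) l \<noteq> 0} \<union> {n. fps_nth (cycle_index_term F t n) l \<noteq> 0} \<union>
    (\<Union>k\<in>UNIV. {n. fps_nth (deriv_term F x k n) l \<noteq> 0})"
  let ?r = "\<lambda>n. cycle_index_term F x n - cycle_index_term F t n - (\<Sum>k\<in>UNIV. (x k 1 - t k 1) * deriv_term F x k n)"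
  have A: "finite ?A"
    using lx lt deriv_term_locally_finite[OF ld] by (auto simp: locally_finite_def)
  have r: "fps_X ^ (2 * p) dvd ?r n" for n
  proof -
    let ?M = "\<lambda>\<sigma>. cycle_monomial n x \<sigma> - cycle_monomial n t \<sigma> -
      (\<Sum>k\<in>UNIV. (x k 1 - t k 1) * (\<Sum>a | a \<in> {1..n k} \<and> \<sigma> k a = a. monomial_without n x \<sigma> k a))"
    let ?c = "fps_const (1 / (\<Prod>i\<in>UNIV. fact (n i))) :: rat fps"
    let ?D = "\<lambda>\<sigma> k. \<Sum>a | a \<in> {1..n k} \<and> \<sigma> k a = a. monomial_without n x \<sigma> k a"
    have "(\<Sum>k\<in>UNIV. (x k 1 - t k 1) * deriv_term F x k n)
      = (\<Sum>k\<in>UNIV. \<Sum>\<sigma>\<in>relabelings n. ?c * (of_nat (num_fixed F n \<sigma>) * ((x k 1 - t k 1) * ?D \<sigma> k)))"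
      unfolding deriv_term_eq[OF F] sum_distrib_left by (intro sum.cong refl) (simp add: mult_ac)
    also have "\<dots> = (\<Sum>\<sigma>\<in>relabelings n. \<Sum>k\<in>UNIV. ?c * (of_nat (num_fixed F n \<sigma>) * ((x k 1 - t k 1) * ?D \<sigma> k)))"
      by (rule sum.swap)
    finally have "?r n = (\<Sum>\<sigma>\<in>relabelings n. ?c * (of_nat (num_fixed F n \<sigma>) * ?M \<sigma>))"
      unfolding cycle_index_term_monomial
      by (simp add: sum_distrib_left sum_subtractf right_diff_distrib)
    also have "fps_X ^ (2 * p) dvd \<dots>"
      using cycle_monomial_taylor[OF _ xt xt2] by (intro dvd_sum dvd_mult)
    finally show ?thesis .
  qed
  have "fps_nth (cycle_index_eval F x) j = fps_nth (\<Sum>n\<in>?A. cycle_index_term F x n) j"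
    unfolding cycle_index_eval_def fps_sum_nth by (rule fps_nth_Sum[OF A]) auto
  moreover have "fps_nth (cycle_index_eval F t) j = fps_nth (\<Sum>n\<in>?A. cycle_index_term F t n) j"
    unfolding cycle_index_eval_def fps_sum_nth by (rule fps_nth_Sum[OF A]) auto
  moreover have "fps_nth ((x k 1 - t k 1) * cycle_index_eval (partial_deriv k F) x) j
    = fps_nth ((x k 1 - t k 1) * (\<Sum>n\<in>?A. deriv_term F x k n)) j" for k
    unfolding fps_Sum_deriv_term[symmetric] by (rule fps_nth_mult_Sum[OF A]) auto
  ultimately have "fps_nth (cycle_index_eval F x - cycle_index_eval F t -
      (\<Sum>k\<in>UNIV. (x k 1 - t k 1) * cycle_index_eval (partial_deriv k F) x)) j
    = fps_nth ((\<Sum>n\<in>?A. cycle_index_term F x n) - (\<Sum>n\<in>?A. cycle_index_term F t n) -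
      (\<Sum>k\<in>UNIV. (x k 1 - t k 1) * (\<Sum>n\<in>?A. deriv_term F x k n))) j"
    by (simp only: fps_sub_nth fps_sum_nth)
  also have "(\<Sum>n\<in>?A. cycle_index_term F x n) - (\<Sum>n\<in>?A. cycle_index_term F t n) -
      (\<Sum>k\<in>UNIV. (x k 1 - t k 1) * (\<Sum>n\<in>?A. deriv_term F x k n)) = (\<Sum>n\<in>?A. ?r n)"
    unfolding sum_distrib_left sum_subtractf by (subst sum.swap) (rule refl)
  also have "fps_nth \<dots> j = (\<Sum>n\<in>?A. fps_nth (?r n) j)" by (rule fps_sum_nth)
  also have "\<dots> = 0"
    using r j unfolding fps_X_power_dvd_iff by (intro sum.neutral ballI) blast
  finally show "fps_nth (cycle_index_eval F x - cycle_index_eval F t -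
      (\<Sum>k\<in>UNIV. (x k 1 - t k 1) * cycle_index_eval (partial_deriv k F) x)) j = 0" .
qed

section \<open>Constant terms\<close>

lemma fps_nth_prod_0: "fps_nth (\<Prod>a\<in>A. f a) 0 = (\<Prod>a\<in>A. fps_nth (f a) 0)"
  by (induct A rule: infinite_finite_induct) auto

lemma cycle_index_term_nth_0_cong:
  fixes F :: "('s::finite, 'x) species"
  assumes "\<And>i j. n i \<noteq> 0 \<Longrightarrow> 0 < j \<Longrightarrow> fps_nth (x i j) 0 = fps_nth (t i j) 0"
  shows "fps_nth (cycle_index_term F x n) 0 = fps_nth (cycle_index_term F t n) 0"
proof -
  have "fps_nth (cycle_monomial n x \<sigma>) 0 = fps_nth (cycle_monomial n t \<sigma>) 0" if \<sigma>: "\<sigma> \<in> relabelings n" for \<sigma>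
    unfolding cycle_monomial_def fps_nth_prod_0
  proof (intro prod.cong refl)
    fix i C assume C: "C \<in> orbit (\<sigma> i) ` {1..n i}"
    then have "n i \<noteq> 0" by auto
    moreover have "0 < card C" using permutes_orbit_fibre(2)[OF relabelings_permutes[OF \<sigma>] _ C] by simp
    ultimately show "fps_nth (x i (card C)) 0 = fps_nth (t i (card C)) 0" by (rule assms)
  qed
  then show ?thesis unfolding cycle_index_term_monomial by (simp add: fps_sum_nth)
qed

text \<open>At \<open>z = 0\<close> only multidegrees supported in \<open>P\<close> survive, so
  constant terms are compared only in sorts that occur in structures of such multidegrees.\<close>

lemma cycle_index_eval_nth_0_cong:
  fixes F :: "('s::finite, 'x) species"
  assumes x: "\<And>i j. i \<notin> P \<Longrightarrow> 0 < j \<Longrightarrow> fps_X ^ j dvd x i j"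
    and t: "\<And>i j. i \<notin> P \<Longrightarrow> 0 < j \<Longrightarrow> fps_X ^ j dvd t i j"
    and xt: "\<And>n i j. structs F (std n) \<noteq> {} \<Longrightarrow> (\<And>i. i \<notin> P \<Longrightarrow> n i = 0) \<Longrightarrow> n i \<noteq> 0 \<Longrightarrow> 0 < j \<Longrightarrow>
      fps_nth (x i j) 0 = fps_nth (t i j) 0"
  shows "fps_nth (cycle_index_eval F x) 0 = fps_nth (cycle_index_eval F t) 0"
proof -
  have "fps_nth (cycle_index_term F x n) 0 = fps_nth (cycle_index_term F t n) 0" for n
  proof (cases "structs F (std n) \<noteq> {} \<and> (\<forall>i. i \<notin> P \<longrightarrow> n i = 0)")
    case True
    then show ?thesis by (intro cycle_index_term_nth_0_cong xt) auto
  next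
    case False
    then have "structs F (std n) \<noteq> {} \<Longrightarrow> \<not> (\<Sum>i\<in>-P. n i) \<le> 0" by auto
    then show ?thesis
      using cycle_index_term_nth_nonzero[where P = P and x = x and F = F and n = n and k = 0, OF x]
        cycle_index_term_nth_nonzero[where P = P and x = t and F = F and n = n and k = 0, OF t] by metis
  qed
  then show ?thesis by (simp add: cycle_index_eval_def fps_Sum_def)
qed

lemma cycle_index_eval_nth_0_nonzero:
  fixes F :: "('s::finite, 'x) species"
  assumes x: "\<And>i j. i \<notin> P \<Longrightarrow> 0 < j \<Longrightarrow> fps_X ^ j dvd x i j"
    and nz: "fps_nth (cycle_index_eval F x) 0 \<noteq> 0"
  obtains n where "structs F (std n) \<noteq> {}" "\<And>i. i \<notin> P \<Longrightarrow> n i = 0"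
proof -
  have "\<exists>n. fps_nth (cycle_index_term F x n) 0 \<noteq> 0"
  proof (rule ccontr)
    assume "\<nexists>n. fps_nth (cycle_index_term F x n) 0 \<noteq> 0"
    then show False using nz by (simp add: cycle_index_eval_def fps_Sum_def)
  qed
  then obtain n where n: "fps_nth (cycle_index_term F x n) 0 \<noteq> 0" by blast
  show thesis
    by (rule that[of n]) (use cycle_index_term_nth_nonzero[where P = P and x = x, OF x n] in auto)
qed

section \<open>Exponential series as specialised cycle indices\<close>

definition linear_subst :: "('s \<Rightarrow> rat fps) \<Rightarrow> 's \<Rightarrow> nat \<Rightarrow> rat fps" where
  "linear_subst Y i j = (if j = 1 then Y i else 0)"

text \<open>Every permutation other than the identity has a cycle of length above one, whose
  variable is set to zero.\<close>

lemma cycle_monomial_linear: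
  assumes \<sigma>: "\<sigma> \<in> relabelings n"
  shows "cycle_monomial n (linear_subst Y) \<sigma> = (if \<sigma> = (\<lambda>i. id) then \<Prod>i\<in>UNIV. Y i ^ n i else 0)"
proof (cases "\<sigma> = (\<lambda>i. id)")
  case True
  have "orbit id a = {a}" for a :: nat by (simp add: orbit_eq_singleton_iff)
  then have o: "orbit id ` {1..n i} = (\<lambda>a. {a}) ` {1..n i}" for i by auto
  have "(\<Prod>C\<in>orbit id ` {1..n i}. linear_subst Y i (card C)) = Y i ^ n i" for i
    unfolding o by (subst prod.reindex) (auto simp: inj_on_def linear_subst_def)
  then show ?thesis using True by (simp add: cycle_monomial_def)
next
  case False
  then obtain i a where ia: "\<sigma> i a \<noteq> a" by (auto simp: fun_eq_iff)
  note p = relabelings_permutes[OF \<sigma>, of i]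
  have a: "a \<in> {1..n i}" using ia p by (auto simp: permutes_def)
  then have "card (orbit (\<sigma> i) a) \<noteq> 1"
    using ia permutes_self_in_orbit[OF p finite_atLeastAtMost, of a] orbit_eq_singleton_iff[of "\<sigma> i" a]
    by (metis card_1_singletonE singletonD)
  then have "(\<Prod>C\<in>orbit (\<sigma> i) ` {1..n i}. linear_subst Y i (card C)) = 0"
    using a by (intro prod_zero) (auto simp: linear_subst_def)
  then have "cycle_monomial n (linear_subst Y) \<sigma> = 0"
    unfolding cycle_monomial_def by (intro prod_zero) auto
  then show ?thesis using False by simp
qed

text \<open>Only the identity survives the substitution, and it fixes all structures. The premise is
  the identity law alone, so that the lemma also covers derivatives, by
  \<open>partial_deriv_transport_id\<close>.\<close>

lemma series_term_egf:
  fixes F :: "('s::finite, 'x) species"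
  assumes id: "\<And>x. x \<in> structs F (std n) \<Longrightarrow> transport F (std n) (\<lambda>i. id) x = x"
  shows "series_term (egf F) Y n = cycle_index_term F (linear_subst Y) n"
proof -
  have "(\<Sum>\<sigma>\<in>relabelings n. of_nat (num_fixed F n \<sigma>) * cycle_monomial n (linear_subst Y) \<sigma>)
    = (\<Sum>\<sigma>\<in>{\<lambda>i. id}. of_nat (num_fixed F n \<sigma>) * cycle_monomial n (linear_subst Y) \<sigma>)"
    using cycle_monomial_linear[of _ n Y]
    by (intro sum.mono_neutral_right) (auto simp: finite_relabelings relabelings_id)
  also have "\<dots> = of_nat (num_fixed F n (\<lambda>i. id)) * cycle_monomial n (linear_subst Y) (\<lambda>i. id)"
    by (simp only: sum.insert sum.empty finite.emptyI empty_iff not_False_eq_True add_0_right)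
  also have "\<dots> = of_nat (num_fixed F n (\<lambda>i. id)) * (\<Prod>i\<in>UNIV. Y i ^ n i)"
    using cycle_monomial_linear[OF relabelings_id, of n Y] by simp
  also have "num_fixed F n (\<lambda>i. id) = card (structs F (std n))"
    unfolding num_fixed_def using id by (intro arg_cong[where f = card]) auto
  finally show ?thesis
    unfolding cycle_index_term_monomial series_term_def egf_def
    by (simp add: fps_of_nat[symmetric] mult.assoc[symmetric])
qed

lemma series_deriv_egf:
  fixes F :: "('s::finite, 'x) species"
  assumes F: "is_species F"
  shows "series_deriv k (egf F) = egf (partial_deriv k F)"
proof
  fix n
  have "card (structs F (add_point k (std n))) = card (structs F (std (inc k n)))"
    by (rule card_structs_cong[OF F finite_tuple_add_point finite_tuple_std card_add_point])
  moreover have "(\<Prod>i\<in>UNIV. fact (inc k n i)) = (of_nat (Suc (n k)) * (\<Prod>i\<in>UNIV. fact (n i)) :: rat)"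
  proof -
    have "(\<Prod>i\<in>UNIV. fact (inc k n i)) = (\<Prod>i\<in>UNIV. (if i = k then of_nat (Suc (n k)) else 1) * fact (n i) :: rat)"
      by (intro prod.cong) auto
    then show ?thesis by (simp add: prod.distrib)
  qed
  ultimately show "series_deriv k (egf F) n = egf (partial_deriv k F) n"
    unfolding series_deriv_def egf_def structs_partial_deriv by (simp del: of_nat_Suc)
qed

lemma partial_deriv_transport_id:
  assumes F: "is_species F" and x: "x \<in> structs (partial_deriv k F) (std n)"
  shows "transport (partial_deriv k F) (std n) (\<lambda>i. id) x = x"
  using x unfolding partial_deriv_def
  by (auto intro!: transport_id[OF F finite_tuple_add_point] split: nat.split)

section \<open>Linear systems with a nilpotent constant term\<close>

text \<open>Justifies induction in which a coordinate comes after all those it depends on.\<close>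

lemma acyclic_wf_converse:
  assumes "acyclic (E :: ('m::finite \<times> 'm) set)"
  shows "wf (E\<inverse>)"
  using finite_acyclic_wf_converse[OF _ assms] by simp

text \<open>Lexicographic induction on degree and coordinate. The coefficient of order
  \<open>k\<close> of \<open>J i j * x j\<close> involves coefficients of \<open>x j\<close> of
  smaller order, except through the constant term of \<open>J i j\<close>, and that one is zero
  unless \<open>j\<close> precedes \<open>i\<close> in the induction.\<close>

lemma linear_fixpoint_dvd:
  fixes x r :: "'m::finite \<Rightarrow> rat fps"
  assumes E: "acyclic E" and J: "\<And>i j. fps_nth (J i j) 0 \<noteq> 0 \<Longrightarrow> (i, j) \<in> E"
    and x: "\<And>i. x i = r i + (\<Sum>j\<in>UNIV. J i j * x j)" and r: "\<And>i. fps_X ^ q dvd r i"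
  shows "fps_X ^ q dvd x i"
proof -
  have "fps_nth (x i) k = 0" if "k < q" for k i
    using that
  proof (induction k arbitrary: i rule: less_induct)
    case (less k)
    show ?case
    proof (induction i rule: wf_induct_rule[OF acyclic_wf_converse[OF E]])
      case (1 i)
      have "fps_nth (J i j * x j) k = 0" for j
        unfolding fps_mult_nth
      proof (intro sum.neutral ballI)
        fix l assume "l \<in> {0..k}"
        show "fps_nth (J i j) l * fps_nth (x j) (k - l) = 0"
        proof (cases "l = 0")
          case True
          then show ?thesis using J[of i j] 1[of j] by auto
        next
          case False
          then have "fps_nth (x j) (k - l) = 0" using less \<open>l \<in> {0..k}\<close> by auto
          then show ?thesis by simp
        qed
      qed
      moreover have "fps_nth (r i) k = 0" using r less.prems by (simp add: fps_X_power_dvd_iff)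
      ultimately show ?case by (subst x) (simp add: fps_sum_nth)
    qed
  qed
  then show ?thesis by (simp add: fps_X_power_dvd_iff)
qed

text \<open>The order behind \<open>linear_fixpoint_dvd\<close>, now used for a recursive definition
  of the coefficients.\<close>

lemma ex_linear_fixpoint:
  fixes b :: "'m::finite \<Rightarrow> rat fps"
  assumes E: "acyclic E" and J: "\<And>i j. fps_nth (J i j) 0 \<noteq> 0 \<Longrightarrow> (i, j) \<in> E"
  shows "\<exists>x. \<forall>i. x i = b i + (\<Sum>j\<in>UNIV. J i j * x j)"
proof -
  let ?R = "less_than <*lex*> E\<inverse>"
  define G where "G f = (\<lambda>(k, i). fps_nth (b i) k + (\<Sum>j\<in>UNIV. \<Sum>l=0..k. fps_nth (J i j) l * f (k - l, j)))"
    for f :: "nat \<times> 'm \<Rightarrow> rat"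
  define c where "c = wfrec ?R G"
  have wf: "wf ?R" using acyclic_wf_converse[OF E] by (intro wf_lex_prod) auto
  have c: "c (k, i) = fps_nth (b i) k + (\<Sum>j\<in>UNIV. \<Sum>l=0..k. fps_nth (J i j) l * c (k - l, j))" for k i
  proof -
    have "c (k, i) = G (cut c ?R (k, i)) (k, i)" unfolding c_def by (rule wfrec[OF wf])
    also have "\<dots> = fps_nth (b i) k + (\<Sum>j\<in>UNIV. \<Sum>l=0..k. fps_nth (J i j) l * cut c ?R (k, i) (k - l, j))"
      by (simp add: G_def)
    also have "(\<Sum>j\<in>UNIV. \<Sum>l=0..k. fps_nth (J i j) l * cut c ?R (k, i) (k - l, j))
      = (\<Sum>j\<in>UNIV. \<Sum>l=0..k. fps_nth (J i j) l * c (k - l, j))"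
    proof (intro sum.cong refl)
      fix j l assume "l \<in> {0..k}"
      \<comment> \<open>\<open>cut\<close> discards only calls that are not smaller; such a call has
        \<open>l = 0\<close> and no edge from \<open>i\<close> to \<open>j\<close>, so its
        coefficient vanishes.\<close>
      show "fps_nth (J i j) l * cut c ?R (k, i) (k - l, j) = fps_nth (J i j) l * c (k - l, j)"
        using J[of i j] \<open>l \<in> {0..k}\<close> by (cases "l = 0") (auto simp: cut_def)
    qed
    finally show ?thesis .
  qed
  have "\<forall>i. Abs_fps (\<lambda>k. c (k, i)) = b i + (\<Sum>j\<in>UNIV. J i j * Abs_fps (\<lambda>k. c (k, j)))"
    by (auto simp: fps_eq_iff fps_sum_nth fps_mult_nth intro: c)
  then show ?thesis by (rule exI[of _ "\<lambda>i. Abs_fps (\<lambda>k. c (k, i))"])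
qed

text \<open>The columns of a right inverse \<open>B\<close> solve fixpoint equations. Uniqueness of
  their solutions, in the form that \<open>(mat 1 - J) ** C = 0\<close> forces \<open>C = 0\<close>,
  is applied to \<open>C = B ** (mat 1 - J) - mat 1\<close> and makes \<open>B\<close> a two-sided
  inverse.\<close>

lemma invertible_mat_1_minus:
  fixes J :: "rat fps ^ 'm::finite ^ 'm"
  assumes E: "acyclic E" and J: "\<And>i j. fps_nth (J $ i $ j) 0 \<noteq> 0 \<Longrightarrow> (i, j) \<in> E"
  shows "invertible (mat 1 - J)"
proof -
  let ?M = "mat 1 - J"
  have mult: "(?M ** C) $ i $ j = C $ i $ j - (\<Sum>k\<in>UNIV. J $ i $ k * C $ k $ j)" for C i j
  proof -
    have "(?M ** C) $ i $ j = (\<Sum>k\<in>UNIV. (if i = k then C $ k $ j else 0) - J $ i $ k * C $ k $ j)"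
      by (simp add: matrix_matrix_mult_def mat_def) (rule sum.cong, auto simp: left_diff_distrib)
    then show ?thesis by (simp add: sum_subtractf)
  qed
  have "\<exists>x. \<forall>i. x i = mat 1 $ i $ j + (\<Sum>k\<in>UNIV. J $ i $ k * x k)" for j
    by (rule ex_linear_fixpoint[OF E]) (rule J)
  then obtain x where x: "\<And>i j. x j i = mat 1 $ i $ j + (\<Sum>k\<in>UNIV. J $ i $ k * x j k)" by metis
  define B where "B = (\<chi> i j. x j i)"
  have MB: "?M ** B = mat 1"
    unfolding vec_eq_iff mult
  proof (intro allI)
    fix i j
    show "B $ i $ j - (\<Sum>k\<in>UNIV. J $ i $ k * B $ k $ j) = mat 1 $ i $ j"
      using x[of j i] by (simp add: B_def)
  qed
  have "C = 0" if "?M ** C = 0" for C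
  proof -
    have "fps_X ^ q dvd C $ i $ j" for i j q
    proof (rule linear_fixpoint_dvd[OF E, where J = "\<lambda>i j. J $ i $ j" and r = "\<lambda>_. 0"])
      show "C $ i $ j = 0 + (\<Sum>k\<in>UNIV. J $ i $ k * C $ k $ j)" for i
        using mult[of C i j] that by simp
    qed (auto intro: J)
    then have "fps_nth (C $ i $ j) k = 0" for i j k
      using fps_X_power_dvd_iff[of "Suc k" "C $ i $ j"] by blast
    then show ?thesis by (simp add: vec_eq_iff fps_eq_iff)
  qed
  moreover have "?M ** (B ** ?M - mat 1) = 0"
  proof -
    have "A ** (X - Z) = A ** X - A ** Z" for A X Z :: "rat fps ^ 'm ^ 'm"
      by (simp add: vec_eq_iff matrix_matrix_mult_def right_diff_distrib sum_subtractf)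
    then have "?M ** (B ** ?M - mat 1) = ?M ** (B ** ?M) - ?M" by (simp only: matrix_mul_rid)
    also have "?M ** (B ** ?M) = ?M" using MB by (simp add: matrix_mul_assoc)
    finally show ?thesis by simp
  qed
  ultimately have "B ** ?M = mat 1" by (metis eq_iff_diff_eq_0)
  then show ?thesis using MB unfolding invertible_def by blast
qed

text \<open>Multiplying by \<open>mat 1 - J\<close> presents the Newton step as the solution of a
  fixpoint equation; later arguments use this equation in place of the inverse.\<close>

lemma matrix_inv_newton_step:
  fixes J :: "rat fps ^ 'm::finite ^ 'm"
  assumes "invertible (mat 1 - J)"
  shows "(Y + matrix_inv (mat 1 - J) *v (V - Y)) $ i =
    V $ i + (\<Sum>j\<in>UNIV. J $ i $ j * ((Y + matrix_inv (mat 1 - J) *v (V - Y)) $ j - Y $ j))"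
proof -
  let ?M = "mat 1 - J"
  define D where "D = matrix_inv ?M *v (V - Y)"
  have "\<exists>A'. ?M ** A' = mat 1 \<and> A' ** ?M = mat 1" using assms by (simp add: invertible_def)
  from someI_ex[OF this] have "?M ** matrix_inv ?M = mat 1" unfolding matrix_inv_def by blast
  then have "?M *v D = V - Y" by (simp add: D_def matrix_vector_mul_assoc)
  then have "(?M *v D) $ i = V $ i - Y $ i" by simp
  moreover have "(?M *v D) $ i = D $ i - (\<Sum>j\<in>UNIV. J $ i $ j * D $ j)"
  proof -
    have "(?M *v D) $ i = (\<Sum>k\<in>UNIV. (if i = k then D $ k else 0) - J $ i $ k * D $ k)"
      by (simp add: matrix_vector_mult_def mat_def) (rule sum.cong, auto simp: left_diff_distrib)
    then show ?thesis by (simp add: sum_subtractf)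
  qed
  ultimately have "D $ i - (\<Sum>j\<in>UNIV. J $ i $ j * D $ j) = V $ i - Y $ i" by simp
  then have "Y $ i + D $ i = V $ i + (\<Sum>j\<in>UNIV. J $ i $ j * D $ j)" by (simp add: algebra_simps)
  then show ?thesis unfolding D_def[symmetric] by simp
qed

section \<open>Newton iteration\<close>

definition dependency :: "('m \<Rightarrow> ('m option, 'x) species) \<Rightarrow> 'm set \<Rightarrow> ('m \<times> 'm) set" where
  "dependency H P = {(i, j). \<exists>n. structs (H i) (std (inc (Some j) n)) \<noteq> {} \<and> (\<forall>k. k \<notin> Some ` P \<longrightarrow> n k = 0)}"

text \<open>Both substitutions are instances. \<open>closed\<close> says that \<open>P\<close>
  already contains every coordinate with a structure built from sorts of \<open>P\<close> alone.
  \<open>subst_2\<close> expresses that variables belonging to longer cycles are known to twice the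
  precision, and \<open>subst_dvd\<close> that a series without constant term fills a cycle of
  length \<open>j\<close> with order at least \<open>j\<close>.\<close>

locale newton_iteration =
  fixes H :: "'m::finite \<Rightarrow> ('m option, 'x) species" and P :: "'m set" and S :: "rat fps ^ 'm"
    and subst :: "rat fps ^ 'm \<Rightarrow> 'm option \<Rightarrow> nat \<Rightarrow> rat fps"
  assumes H: "\<And>i. is_species (H i)"
    and poly: "\<And>i. polynomial_in (H i) (Some ` P)"
    and closed: "\<And>i n. structs (H i) (std n) \<noteq> {} \<Longrightarrow> (\<And>k. k \<notin> Some ` P \<Longrightarrow> n k = 0) \<Longrightarrow> i \<in> P"
    and acyclic: "acyclic (dependency H P)"
    and subst_1: "\<And>Y i. subst Y i 1 = with_z Y i"
    and subst_dvd: "\<And>Y i j. fps_nth (with_z Y i) 0 = 0 \<Longrightarrow> 0 < j \<Longrightarrow> fps_X ^ j dvd subst Y i j"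
    and subst_0: "\<And>Y Y' i j. 0 < j \<Longrightarrow> fps_nth (Y $ i) 0 = fps_nth (Y' $ i) 0 \<Longrightarrow>
      fps_nth (subst Y (Some i) j) 0 = fps_nth (subst Y' (Some i) j) 0"
    and subst_2: "\<And>p Y Y' i j. agree_upto p Y Y' \<Longrightarrow> 1 < j \<Longrightarrow> fps_X ^ (2 * p) dvd subst Y i j - subst Y' i j"
    and S_fixed: "\<And>i. cycle_index_eval (H i) (subst S) = S $ i"
    and S_adm: "\<And>i. i \<notin> P \<Longrightarrow> fps_nth (S $ i) 0 = 0"
begin

definition jac :: "rat fps ^ 'm \<Rightarrow> rat fps ^ 'm ^ 'm" where
  "jac Y = (\<chi> i j. cycle_index_eval (partial_deriv (Some j) (H i)) (subst Y))"

definition step :: "rat fps ^ 'm \<Rightarrow> rat fps ^ 'm" where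
  "step Y = Y + matrix_inv (mat 1 - jac Y) *v ((\<chi> i. cycle_index_eval (H i) (subst Y)) - Y)"

text \<open>Constant terms occur only in sorts in which the system is polynomial. This is the
  invariant that makes all evaluations locally finite and confines the constant terms of the
  Jacobian to \<open>dependency H P\<close>.\<close>

definition admissible :: "rat fps ^ 'm \<Rightarrow> bool" where
  "admissible Y \<longleftrightarrow> (\<forall>i. i \<notin> P \<longrightarrow> fps_nth (Y $ i) 0 = 0)"

abbreviation "E \<equiv> dependency H P"

lemma admissible_dvd:
  assumes "admissible Y" "k \<notin> Some ` P" "0 < j"
  shows "fps_X ^ j dvd subst Y k j"
proof (rule subst_dvd[OF _ assms(3)])
  show "fps_nth (with_z Y k) 0 = 0"
    using assms(1,2) by (cases k) (auto simp: with_z_def admissible_def)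
qed

lemma defined:
  assumes "admissible Y"
  shows "locally_finite (cycle_index_term (H i) (subst Y))"
    and "locally_finite (cycle_index_term (partial_deriv k (H i)) (subst Y))"
  by (rule cycle_index_locally_finite[where P = "Some ` P"];
      simp add: poly admissible_dvd[OF assms] polynomial_in_partial_deriv[OF H])+

lemma jac_dependency:
  assumes "admissible Y" "fps_nth (jac Y $ i $ j) 0 \<noteq> 0"
  shows "(i, j) \<in> E"
proof -
  have "fps_nth (cycle_index_eval (partial_deriv (Some j) (H i)) (subst Y)) 0 \<noteq> 0"
    using assms(2) by (simp add: jac_def)
  then obtain n where "structs (partial_deriv (Some j) (H i)) (std n) \<noteq> {}" "\<And>k. k \<notin> Some ` P \<Longrightarrow> n k = 0"
    using cycle_index_eval_nth_0_nonzero[where P = "Some ` P" and x = "subst Y", OF admissible_dvd[OF assms(1)]]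
    by metis
  then show ?thesis
    using structs_partial_deriv_nonempty[OF H] unfolding dependency_def by blast
qed

lemma step_invertible: "admissible Y \<Longrightarrow> invertible (mat 1 - jac Y)"
  by (rule invertible_mat_1_minus[OF acyclic]) (rule jac_dependency)

lemma step_eq:
  assumes "admissible Y"
  shows "step Y $ i = cycle_index_eval (H i) (subst Y) + (\<Sum>j\<in>UNIV. jac Y $ i $ j * (step Y $ j - Y $ j))"
  using matrix_inv_newton_step[OF step_invertible[OF assms], of Y "\<chi> i. cycle_index_eval (H i) (subst Y)" i]
  by (simp add: step_def)

lemma step_eq_0:
  assumes "admissible Y"
  shows "fps_nth (step Y $ i) 0 = fps_nth (cycle_index_eval (H i) (subst Y)) 0 +
    (\<Sum>j\<in>UNIV. fps_nth (jac Y $ i $ j) 0 * (fps_nth (step Y $ j) 0 - fps_nth (Y $ j) 0))"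
  by (subst step_eq[OF assms]) (simp add: fps_sum_nth)

text \<open>For \<open>i\<close> outside \<open>P\<close>, \<open>closed\<close> removes the
  constant term of the evaluated \<open>H i\<close>, and the coordinates on which \<open>i\<close>
  depends lie outside \<open>P\<close> as well, so that induction along \<open>E\<close> handles the
  correction.\<close>

lemma step_admissible:
  assumes Y: "admissible Y"
  shows "admissible (step Y)"
proof -
  have "i \<notin> P \<longrightarrow> fps_nth (step Y $ i) 0 = 0" for i
  proof (induction i rule: wf_induct_rule[OF acyclic_wf_converse[OF acyclic]])
    case (1 i)
    show ?case
    proof
      assume i: "i \<notin> P"
      have "fps_nth (cycle_index_eval (H i) (subst Y)) 0 = 0"
      proof (rule ccontr)
        assume "fps_nth (cycle_index_eval (H i) (subst Y)) 0 \<noteq> 0"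
        then obtain n where "structs (H i) (std n) \<noteq> {}" "\<And>k. k \<notin> Some ` P \<Longrightarrow> n k = 0"
          using cycle_index_eval_nth_0_nonzero[where P = "Some ` P" and x = "subst Y", OF admissible_dvd[OF Y]] by metis
        then show False using closed i by blast
      qed
      moreover have "fps_nth (jac Y $ i $ j) 0 * (fps_nth (step Y $ j) 0 - fps_nth (Y $ j) 0) = 0" for j
      proof (cases "fps_nth (jac Y $ i $ j) 0 = 0")
        case False
        then have E: "(i, j) \<in> E" by (rule jac_dependency[OF Y])
        then obtain n where n: "structs (H i) (std (inc (Some j) n)) \<noteq> {}" "\<And>k. k \<notin> Some ` P \<Longrightarrow> n k = 0"
          unfolding dependency_def by blast
        \<comment> \<open>If \<open>j\<close> were in \<open>P\<close>, the structure that witnesses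
          the edge would use only sorts of \<open>P\<close>, and \<open>closed\<close> would put
          \<open>i\<close> in \<open>P\<close>.\<close>
        have "j \<notin> P"
        proof
          assume "j \<in> P"
          then have "inc (Some j) n k = 0" if "k \<notin> Some ` P" for k using n(2)[OF that] that by auto
          then show False using closed[OF n(1)] i by blast
        qed
        then show ?thesis using 1[of j] E Y by (simp add: admissible_def)
      qed simp
      then have "(\<Sum>j\<in>UNIV. fps_nth (jac Y $ i $ j) 0 * (fps_nth (step Y $ j) 0 - fps_nth (Y $ j) 0)) = 0"
        by (intro sum.neutral ballI)
      ultimately show "fps_nth (step Y $ i) 0 = 0" by (subst step_eq_0[OF Y]) simp
    qed
  qed
  then show ?thesis by (simp add: admissible_def)
qed

lemma iterate_admissible: "admissible ((step ^^ n) 0)"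
  by (induct n) (simp_all add: step_admissible, simp add: admissible_def)

lemma eval_nth_0_cong:
  assumes "admissible Y" "admissible Y'" "\<And>j. (i, j) \<in> E \<Longrightarrow> fps_nth (Y $ j) 0 = fps_nth (Y' $ j) 0"
  shows "fps_nth (cycle_index_eval (H i) (subst Y)) 0 = fps_nth (cycle_index_eval (H i) (subst Y')) 0"
proof (rule cycle_index_eval_nth_0_cong[where P = "Some ` P"])
  fix n and k :: "'m option" and j :: nat
  assume n: "structs (H i) (std n) \<noteq> {}" "\<And>k. k \<notin> Some ` P \<Longrightarrow> n k = 0" "n k \<noteq> 0" "0 < j"
  have "k \<in> Some ` P" using n(2)[of k] n(3) by auto
  then obtain l where k: "k = Some l" by blast
  have "inc (Some l) (n(Some l := n (Some l) - 1)) = n" using n(3) k by auto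
  moreover have "(n(Some l := n (Some l) - 1)) k = 0" if "k \<notin> Some ` P" for k using n(2)[OF that] by auto
  ultimately have "(i, l) \<in> E"
    using n(1) unfolding dependency_def by (auto intro!: exI[of _ "n(Some l := n (Some l) - 1)"])
  then show "fps_nth (subst Y k j) 0 = fps_nth (subst Y' k j) 0"
    unfolding k by (intro subst_0 n(4) assms(3))
qed (simp_all add: admissible_dvd assms(1,2))

text \<open>Once the coordinates on which \<open>i\<close> depends have their final constant terms,
  the Newton correction in coordinate \<open>i\<close> vanishes at \<open>z = 0\<close>, because it
  multiplies differences of two equal values. The step then reduces to evaluating
  \<open>H i\<close>, which reproduces the constant term of the fixed point
  \<open>S\<close>.\<close>

lemma constant_terms: "\<exists>N. \<forall>n\<ge>N. fps_nth ((step ^^ n) 0 $ i) 0 = fps_nth (S $ i) 0"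
proof (induction i rule: wf_induct_rule[OF acyclic_wf_converse[OF acyclic]])
  case (1 i)
  let ?Y = "\<lambda>n. (step ^^ n) 0"
  have "\<forall>j. \<exists>N. (i, j) \<in> E \<longrightarrow> (\<forall>n\<ge>N. fps_nth (?Y n $ j) 0 = fps_nth (S $ j) 0)" using 1 by blast
  then obtain N where N: "\<And>j n. (i, j) \<in> E \<Longrightarrow> N j \<le> n \<Longrightarrow> fps_nth (?Y n $ j) 0 = fps_nth (S $ j) 0" by metis
  define M where "M = Max (range N)"
  have M: "N j \<le> M" for j by (simp add: M_def)
  have Ma: "fps_nth (?Y n $ j) 0 = fps_nth (S $ j) 0" if "(i, j) \<in> E" "M \<le> n" for j n
    using N[OF that(1)] M[of j] that(2) by simp
  have "fps_nth (?Y (Suc n) $ i) 0 = fps_nth (S $ i) 0" if n: "M \<le> n" for n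
  proof -
    note adm = iterate_admissible[of n]
    have "fps_nth (jac (?Y n) $ i $ j) 0 * (fps_nth (step (?Y n) $ j) 0 - fps_nth (?Y n $ j) 0) = 0" for j
    proof (cases "fps_nth (jac (?Y n) $ i $ j) 0 = 0")
      case False
      then have "(i, j) \<in> E" by (rule jac_dependency[OF adm])
      from Ma[OF this n] Ma[OF this le_SucI[OF n]] show ?thesis by simp
    qed simp
    then have "(\<Sum>j\<in>UNIV. fps_nth (jac (?Y n) $ i $ j) 0 *
        (fps_nth (step (?Y n) $ j) 0 - fps_nth (?Y n $ j) 0)) = 0"
      by (intro sum.neutral ballI)
    then have "fps_nth (?Y (Suc n) $ i) 0 = fps_nth (cycle_index_eval (H i) (subst (?Y n))) 0"
      using step_eq_0[OF adm, of i] by simp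
    also have "\<dots> = fps_nth (cycle_index_eval (H i) (subst S)) 0"
      by (rule eval_nth_0_cong[OF adm]) (use S_adm Ma n in \<open>auto simp: admissible_def\<close>)
    finally show ?thesis by (simp add: S_fixed)
  qed
  then have "\<forall>n\<ge>Suc M. fps_nth (?Y n $ i) 0 = fps_nth (S $ i) 0"
    by (metis Suc_le_D Suc_le_mono)
  then show ?case by blast
qed

lemma agree_upto_dvd: "agree_upto p Y Y' \<longleftrightarrow> (\<forall>i. fps_X ^ p dvd Y $ i - Y' $ i)"
  by (auto simp: agree_upto_def fps_X_power_dvd_iff)

text \<open>The error \<open>step Y - S\<close> satisfies a fixpoint equation with the Jacobian at
  \<open>Y\<close>, whose inhomogeneous part is the Taylor remainder \<open>?r\<close>;
  \<open>linear_fixpoint_dvd\<close> passes the divisibility of the remainder on to the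
  error.\<close>

lemma step_doubles:
  assumes Y: "admissible Y" and agree: "agree_upto p Y S"
  shows "agree_upto (2 * p) (step Y) S"
proof -
  have S: "admissible S" using S_adm by (simp add: admissible_def)
  let ?r = "\<lambda>i. cycle_index_eval (H i) (subst Y) - S $ i - (\<Sum>j\<in>UNIV. (Y $ j - S $ j) * jac Y $ i $ j)"
  have r: "fps_X ^ (2 * p) dvd ?r i" for i
  proof -
    have "fps_X ^ (2 * p) dvd cycle_index_eval (H i) (subst Y) - cycle_index_eval (H i) (subst S) -
      (\<Sum>k\<in>UNIV. (subst Y k 1 - subst S k 1) * cycle_index_eval (partial_deriv k (H i)) (subst Y))"
    proof (rule cycle_index_taylor[OF H defined(1)[OF Y] defined(1)[OF S] defined(2)[OF Y]])
      show 2: "fps_X ^ (2 * p) dvd subst Y k j - subst S k j" if "1 < j" for k j by (rule subst_2[OF agree that])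
      show "fps_X ^ p dvd subst Y k j - subst S k j" if "0 < j" for k j
      proof (cases "j = 1")
        case True
        have "fps_X ^ p dvd with_z Y k - with_z S k"
          using agree unfolding agree_upto_dvd by (cases k) (simp_all add: with_z_def)
        then show ?thesis unfolding True subst_1 .
      next
        case False
        then have "fps_X ^ (2 * p) dvd subst Y k j - subst S k j" using that by (intro 2) simp
        moreover have "fps_X ^ p dvd (fps_X :: rat fps) ^ (2 * p)" by (rule le_imp_power_dvd) simp
        ultimately show ?thesis by (rule dvd_trans[rotated])
      qed
    qed
    \<comment> \<open>The sort of \<open>z\<close> drops out: \<open>z\<close> itself is substituted
      there in both cases.\<close>
    moreover have "(\<Sum>k\<in>UNIV. (subst Y k 1 - subst S k 1) * cycle_index_eval (partial_deriv k (H i)) (subst Y))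
      = (\<Sum>j\<in>UNIV. (Y $ j - S $ j) * jac Y $ i $ j)"
      unfolding UNIV_option_conv subst_1
      by (simp add: sum.reindex with_z_def jac_def)
    ultimately show ?thesis by (simp add: S_fixed)
  qed
  have "fps_X ^ (2 * p) dvd (step Y $ i - S $ i)" for i
  proof (rule linear_fixpoint_dvd[OF acyclic, where J = "\<lambda>i j. jac Y $ i $ j" and x = "\<lambda>i. step Y $ i - S $ i" and r = ?r])
    show "step Y $ i - S $ i = ?r i + (\<Sum>j\<in>UNIV. jac Y $ i $ j * (step Y $ j - S $ j))" for i
    proof -
      have "(\<Sum>j\<in>UNIV. jac Y $ i $ j * (step Y $ j - S $ j)) =
        (\<Sum>j\<in>UNIV. jac Y $ i $ j * (step Y $ j - Y $ j)) + (\<Sum>j\<in>UNIV. (Y $ j - S $ j) * jac Y $ i $ j)"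
        by (simp add: sum.distrib[symmetric] algebra_simps)
      then show ?thesis using step_eq[OF Y, of i] by simp
    qed
  qed (use jac_dependency[OF Y] r in auto)
  then show ?thesis by (simp add: agree_upto_dvd)
qed

theorem newton_converges:
  "(\<forall>n i. locally_finite (cycle_index_term (H i) (subst ((step ^^ n) 0)))) \<and>
   (\<forall>n i k. locally_finite (cycle_index_term (partial_deriv k (H i)) (subst ((step ^^ n) 0)))) \<and>
   (\<forall>n. invertible (mat 1 - jac ((step ^^ n) 0))) \<and>
   converges_quadratically (\<lambda>n. (step ^^ n) 0) S"
proof -
  let ?Y = "\<lambda>n. (step ^^ n) 0"
  have dbl: "agree_upto (2 * p) (?Y (Suc n)) S" if "agree_upto p (?Y n) S" for n p
    using step_doubles[OF iterate_admissible that] by simp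
  have mono: "agree_upto p A B" if "agree_upto q A B" "p \<le> q" for p q and A B :: "rat fps ^ 'm"
    using that by (auto simp: agree_upto_def)
  have "\<forall>i. \<exists>N. \<forall>n\<ge>N. fps_nth (?Y n $ i) 0 = fps_nth (S $ i) 0" using constant_terms by blast
  then obtain N where N: "\<And>i n. N i \<le> n \<Longrightarrow> fps_nth (?Y n $ i) 0 = fps_nth (S $ i) 0" by metis
  let ?M = "Max (range N)"
  have start: "agree_upto 1 (?Y n) S" if "?M \<le> n" for n
  proof -
    have "N i \<le> n" for i using that by (metis Max_ge UNIV_I finite finite_imageI image_eqI order_trans)
    then show ?thesis using N by (simp add: agree_upto_def)
  qed
  \<comment> \<open>With one coefficient correct, doubling gains at least one more at every step;
    this weak form already gives convergence.\<close>
  have "agree_upto (Suc k) (?Y n) S" if "?M + k \<le> n" for k n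
    using that
  proof (induction k arbitrary: n)
    case (Suc k)
    then obtain n' where n': "n = Suc n'" by (cases n) auto
    then have "agree_upto (Suc k) (?Y n') S" using Suc by simp
    from mono[OF dbl[OF this], of "Suc (Suc k)"] show ?case by (simp add: n')
  qed (use start in simp)
  then have "\<exists>N. \<forall>n\<ge>N. agree_upto p (?Y n) S" for p using mono[of "Suc p" _ _ p] by (meson le_Suc_eq order_refl)
  then show ?thesis
    unfolding converges_quadratically_def
    using dbl defined[OF iterate_admissible] step_invertible[OF iterate_admissible] by blast
qed

end

section \<open>Structures on the empty set\<close>

lemma empty_structs_recode: "structs (recode F) U = {} \<longleftrightarrow> structs F U = {}"
  by (simp add: structs_recode)

text \<open>Over no labels all blocks are empty, so only sorts with structures on the empty set may
  have outer labels.\<close>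

lemma empty_structs_compose:
  "empty_structs (compose F G) \<noteq> {} \<longleftrightarrow>
    (\<exists>n. structs F (std n) \<noteq> {} \<and> (\<forall>i. n i \<noteq> 0 \<longrightarrow> empty_structs (G i) \<noteq> {}))"
proof -
  have "empty_structs (compose F G) \<noteq> {} \<longleftrightarrow> comp_reps F G (\<lambda>t. {}) \<noteq> {}"
    by (simp add: compose_def empty_structs_recode comp_classes_def)
  also have "\<dots> \<longleftrightarrow> (\<exists>n. structs F (std n) \<noteq> {} \<and> (\<forall>i. n i \<noteq> 0 \<longrightarrow> empty_structs (G i) \<noteq> {}))"
  proof
    assume "comp_reps F G (\<lambda>t. {}) \<noteq> {}"
    then obtain n h B g where r: "(n, h, B, g) \<in> comp_reps F G (\<lambda>t. {})" by auto
    have "empty_structs (G i) \<noteq> {}" if "n i \<noteq> 0" for i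
    proof -
      have a: "1 \<in> std n i" using that by (simp add: std_def)
      have "B i 1 = (\<lambda>t. {})" using comp_reps_block(1)[OF r a] by auto
      then show ?thesis using comp_reps_block(2)[OF r a] by auto
    qed
    moreover have "structs F (std n) \<noteq> {}" using r by (auto simp: comp_reps_def)
    ultimately show "\<exists>n. structs F (std n) \<noteq> {} \<and> (\<forall>i. n i \<noteq> 0 \<longrightarrow> empty_structs (G i) \<noteq> {})" by blast
  next
    assume "\<exists>n. structs F (std n) \<noteq> {} \<and> (\<forall>i. n i \<noteq> 0 \<longrightarrow> empty_structs (G i) \<noteq> {})"
    then obtain n h where h: "h \<in> structs F (std n)" and G: "\<And>i. n i \<noteq> 0 \<Longrightarrow> empty_structs (G i) \<noteq> {}" by blast
    have "(n, h, \<lambda>i a t. {}, \<lambda>i a. SOME x. x \<in> empty_structs (G i)) \<in> comp_reps F G (\<lambda>t. {})"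
      using h some_in_eq[of "empty_structs (G i)" for i] G
      by (auto simp: comp_reps_def std_def disjoint_family_on_def)
    then show "comp_reps F G (\<lambda>t. {}) \<noteq> {}" by blast
  qed
  finally show ?thesis .
qed

lemma species_iso_empty: "F \<simeq>\<^sub>s G \<Longrightarrow> finite_tuple U \<Longrightarrow> structs F U \<noteq> {} \<longleftrightarrow> structs G U \<noteq> {}"
  unfolding species_iso_def by (metis bij_betw_empty1 bij_betw_empty2)

lemma empty_structs_singleton: "empty_structs singleton_species = {}"
  by (simp add: singleton_species_def)

text \<open>Transfers the condition \<open>S(0) = H^m(0, 0)\<close> to the iteration in
  \<open>well_founded_system\<close>: structures built without points remain available when points
  are allowed.\<close>

lemma system_iter_empty_structs:
  assumes "empty_structs (system_iter H (empty_species :: (unit, nat) species) n i) \<noteq> {}"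
  shows "empty_structs (system_iter H singleton_species n i) \<noteq> {}"
  using assms
proof (induction n arbitrary: i)
  case (Suc n)
  let ?e = "empty_species :: (unit, nat) species"
  obtain m where m: "structs (H i) (std m) \<noteq> {}"
    "\<And>s. m s \<noteq> 0 \<Longrightarrow> empty_structs (case_option ?e (system_iter H ?e n) s) \<noteq> {}"
    using Suc.prems by (auto simp: apply_system_def empty_structs_compose)
  have "empty_structs (case_option singleton_species (system_iter H singleton_species n) s) \<noteq> {}" if "m s \<noteq> 0" for s
    using m(2)[OF that] Suc.IH by (cases s) (auto simp: empty_species_def)
  then show ?case using m(1) by (auto simp: apply_system_def empty_structs_compose)
qed (simp add: empty_species_def)

section \<open>Counting types along the iteration\<close>

lemma truncate_species_species:
  assumes F: "is_species (F :: ('s::finite, 'x) species)"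
  shows "is_species (truncate_species p F)"
proof -
  let ?T = "truncate_species p F"
  have sub: "structs ?T U \<subseteq> structs F U" and tr: "transport ?T = transport F" for U
    by (simp_all add: truncate_species_def)
  have in_T: "transport ?T U \<sigma> x \<in> structs ?T V" if "finite_tuple U" "bij_tuple \<sigma> U V" "x \<in> structs ?T U" for U V \<sigma> x
  proof -
    have "card (V i) = card (U i)" for i using that(2) bij_betw_same_card unfolding bij_tuple_def by metis
    then show ?thesis using that transport_in[OF F that(1,2)] by (auto simp: truncate_species_def split: if_splits)
  qed
  have fin: "finite (structs ?T U)" if "finite_tuple U" for U
    using species_finite[OF F that] sub finite_subset by blast
  have cg: "transport ?T U \<sigma> x = transport ?T U \<tau> x"
    if "finite_tuple U" "bij_tuple \<sigma> U V" "\<forall>i. \<forall>a \<in> U i. \<sigma> i a = \<tau> i a" "x \<in> structs ?T U" for U V \<sigma> \<tau> x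
    unfolding tr using that sub by (intro transport_cong[OF F that(1,2)]) auto
  have idl: "transport ?T U (\<lambda>i. id) x = x" if "finite_tuple U" "x \<in> structs ?T U" for U x
    unfolding tr using that sub by (intro transport_id[OF F that(1)]) auto
  have cmp: "transport ?T U (\<lambda>i. \<tau> i \<circ> \<sigma> i) x = transport ?T V \<tau> (transport ?T U \<sigma> x)"
    if "finite_tuple U" "bij_tuple \<sigma> U V" "bij_tuple \<tau> V W" "x \<in> structs ?T U" for U V W \<sigma> \<tau> x
    unfolding tr using that(4) sub by (intro transport_comp[OF F that(1-3), symmetric]) auto
  show ?thesis unfolding is_species_def
    by (intro conjI allI impI ballI) (erule fin | erule (1) idl | erule (2) in_T | erule (3) cg | erule (3) cmp)+
qed

text \<open>Contact of order \<open>p\<close> is enough to compare the numbers of types of size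
  \<open>p\<close>, so convergence of species becomes eventual constancy of these numbers.\<close>

lemma contact_type_count:
  fixes F :: "(unit, 'x) species" and G :: "(unit, 'y) species"
  assumes F: "is_species F" and G: "is_species G" and c: "contact p F G"
  shows "type_count F p = type_count G p"
proof -
  have tr: "ogf (truncate_species p K) (\<lambda>_. p) = ogf K (\<lambda>_. p)" for K :: "(unit, 'z) species"
    by (simp add: ogf_def truncate_species_def UNIV_unit std_def)
  have "ogf F (\<lambda>_. p) = ogf G (\<lambda>_. p)"
    using ogf_iso[OF truncate_species_species[OF F] truncate_species_species[OF G], of p p "\<lambda>_. p"] c
    by (simp add: contact_def tr)
  then show ?thesis by (simp add: ogf_type_count F G)
qed

lemma type_count_nonzero:
  assumes G: "is_species G"
  shows "type_count G k \<noteq> 0 \<longleftrightarrow> structs G (std (\<lambda>_. k)) \<noteq> {}"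
  using species_finite[OF G finite_tuple_std] by (simp add: type_count_def card_eq_0_iff)

lemma type_count_singleton: "type_count singleton_species k = (if k = 1 then 1 else 0)"
  by (simp add: type_count_def singleton_species_def std_def)

lemma type_count_empty: "type_count empty_species k = 0"
  by (simp add: type_count_def empty_species_def)

text \<open>The colours of a given weight are numbered from zero, so a larger count means a larger
  palette. The coloured types of successive stages are thereby nested as sets, although no
  embeddings of species are constructed.\<close>

lemma coloured_mono:
  assumes "\<And>i k. y i k \<le> y' i k"
  shows "coloured F y n p \<subseteq> coloured F y' n p"
proof -
  have "palette (y i) \<subseteq> palette (y' i)" for i
    using assms by (auto simp: palette_def intro: less_le_trans)
  then have "colourings y n \<subseteq> colourings y' n"
    unfolding colourings_def by (intro PiE_mono)
  then show ?thesis by (auto simp: coloured_def)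
qed

lemma colourings_restr: "c \<in> colourings y n \<Longrightarrow> restr n c = c"
  by (auto simp: colourings_def restr_def PiE_iff fun_eq_iff extensional_def)

definition coloured_types :: "('s::finite, 'x) species \<Rightarrow> ('s \<Rightarrow> nat \<Rightarrow> nat) \<Rightarrow> nat \<Rightarrow>
    (('s \<Rightarrow> nat) \<times> ('x \<times> ('s \<Rightarrow> nat \<Rightarrow> nat \<times> nat)) set) set" where
  "coloured_types F y p = (SIGMA n:UNIV. deco_orbit F n ` coloured F y n p)"

lemma coloured_types_mono:
  "(\<And>i k. y i k \<le> y' i k) \<Longrightarrow> coloured_types F y p \<subseteq> coloured_types F y' p"
  unfolding coloured_types_def by (intro Sigma_mono image_mono coloured_mono) auto

section \<open>Growth of the type counts and acyclicity\<close>

locale well_founded_iteration =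
  fixes H :: "'m::finite \<Rightarrow> ('m option, 'x) species"
  assumes H: "\<And>i. is_species (H i)" and wf: "well_founded_system H"
begin

abbreviation "Z \<equiv> system_iter H singleton_species"
abbreviation "args n \<equiv> case_option singleton_species (Z n)"

lemma composable_iter: "composable (H i) (args n)"
  using wf by (simp add: well_founded_system_def)

lemma species_iter: "is_species (Z n i)"
proof (induction n arbitrary: i)
  case (Suc n)
  have "is_species (args n s)" for s
    using Suc singleton_species_species by (cases s) simp_all
  then show ?case using compose_species[OF H _ composable_iter] by (simp add: apply_system_def)
qed (simp add: empty_species_species)

lemma species_args: "is_species (args n s)"
  using species_iter singleton_species_species by (cases s) simp_all

definition y :: "nat \<Rightarrow> 'm option \<Rightarrow> nat \<Rightarrow> nat" where
  "y n s = type_count (args n s)"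

lemma y_None: "y n None k = (if k = 1 then 1 else 0)"
  by (simp add: y_def type_count_singleton)

lemma y_0: "y 0 (Some i) k = 0"
  by (simp add: y_def type_count_empty)

lemma y_Suc: "y (Suc n) (Some i) p = card (coloured_types (H i) (y n) p)"
  and finite_types: "finite (coloured_types (H i) (y n) p)"
proof -
  have "y n = (\<lambda>s. type_count (args n s))" by (simp add: fun_eq_iff y_def)
  note * = ogf_compose[where F = "H i" and G = "args n" and p = p, OF H species_args composable_iter, folded this coloured_types_def]
  show "finite (coloured_types (H i) (y n) p)" by (rule *(2))
  have "is_species (compose (H i) (args n))" by (rule compose_species[OF H species_args composable_iter])
  from ogf_type_count[OF this, of p] *(1) show "y (Suc n) (Some i) p = card (coloured_types (H i) (y n) p)"
    by (simp add: y_def apply_system_def)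
qed

text \<open>By \<open>y_Suc\<close> the counts are cardinalities of nested finite sets.\<close>

lemma y_mono: "n \<le> n' \<Longrightarrow> y n s k \<le> y n' s k"
proof -
  have "y n s k \<le> y (Suc n) s k" for n s k
  proof (induction n arbitrary: s k)
    case 0
    then show ?case by (cases s) (simp_all add: y_0 y_None)
  next
    case (Suc n)
    show ?case
    proof (cases s)
      case (Some i)
      show ?thesis unfolding Some y_Suc[of "Suc n"] y_Suc[of n]
        by (intro card_mono finite_types coloured_types_mono Suc)
    qed (simp add: y_None)
  qed
  then show "n \<le> n' \<Longrightarrow> y n s k \<le> y n' s k" by (rule lift_Suc_mono_le[where f = "\<lambda>n. y n s k"])
qed

lemma ex_limit:
  obtains l where "\<And>p. \<exists>N. \<forall>n\<ge>N. \<forall>i. y n (Some i) p = l i p" "\<And>i. \<exists>p. l i p \<noteq> 0"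
proof -
  obtain L :: "'m \<Rightarrow> (unit, nat) species" where L: "\<And>i. is_species (L i)" "species_limit Z L"
    "\<And>i. \<exists>U. finite_tuple U \<and> structs (L i) U \<noteq> {}"
    using wf by (auto simp: well_founded_system_def)
  have "\<exists>N. \<forall>n\<ge>N. \<forall>i. y n (Some i) p = type_count (L i) p" for p
  proof -
    obtain N where "\<forall>n\<ge>N. \<forall>i. contact p (Z n i) (L i)" using L(2) unfolding species_limit_def by blast
    then have "\<forall>n\<ge>N. \<forall>i. y n (Some i) p = type_count (L i) p"
      using contact_type_count[OF species_iter L(1)] by (simp add: y_def)
    then show ?thesis by blast
  qed
  moreover have "\<exists>p. type_count (L i) p \<noteq> 0" for i
  proof -
    obtain U where U: "finite_tuple U" "structs (L i) U \<noteq> {}" using L(3) by blast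
    have "structs (L i) (std (\<lambda>_. card (U ()))) \<noteq> {}"
      by (rule structs_nonempty_cong[OF L(1) U(1) finite_tuple_std _ U(2)]) (simp add: std_def)
    then show ?thesis using type_count_nonzero[OF L(1)] by blast
  qed
  ultimately show thesis by (rule that)
qed

text \<open>An edge is witnessed by a structure \<open>h\<close> of \<open>H i\<close> with one
  label of sort \<open>Some j\<close> besides labels of sorts in \<open>P\<close>. Giving that label
  a type of size \<open>p\<close> and all others a type of size zero yields a coloured type of
  weight \<open>p\<close>, so coordinate \<open>i\<close> has at least as many types at the next
  stage as coordinate \<open>j\<close> now. The last clause excludes such a coloured type from any
  stage where coordinate \<open>j\<close> has no type of size \<open>p\<close>.\<close>

lemma edge_colouring:
  assumes E: "(i, j) \<in> dependency H P" and P: "\<And>k. k \<in> P \<Longrightarrow> y N (Some k) 0 \<noteq> 0"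
  shows "\<exists>f. inj_on f {..<y N (Some j) p} \<and> f ` {..<y N (Some j) p} \<subseteq> coloured_types (H i) (y N) p \<and>
    (\<forall>M. \<forall>b<y N (Some j) p. f b \<in> coloured_types (H i) (y M) p \<longrightarrow> y M (Some j) p \<noteq> 0)"
proof -
  obtain n where n: "structs (H i) (std (inc (Some j) n)) \<noteq> {}" "\<And>k. k \<notin> Some ` P \<Longrightarrow> n k = 0"
    using E unfolding dependency_def by blast
  let ?n = "inc (Some j) n"
  obtain h where h: "h \<in> structs (H i) (std ?n)" using n(1) by blast
  \<comment> \<open>The distinguished label is label 1 of sort \<open>Some j\<close>;
    \<open>(0, 0)\<close> is the first colour of weight zero, present in the palettes of
    \<open>P\<close> by the assumption on \<open>y N\<close>.\<close>
  define c where "c b s a = (if s = Some j \<and> a = 1 then (p, b) else (0, 0))" for b :: nat and s :: "'m option" and a :: nat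
  have one: "1 \<in> std ?n (Some j)" by (simp add: std_def)
  have c_in: "restr ?n (c b) \<in> colourings (y N) ?n" if b: "b < y N (Some j) p" for b
  proof -
    have "c b s a \<in> palette (y N s)" if a: "a \<in> std ?n s" for s a
    proof (cases "s = Some j \<and> a = 1")
      case True
      then show ?thesis using b by (simp add: c_def palette_def)
    next
      case False
      have "n s \<noteq> 0" using False a by (auto simp: std_def split: if_splits)
      then have "s \<in> Some ` P" using n(2)[of s] by auto
      then obtain k where "s = Some k" "k \<in> P" by blast
      then show ?thesis using False P by (auto simp: c_def palette_def)
    qed
    then show ?thesis by (auto simp: colourings_def restr_def)
  qed
  have w: "weight ?n (restr ?n (c b)) = p" for b
  proof -
    have "(\<Sum>a\<in>std ?n s. fst (restr ?n (c b) s a)) = (if s = Some j then p else 0)" for s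
    proof -
      have "(\<Sum>a\<in>std ?n s. fst (restr ?n (c b) s a)) = (\<Sum>a\<in>std ?n s. if a = 1 then (if s = Some j then p else 0) else 0)"
        by (rule sum.cong) (auto simp: restr_def c_def)
      also have "\<dots> = (if s = Some j then p else 0)" by (simp add: sum.delta std_def)
      finally show ?thesis .
    qed
    then show ?thesis by (simp add: weight_def)
  qed
  let ?f = "\<lambda>b. (?n, deco_orbit (H i) ?n (h, restr ?n (c b)))"
  have "?f ` {..<y N (Some j) p} \<subseteq> coloured_types (H i) (y N) p"
    using c_in w h by (auto simp: coloured_types_def coloured_def)
  moreover have "inj_on ?f {..<y N (Some j) p}"
  proof (rule inj_onI)
    fix b b' assume "?f b = ?f b'"
    then obtain \<sigma> where \<sigma>: "bij_tuple \<sigma> (std ?n) (std ?n)" "\<And>s a. a \<in> std ?n s \<Longrightarrow> c b' s (\<sigma> s a) = c b s a"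
      by (auto simp: deco_orbit_restr_eq_iff[OF H h h])
    \<comment> \<open>For \<open>p = 0\<close> the distinguished colour may coincide with
      \<open>(0, 0)\<close>, so the labels are compared in both directions: what
      \<open>\<sigma>\<close> sends to 1, and where it sends 1.\<close>
    obtain a where a: "a \<in> std ?n (Some j)" "\<sigma> (Some j) a = 1"
      using \<sigma>(1) one unfolding bij_tuple_def bij_betw_def by (metis (no_types, lifting) imageE)
    have "(p, b') = c b (Some j) a" using \<sigma>(2)[OF a(1)] a(2) by (simp add: c_def)
    moreover have "(p, b) = c b' (Some j) (\<sigma> (Some j) 1)" using \<sigma>(2)[OF one] by (simp add: c_def)
    ultimately show "b = b'" by (auto simp: c_def split: if_splits)
  qed
  moreover have "y M (Some j) p \<noteq> 0" if b: "b < y N (Some j) p" and M: "?f b \<in> coloured_types (H i) (y M) p" for M b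
  proof -
    obtain h' c' where h': "h' \<in> structs (H i) (std ?n)" and c': "c' \<in> colourings (y M) ?n"
      and eq: "deco_orbit (H i) ?n (h, restr ?n (c b)) = deco_orbit (H i) ?n (h', c')"
      using M by (auto simp: coloured_types_def coloured_def)
    obtain \<sigma> where \<sigma>: "bij_tuple \<sigma> (std ?n) (std ?n)" "\<And>s a. a \<in> std ?n s \<Longrightarrow> c' s (\<sigma> s a) = c b s a"
      using eq colourings_restr[OF c'] deco_orbit_restr_eq_iff[OF H h h', of "c b" c'] by auto
    have "\<sigma> (Some j) 1 \<in> std ?n (Some j)"
      using \<sigma>(1) one bij_betw_apply unfolding bij_tuple_def by metis
    then have "c' (Some j) (\<sigma> (Some j) 1) \<in> palette (y M (Some j))"
      using c' unfolding colourings_def by (auto simp: PiE_iff)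
    then show ?thesis unfolding \<sigma>(2)[OF one] by (auto simp: c_def palette_def)
  qed
  ultimately show ?thesis by (intro exI[of _ ?f]) blast
qed

text \<open>
  On a strongly connected component all limit counts agree, so every coloured type of \<open>H\<^sub>i\<close> uses a
  colour of the next coordinate: the component can never become nonempty.
\<close>

theorem acyclic_dependency:
  assumes P: "\<And>k. k \<in> P \<Longrightarrow> \<exists>N. empty_structs (Z N k) \<noteq> {}"
  shows "acyclic (dependency H P)"
proof (rule ccontr)
  let ?E = "dependency H P"
  assume "\<not> acyclic ?E"
  then obtain i0 where i0: "(i0, i0) \<in> ?E\<^sup>+" by (auto simp: acyclic_def)
  \<comment> \<open>The strongly connected component of a vertex on a cycle; by \<open>succ\<close>
    each of its members has a successor inside it.\<close>
  define C where "C = {i. (i0, i) \<in> ?E\<^sup>* \<and> (i, i0) \<in> ?E\<^sup>*}"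
  have succ: "\<exists>j\<in>C. (i, j) \<in> ?E" if "i \<in> C" for i
  proof -
    have "(i, i0) \<in> ?E\<^sup>+" using that i0 by (auto simp: C_def intro: rtrancl_trancl_trancl)
    then obtain j where "(i, j) \<in> ?E" "(j, i0) \<in> ?E\<^sup>*" by (blast dest: tranclD)
    moreover from this have "(i0, j) \<in> ?E\<^sup>*" using that by (auto simp: C_def intro: rtrancl_into_rtrancl)
    ultimately show ?thesis by (auto simp: C_def)
  qed
  have "\<forall>k\<in>P. \<exists>N. y N (Some k) 0 \<noteq> 0"
    using P type_count_nonzero[OF species_iter, of _ _ 0] by (auto simp: y_def std_zero)
  then obtain NP where NP: "\<And>k. k \<in> P \<Longrightarrow> y (NP k) (Some k) 0 \<noteq> 0" by metis
  define N0 where "N0 = Max (range NP)"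
  have PN: "y N (Some k) 0 \<noteq> 0" if "k \<in> P" "N0 \<le> N" for k N
  proof -
    have "NP k \<le> N" using that(2) by (auto simp: N0_def)
    then show ?thesis using NP[OF that(1)] y_mono[of "NP k" N "Some k" 0] by simp
  qed
  obtain l where l: "\<And>p. \<exists>N. \<forall>n\<ge>N. \<forall>i. y n (Some i) p = l i p" and l_nz: "\<And>i. \<exists>p. l i p \<noteq> 0"
    by (rule ex_limit) blast
  have edge: "l j p \<le> l i p" if e: "(i, j) \<in> ?E" for i j p
  proof -
    obtain N1 where N1: "\<And>n i. n \<ge> N1 \<Longrightarrow> y n (Some i) p = l i p" using l[of p] by blast
    define N where "N = max N0 N1"
    obtain f where "inj_on f {..<y N (Some j) p}" "f ` {..<y N (Some j) p} \<subseteq> coloured_types (H i) (y N) p"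
      using edge_colouring[OF e, of N p] PN by (auto simp: N_def)
    from card_inj_on_le[OF this finite_types] have "y N (Some j) p \<le> y (Suc N) (Some i) p" by (simp add: y_Suc)
    then show ?thesis using N1[of N] N1[of "Suc N"] by (simp add: N_def)
  qed
  have path: "l j p \<le> l i p" if "(i, j) \<in> ?E\<^sup>*" for i j p
    using that by (induction rule: rtrancl_induct) (auto intro: order_trans edge)
  have same: "l j p = l i p" if "i \<in> C" "j \<in> C" for i j p
    using that path by (auto simp: C_def intro!: antisym intro: path rtrancl_trans)
  \<comment> \<open>The first stage at which some coordinate of the component acquires a structure
    of any size.\<close>
  define n0 where "n0 = (LEAST n. \<exists>i\<in>C. \<exists>p. y n (Some i) p \<noteq> 0)"
  have "\<exists>n. \<exists>i\<in>C. \<exists>p. y n (Some i) p \<noteq> 0"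
  proof -
    obtain p where "l i0 p \<noteq> 0" using l_nz by blast
    moreover obtain N where "\<forall>n\<ge>N. \<forall>i. y n (Some i) p = l i p" using l by blast
    ultimately have "y N (Some i0) p \<noteq> 0" by simp
    moreover have "i0 \<in> C" by (simp add: C_def)
    ultimately show ?thesis by blast
  qed
  then have ex: "\<exists>i\<in>C. \<exists>p. y n0 (Some i) p \<noteq> 0" unfolding n0_def by (rule LeastI_ex)
  then obtain i p where i: "i \<in> C" "y n0 (Some i) p \<noteq> 0" by blast
  then obtain m where m: "n0 = Suc m" by (cases n0) (auto simp: y_0)
  have zero: "y m (Some j) p = 0" if "j \<in> C" for j
    using not_less_Least[of m "\<lambda>n. \<exists>i\<in>C. \<exists>p. y n (Some i) p \<noteq> 0"] that m by (auto simp: n0_def)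
  obtain j where j: "j \<in> C" "(i, j) \<in> ?E" using succ[OF i(1)] by blast
  obtain N1 where N1: "\<And>n i. n \<ge> N1 \<Longrightarrow> y n (Some i) p = l i p" using l[of p] by blast
  \<comment> \<open>Late enough for the counts of size \<open>p\<close> to be final and for the
    coordinates of \<open>P\<close> to have types of size zero, and not before stage
    \<open>m\<close>.\<close>
  define N where "N = max m (max N0 N1)"
  obtain f where f: "inj_on f {..<y N (Some j) p}" "f ` {..<y N (Some j) p} \<subseteq> coloured_types (H i) (y N) p"
    "\<And>M b. b < y N (Some j) p \<Longrightarrow> f b \<in> coloured_types (H i) (y M) p \<Longrightarrow> y M (Some j) p \<noteq> 0"
    using edge_colouring[OF j(2), of N p] PN by (auto simp: N_def)
  have "card (f ` {..<y N (Some j) p}) = card (coloured_types (H i) (y N) p)"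
  proof -
    have "card (f ` {..<y N (Some j) p}) = l j p" using card_image[OF f(1)] N1[of N] by (simp add: N_def)
    moreover have "card (coloured_types (H i) (y N) p) = l i p"
      using y_Suc[of N i p] N1[of "Suc N"] by (simp add: N_def)
    ultimately show ?thesis using same[OF i(1) j(1)] by simp
  qed
  \<comment> \<open>An injection between finite sets of equal size is onto, so at stage
    \<open>N\<close> every coloured type of \<open>H i\<close> of weight \<open>p\<close> uses a
    type of size \<open>p\<close> of coordinate \<open>j\<close>. One of them exists already at
    stage \<open>m\<close>, where coordinate \<open>j\<close> has no type of that size.\<close>
  then have surj: "f ` {..<y N (Some j) p} = coloured_types (H i) (y N) p"
    by (rule card_subset_eq[OF finite_types f(2)])
  have "coloured_types (H i) (y m) p \<noteq> {}" using i(2) unfolding m y_Suc by auto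
  moreover have "coloured_types (H i) (y m) p \<subseteq> coloured_types (H i) (y N) p"
    by (intro coloured_types_mono y_mono) (simp add: N_def)
  ultimately obtain b where "b < y N (Some j) p" "f b \<in> coloured_types (H i) (y m) p"
    unfolding surj[symmetric] by blast
  then show False using f(3) zero[OF j(1)] by blast
qed

end

section \<open>Generating series of the solution\<close>

text \<open>The orbit count of \<open>ogf_compose\<close> meets that of
  \<open>cycle_index_term_colours\<close>: both use the palettes given by
  \<open>type_count\<close>.\<close>

theorem ogf_compose_cycle_index:
  fixes F :: "('s::finite, 'x) species" and G :: "'s \<Rightarrow> (unit, 'y) species"
  assumes F: "is_species F" and G: "\<And>i. is_species (G i)" and comp: "composable F G"
  shows "univariate (ogf (compose F G)) =
    cycle_index_eval F (\<lambda>i j. fps_compose (univariate (ogf (G i))) (fps_X ^ j))"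
proof (rule fps_ext)
  fix p
  let ?y = "\<lambda>i. type_count (G i)"
  let ?x = "\<lambda>i j. fps_compose (Abs_fps (\<lambda>k. of_nat (?y i k))) (fps_X ^ j) :: rat fps"
  let ?A = "\<lambda>n. deco_orbit F n ` coloured F ?y n p"
  have x: "(\<lambda>i j. fps_compose (univariate (ogf (G i))) (fps_X ^ j)) = ?x"
    by (simp add: univariate_def ogf_type_count[OF G])
  note t = cycle_index_term_colours[OF F, of ?y _ p]
  have "ogf (compose F G) (\<lambda>_. p) = of_nat (\<Sum>n | card (?A n) \<noteq> 0. card (?A n))"
    unfolding ogf_compose(1)[where F = F and G = G, OF F G comp]
    by (rule arg_cong[OF card_Sigma_UNIV]) (rule ogf_compose(2)[where F = F and G = G, OF F G comp])
  also have "\<dots> = fps_nth (cycle_index_eval F ?x) p"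
    unfolding cycle_index_eval_def fps_Sum_def by (simp only: t fps_nth_Abs_fps of_nat_eq_0_iff of_nat_sum)
  finally show "fps_nth (univariate (ogf (compose F G))) p =
    fps_nth (cycle_index_eval F (\<lambda>i j. fps_compose (univariate (ogf (G i))) (fps_X ^ j))) p"
    unfolding x by (simp add: univariate_def)
qed

lemma univariate_ogf_singleton: "univariate (ogf singleton_species) = fps_X"
  by (simp add: univariate_def ogf_type_count[OF singleton_species_species] type_count_singleton fps_eq_iff)

lemma univariate_egf_singleton: "univariate (egf singleton_species) = fps_X"
  by (simp add: univariate_def egf_def singleton_species_def std_def UNIV_unit fps_eq_iff)

theorem mainTheorem9:
  fixes H :: "'m::finite \<Rightarrow> ('m option, 'x) species"
    and S :: "'m \<Rightarrow> (unit, 'y) species"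
  assumes "\<And>i. is_species (H i)"
    and "well_founded_system H"
    and "system_solution H S"
  shows "((\<forall>i. asymmetric_in (H i) (Some ` {j. empty_structs (S j) \<noteq> {}})) \<longrightarrow>
            (\<forall>n. newton_egf_defined H ((newton_egf H ^^ n) 0)) \<and>
            converges_quadratically (\<lambda>n. (newton_egf H ^^ n) 0) (\<chi> i. univariate (egf (S i)))) \<and>
         ((\<forall>n. newton_polya_defined H ((newton_polya H ^^ n) 0)) \<and>
            converges_quadratically (\<lambda>n. (newton_polya H ^^ n) 0) (\<chi> i. univariate (ogf (S i))))"
proof -
  note H = assms(1)
  interpret well_founded_iteration H using assms(1,2) by unfold_locales
  define P where "P = {j. empty_structs (S j) \<noteq> {}}"
  let ?G = "case_option singleton_species (\<lambda>j. recode (S j))"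
  have S: "is_species (S i)" and comp: "composable (H i) ?G"
    and iso: "S i \<simeq>\<^sub>s compose (H i) ?G"
    and init: "compose (S i) (\<lambda>_. empty_species :: (unit, nat) species)
      \<simeq>\<^sub>s system_iter H (empty_species :: (unit, nat) species) CARD('m) i" for i
    using assms(3) by (simp_all add: system_solution_def apply_system_def)
  have G: "is_species (?G s)" for s
    using recode_species[OF S] singleton_species_species by (cases s) simp_all
  have GP: "{s. empty_structs (?G s) \<noteq> {}} = Some ` P"
  proof (intro set_eqI)
    fix s
    show "s \<in> {s. empty_structs (?G s) \<noteq> {}} \<longleftrightarrow> s \<in> Some ` P"
      by (cases s) (auto simp: P_def empty_structs_singleton empty_structs_recode)
  qed
  have poly: "polynomial_in (H i) (Some ` P)" for i
    using comp[of i] unfolding composable_def GP .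
  \<comment> \<open>Such a structure of \<open>H i\<close>, filled with structures of
    \<open>S\<close> on the empty set, is a structure of \<open>H(Z, S)\<close> on the empty set,
    and the isomorphism carries it to \<open>S i\<close>.\<close>
  have closed: "i \<in> P" if n: "structs (H i) (std n) \<noteq> {}" "\<And>k. k \<notin> Some ` P \<Longrightarrow> n k = 0" for i n
  proof -
    have "empty_structs (?G s) \<noteq> {}" if "n s \<noteq> 0" for s
    proof -
      have "s \<in> Some ` P" using n(2)[of s] that by auto
      then show ?thesis unfolding GP[symmetric] by simp
    qed
    then have "empty_structs (compose (H i) ?G) \<noteq> {}"
      unfolding empty_structs_compose using n(1) by blast
    then show ?thesis using species_iso_empty[OF iso finite_tuple_empty] by (simp add: P_def)
  qed
  have acyclic: "acyclic (dependency H P)"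
  proof (rule acyclic_dependency)
    \<comment> \<open>A structure of \<open>S k\<close> on the empty set survives the substitution
      of the empty species for \<open>Z\<close>, so by the condition on \<open>S(0)\<close> the
      iterate of index \<open>CARD('m)\<close> has one as well.\<close>
    fix k assume "k \<in> P"
    then have "structs (S k) (std (\<lambda>_. 0)) \<noteq> {}" by (simp add: P_def std_zero)
    then have "empty_structs (compose (S k) (\<lambda>_. empty_species :: (unit, nat) species)) \<noteq> {}"
      unfolding empty_structs_compose by (intro exI[of _ "\<lambda>_. 0"]) simp
    then have "empty_structs (system_iter H (empty_species :: (unit, nat) species) CARD('m) k) \<noteq> {}"
      using species_iso_empty[OF init finite_tuple_empty] by blast
    then show "\<exists>N. empty_structs (Z N k) \<noteq> {}"
      by (intro exI[of _ "CARD('m)"] system_iter_empty_structs)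
  qed
  have egf_0: "fps_nth (univariate (egf (S i))) 0 = 0" and ogf_0: "fps_nth (univariate (ogf (S i))) 0 = 0" if "i \<notin> P" for i
    using that by (simp_all add: P_def univariate_def egf_def ogf_def std_zero)

  have polya: "newton_iteration H P (\<chi> i. univariate (ogf (S i))) dilate"
  proof
    fix Y Y' :: "rat fps ^ 'm" and i :: "'m option" and j p :: nat
    show "dilate Y i 1 = with_z Y i"
      by (rule fps_ext) (simp add: dilate_def fps_nth_compose_X_power[of 1, simplified])
    show "fps_X ^ j dvd dilate Y i j" if "fps_nth (with_z Y i) 0 = 0" "0 < j"
      using that by (auto simp: fps_X_power_dvd_iff dilate_def fps_nth_compose_X_power dest: dvd_imp_le)
    show "fps_X ^ (2 * p) dvd dilate Y i j - dilate Y' i j" if a: "agree_upto p Y Y'" and j: "1 < j"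
      unfolding fps_X_power_dvd_iff
    proof (intro allI impI)
      fix k assume k: "k < 2 * p"
      \<comment> \<open>From \<open>k < 2 * p\<close> and \<open>j > 1\<close> follows
        \<open>k div j < p\<close>, where the two series agree.\<close>
      have "fps_nth (with_z Y i) (k div j) = fps_nth (with_z Y' i) (k div j)"
      proof (cases i)
        case (Some l)
        have "k div j \<le> k div 2" using j by (intro div_le_mono2) auto
        then have "k div j < p" using k by linarith
        then show ?thesis using a Some by (simp add: agree_upto_def with_z_def)
      qed (simp add: with_z_def)
      then show "fps_nth (dilate Y i j - dilate Y' i j) k = 0"
        using j by (simp add: dilate_def fps_nth_compose_X_power)
    qed
  next
    fix Y Y' :: "rat fps ^ 'm" and i and j :: nat
    assume "0 < j" "fps_nth (Y $ i) 0 = fps_nth (Y' $ i) 0"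
    then show "fps_nth (dilate Y (Some i) j) 0 = fps_nth (dilate Y' (Some i) j) 0"
      by (simp add: dilate_def with_z_def fps_nth_compose_X_power)
  next
    fix i
    let ?S = "\<chi> i. univariate (ogf (S i))"
    have z: "univariate (ogf (?G s)) = with_z ?S s" for s
      using ogf_iso[OF S recode_species[OF S] recode_iso[OF S]]
      by (cases s) (simp_all add: univariate_ogf_singleton[unfolded univariate_def] with_z_def univariate_def)
    have "univariate (ogf (S i)) = univariate (ogf (compose (H i) ?G))"
      using ogf_iso[OF S compose_species[OF H G comp] iso] by (simp add: univariate_def)
    also have "\<dots> = cycle_index_eval (H i) (dilate ?S)"
      unfolding ogf_compose_cycle_index[where F = "H i" and G = ?G, OF H G comp] z
      by (rule arg_cong[where f = "cycle_index_eval (H i)"]) (simp add: fun_eq_iff dilate_def)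
    finally show "cycle_index_eval (H i) (dilate ?S) = ?S $ i" by simp
  qed (auto simp: H poly acyclic ogf_0 intro: closed)
  interpret polya: newton_iteration H P "\<chi> i. univariate (ogf (S i))" dilate by (rule polya)
  have polya_jac: "polya.jac = polya_jacobian H"
    by (simp add: fun_eq_iff polya.jac_def polya_jacobian_def polya_def)
  have polya_step: "polya.step = newton_polya H"
    by (simp add: fun_eq_iff polya.step_def newton_polya_def polya_jac polya_def)

  have "(\<forall>n. newton_egf_defined H ((newton_egf H ^^ n) 0)) \<and>
      converges_quadratically (\<lambda>n. (newton_egf H ^^ n) 0) (\<chi> i. univariate (egf (S i)))"
    if asym: "\<forall>i. asymmetric_in (H i) (Some ` P)"
  proof -
    let ?l = "\<lambda>Y :: rat fps ^ 'm. linear_subst (with_z Y)"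
    let ?S = "\<chi> i. univariate (egf (S i))"
    have term_H: "series_term (egf (H i)) X = cycle_index_term (H i) (linear_subst X)" for i X
      by (rule ext, rule series_term_egf) (simp add: transport_id[OF H])
    have term_D: "series_term (series_deriv k (egf (H i))) X = cycle_index_term (partial_deriv k (H i)) (linear_subst X)" for i k X
      unfolding series_deriv_egf[OF H] by (rule ext, rule series_term_egf) (rule partial_deriv_transport_id[OF H])
    have egf: "newton_iteration H P ?S ?l"
    proof
      fix Y Y' :: "rat fps ^ 'm" and i :: "'m option" and j p :: nat
      show "fps_X ^ j dvd ?l Y i j" if "fps_nth (with_z Y i) 0 = 0" "0 < j"
        using that by (auto simp: fps_X_power_dvd_iff linear_subst_def)
    next
      fix i
      have z: "(\<lambda>s. univariate (egf (?G s))) = with_z ?S"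
      proof
        fix s
        show "univariate (egf (?G s)) = with_z ?S s"
          using egf_iso[OF recode_iso[OF S]]
          by (cases s) (simp_all add: univariate_egf_singleton[unfolded univariate_def] with_z_def univariate_def)
      qed
      have "univariate (egf (S i)) = univariate (egf (compose (H i) ?G))"
        using egf_iso[OF iso] by (simp add: univariate_def)
      \<comment> \<open>The asymmetry hypothesis enters here: by \<open>GP\<close> the sorts that
        admit empty blocks are those of \<open>P\<close>.\<close>
      also have "\<dots> = series_eval (egf (H i)) (with_z ?S)"
        unfolding z[symmetric] by (rule egf_compose[OF H G comp]) (use asym GP in simp)
      also have "\<dots> = cycle_index_eval (H i) (?l ?S)"
        by (simp add: series_eval_def cycle_index_eval_def term_H)
      finally show "cycle_index_eval (H i) (?l ?S) = ?S $ i" by simp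
    qed (auto simp: H poly acyclic egf_0 linear_subst_def with_z_def intro: closed)
    interpret egf: newton_iteration H P ?S ?l by (rule egf)
    have jac: "egf.jac = egf_jacobian H"
      by (simp add: fun_eq_iff egf.jac_def egf_jacobian_def series_eval_def cycle_index_eval_def term_D)
    have step: "egf.step = newton_egf H"
      by (simp add: fun_eq_iff egf.step_def newton_egf_def jac series_eval_def cycle_index_eval_def term_H)
    show ?thesis
      using egf.newton_converges unfolding step jac newton_egf_defined_def term_H term_D by blast
  qed
  moreover have "(\<forall>n. newton_polya_defined H ((newton_polya H ^^ n) 0)) \<and>
      converges_quadratically (\<lambda>n. (newton_polya H ^^ n) 0) (\<chi> i. univariate (ogf (S i)))"
    using polya.newton_converges unfolding polya_step polya_jac newton_polya_defined_def by blast
  ultimately show ?thesis unfolding P_def by blast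
qed

end
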